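(* Let $\nu:S\to J(\mathcal H)$ be a normal function over a complex manifold $S$, given as an extension $0\to\mathcal H\to\mathcal V\to\mathbb Z(0)\to0$ of variations of mixed Hodge structure, where $\mathcal H$ is a polarized variation of pure Hodge structure of weight $-1$. 1. The pullback of the mixed Hodge metric along the normal function (that is, along the period map of $\mathcal V$) is pseudo-Kähler. 2. If the underlying variation of pure Hodge structure $\mathcal H$ is constant (e.g. for a family of cycles on a fixed smooth projective variety), then the holomorphic sectional curvature of the pullback of the mixed Hodge metric is semi-negative.
   Context: Period map of $\mathcal V$: the associated holomorphic, horizontal, locally liftable map $S\to\Gamma\backslash D$, with $D$ the classifying space of graded-polarized mixed Hodge structures with the weight filtration, graded polarizations and Hodge numbers of the fibres of $\mathcal V$, and $\Gamma$ the monodromy group. Mixed Hodge metric on $D$: $D$ consists of the filtrations $F$ of the fixed space $V_{\mathbb C}$ forming with the fixed weight filtration $W$ a mixed Hodge structure graded-polarized by fixed forms $Q_k$ on $\operatorname{gr}^W_k$ with fixed Hodge numbers. For $F\in D$ the Deligne bigrading is the unique functorial $V_{\mathbb C}=\bigoplus I^{p,q}$ with $F^p=\bigoplus_{a\ge p}I^{a,b}$, $W_k=\bigoplus_{a+b\le k}I^{a,b}$, $\overline{I^{p,q}}\equiv I^{q,p}$ mod $\bigoplus_{a<q,b<p}I^{a,b}$. Let $h_F$ be the metric on $V_{\mathbb C}$ making it orthogonal with $h_F(u,v)=\mathrm i^{p-q}Q_{p+q}([u],[\bar v])$ on $I^{p,q}$; on $\operatorname{End}(V_{\mathbb C})$,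 $h_F(\alpha,\beta)=\operatorname{Tr}(\alpha\beta^* )$. Let $\mathfrak g_{\mathbb C}$ be the Lie algebra of the group $G_{\mathbb C}$ of automorphisms of $V_{\mathbb C}$ preserving $W$ and the $Q_k$ on $\operatorname{gr}^W$, $\mathfrak g^{r,s}$ its elements mapping each $I^{p,q}$ to $I^{p+r,q+s}$, $\mathfrak q_F=\bigoplus_{r<0}\mathfrak g^{r,s}\cong T_F^{1,0}D$ via $u\mapsto\frac{d}{dt}|_0e^{tu}\cdot F$. The mixed Hodge metric on $T(D)$ is $h_F|_{\mathfrak q_F}$; it is invariant under the real group $G_{\mathbb R}=G_{\mathbb C}\cap GL(V_{\mathbb R})$, which contains $\Gamma$. Horizontal means tangent to $\bigoplus_s\mathfrak g^{-1,s}$. The pullback is a pseudo-metric (semi-positive hermitian form on each holomorphic tangent space); pseudo-Kähler means its associated $(1,1)$-form is closed. Holomorphic sectional curvature is that of the Chern connection of the pulled back metric (considered where it is non-degenerate); for a metric $h\,|ds|^2$ on a curve it is $-h^{-1}\partial_s\partial_{\bar s}\log h$; semi-negative means $\le0$. *)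

theory Defs
  imports "HOL-Analysis.Analysis"
begin

section \<open>Rational structure and matrices\<close>

text \<open>
  The fixed space is \<open>V\<^sub>\<int> = \<int>\<^sup>n \<subseteq> V\<^sub>\<complex> = \<complex>\<^sup>n\<close>, with \<open>n\<close> the cardinality of the index type;
  endomorphisms are matrices.
\<close>

definition vcnj :: "complex^'n \<Rightarrow> complex^'n" where
  "vcnj x = (\<chi> i. cnj (x $ i))"

definition integral_vec :: "complex^'n \<Rightarrow> bool" where
  "integral_vec x \<longleftrightarrow> (\<forall>i. x $ i \<in> \<int>)"

definition rational_vec :: "complex^'n \<Rightarrow> bool" where
  "rational_vec x \<longleftrightarrow> (\<forall>i. x $ i \<in> \<rat>)"

definition integral_mat :: "complex^'m^'n \<Rightarrow> bool" where
  "integral_mat A \<longleftrightarrow> (\<forall>i j. A $ i $ j \<in> \<int>)"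

definition GL_int :: "(complex^'n^'n) set" where
  "GL_int = {g. invertible g \<and> integral_mat g \<and> integral_mat (matrix_inv g)}"


section \<open>Graded-polarized mixed Hodge structures\<close>

type_synonym 'n filtration = "int \<Rightarrow> (complex^'n) set"

text \<open>
  The form \<open>Q k\<close> on \<open>gr\<^sup>W\<^sub>k\<close> is given as a form on \<open>W k\<close> that vanishes on \<open>W (k - 1)\<close>;
  its values outside \<open>W k\<close> are irrelevant.
\<close>
type_synonym 'n graded_form = "int \<Rightarrow> complex^'n \<Rightarrow> complex^'n \<Rightarrow> complex"

definition weight_filtration :: "'n::finite filtration \<Rightarrow> bool" where
  "weight_filtration W \<longleftrightarrow>
     mono W \<and> (\<exists>k. W k = {0}) \<and> (\<exists>k. W k = UNIV) \<and>
     (\<forall>k. W k = vec.span {x \<in> W k. rational_vec x})"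

definition graded_forms :: "'n::finite filtration \<Rightarrow> 'n graded_form \<Rightarrow> bool" where
  "graded_forms W Q \<longleftrightarrow> (\<forall>k.
     (\<forall>x\<in>W k. \<forall>y\<in>W k. \<forall>z\<in>W k. \<forall>c.
        Q k (x + y) z = Q k x z + Q k y z \<and> Q k (c *s x) z = c * Q k x z) \<and>
     (\<forall>x\<in>W k. \<forall>y\<in>W k. Q k y x = (-1) powi k * Q k x y) \<and>
     (\<forall>x\<in>W (k - 1). \<forall>y\<in>W k. Q k x y = 0) \<and>
     (\<forall>x\<in>W k. \<forall>y\<in>W k. rational_vec x \<longrightarrow> rational_vec y \<longrightarrow> Q k x y \<in> \<rat>))"

text \<open>Preimages in \<open>W k\<close> of \<open>F\<^sup>p gr\<^sup>W\<^sub>k\<close> and of the Hodge component \<open>(gr\<^sup>W\<^bsub>p+q\<^esub>)\<^bsup>p,q\<^esup>\<close>.\<close>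

definition gr_filt :: "'n::finite filtration \<Rightarrow> 'n filtration \<Rightarrow> int \<Rightarrow> int \<Rightarrow> (complex^'n) set" where
  "gr_filt W F k p = {x + y | x y. x \<in> F p \<inter> W k \<and> y \<in> W (k - 1)}"

definition gr_comp :: "'n::finite filtration \<Rightarrow> 'n filtration \<Rightarrow> int \<Rightarrow> int \<Rightarrow> (complex^'n) set" where
  "gr_comp W F p q = gr_filt W F (p + q) p \<inter> vcnj ` gr_filt W F (p + q) q"

definition mixed_hodge_structure :: "'n::finite filtration \<Rightarrow> 'n filtration \<Rightarrow> bool" where
  "mixed_hodge_structure W F \<longleftrightarrow>
     weight_filtration W \<and>
     (\<forall>p. vec.subspace (F p)) \<and> antimono F \<and> (\<exists>p. F p = UNIV) \<and> (\<exists>p. F p = {0}) \<and>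
     (\<forall>k p. {x + y | x y. x \<in> gr_filt W F k p \<and> y \<in> vcnj ` gr_filt W F k (k - p + 1)} = W k \<and>
            gr_filt W F k p \<inter> vcnj ` gr_filt W F k (k - p + 1) = W (k - 1))"

definition graded_polarized :: "'n::finite filtration \<Rightarrow> 'n graded_form \<Rightarrow> 'n filtration \<Rightarrow> bool" where
  "graded_polarized W Q F \<longleftrightarrow>
     graded_forms W Q \<and>
     (\<forall>k p. \<forall>x\<in>gr_filt W F k p. \<forall>y\<in>gr_filt W F k (k - p + 1). Q k x y = 0) \<and>
     (\<forall>p q. \<forall>x \<in> gr_comp W F p q - W (p + q - 1).
        Im (\<i> powi (p - q) * Q (p + q) x (vcnj x)) = 0 \<and>
        Re (\<i> powi (p - q) * Q (p + q) x (vcnj x)) > 0)"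

text \<open>The classifying space \<open>D\<close> for weight filtration \<open>W\<close>, forms \<open>Q\<close> and Hodge numbers \<open>h\<close>.\<close>

definition classifying_space ::
    "'n::finite filtration \<Rightarrow> 'n graded_form \<Rightarrow> (int \<Rightarrow> int \<Rightarrow> nat) \<Rightarrow> 'n filtration set" where
  "classifying_space W Q h =
     {F. mixed_hodge_structure W F \<and> graded_polarized W Q F \<and>
         (\<forall>p q. vec.dim (gr_comp W F p q) = h p q + vec.dim (W (p + q - 1)))}"


section \<open>The mixed Hodge metric\<close>

definition bigraded_sum :: "(int \<Rightarrow> int \<Rightarrow> (complex^'n::finite) set) \<Rightarrow> (int \<Rightarrow> int \<Rightarrow> bool) \<Rightarrow> (complex^'n) set" where
  "bigraded_sum I P = vec.span (\<Union>{I a b | a b. P a b})"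

definition is_deligne_bigrading ::
    "'n::finite filtration \<Rightarrow> 'n filtration \<Rightarrow> (int \<Rightarrow> int \<Rightarrow> (complex^'n) set) \<Rightarrow> bool" where
  "is_deligne_bigrading W F I \<longleftrightarrow>
     (\<forall>p q. vec.subspace (I p q)) \<and>
     bigraded_sum I (\<lambda>a b. True) = UNIV \<and>
     (\<forall>T f. finite T \<longrightarrow> (\<forall>(a, b)\<in>T. f (a, b) \<in> I a b) \<longrightarrow> sum f T = 0 \<longrightarrow> (\<forall>t\<in>T. f t = 0)) \<and>
     (\<forall>p. F p = bigraded_sum I (\<lambda>a b. a \<ge> p)) \<and>
     (\<forall>k. W k = bigraded_sum I (\<lambda>a b. a + b \<le> k)) \<and>
     (\<forall>p q. {vcnj x + r | x r. x \<in> I p q \<and> r \<in> bigraded_sum I (\<lambda>a b. a < q \<and> b < p)} =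
            {y + r | y r. y \<in> I q p \<and> r \<in> bigraded_sum I (\<lambda>a b. a < q \<and> b < p)})"

definition deligne_bigrading ::
    "'n::finite filtration \<Rightarrow> 'n filtration \<Rightarrow> int \<Rightarrow> int \<Rightarrow> (complex^'n) set" where
  "deligne_bigrading W F = (THE I. is_deligne_bigrading W F I)"

text \<open>Sesquilinear forms are complex linear in the first argument.\<close>

definition sesquilinear :: "(complex^'n \<Rightarrow> complex^'n \<Rightarrow> complex) \<Rightarrow> bool" where
  "sesquilinear h \<longleftrightarrow>
     (\<forall>x y z. h (x + y) z = h x z + h y z \<and> h x (y + z) = h x y + h x z) \<and>
     (\<forall>c x y. h (c *s x) y = c * h x y \<and> h x (c *s y) = cnj c * h x y)"

definition hodge_form ::
    "'n::finite filtration \<Rightarrow> 'n graded_form \<Rightarrow> 'n filtration \<Rightarrow> complex^'n \<Rightarrow> complex^'n \<Rightarrow> complex" where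
  "hodge_form W Q F = (THE h. sesquilinear h \<and>
     (\<forall>p q a b. (p, q) \<noteq> (a, b) \<longrightarrow>
        (\<forall>u\<in>deligne_bigrading W F p q. \<forall>v\<in>deligne_bigrading W F a b. h u v = 0)) \<and>
     (\<forall>p q. \<forall>u\<in>deligne_bigrading W F p q. \<forall>v\<in>deligne_bigrading W F p q.
        h u v = \<i> powi (p - q) * Q (p + q) u (vcnj v)))"

definition form_adjoint ::
    "(complex^'n::finite \<Rightarrow> complex^'n \<Rightarrow> complex) \<Rightarrow> complex^'n^'n \<Rightarrow> complex^'n^'n" where
  "form_adjoint h B = (THE C. \<forall>x y. h (B *v x) y = h x (C *v y))"

definition mixed_hodge_metric ::
    "'n::finite filtration \<Rightarrow> 'n graded_form \<Rightarrow> 'n filtration \<Rightarrow> complex^'n^'n \<Rightarrow> complex^'n^'n \<Rightarrow> complex" where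
  "mixed_hodge_metric W Q F \<alpha> \<beta> = trace (\<alpha> ** form_adjoint (hodge_form W Q F) \<beta>)"

definition lie_algebra :: "'n::finite filtration \<Rightarrow> 'n graded_form \<Rightarrow> (complex^'n^'n) set" where
  "lie_algebra W Q = {X. \<forall>k. (*v) X ` W k \<subseteq> W k \<and>
     (\<forall>x\<in>W k. \<forall>y\<in>W k. Q k (X *v x) y + Q k x (X *v y) = 0)}"

definition lie_component ::
    "'n::finite filtration \<Rightarrow> 'n graded_form \<Rightarrow> 'n filtration \<Rightarrow> int \<Rightarrow> int \<Rightarrow> (complex^'n^'n) set" where
  "lie_component W Q F r s = {X \<in> lie_algebra W Q.
     \<forall>p q. (*v) X ` deligne_bigrading W F p q \<subseteq> deligne_bigrading W F (p + r) (q + s)}"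

definition tangent_algebra ::
    "'n::finite filtration \<Rightarrow> 'n graded_form \<Rightarrow> 'n filtration \<Rightarrow> (complex^'n^'n) set" where
  "tangent_algebra W Q F = {sum f T | f T. finite T \<and>
     (\<forall>(r, s)\<in>T. r < 0 \<and> f (r, s) \<in> lie_component W Q F r s)}"


section \<open>Holomorphic maps and complex manifolds\<close>

definition hol_on :: "(complex^'d) set \<Rightarrow> (complex^'d \<Rightarrow> complex^'n) \<Rightarrow> bool" where
  "hol_on A f \<longleftrightarrow> (\<forall>z\<in>A. \<exists>D. (f has_derivative D) (at z) \<and> (\<forall>c x. D (c *s x) = c *s D x))"

type_synonym ('s, 'd) chart = "'s set \<times> ('s \<Rightarrow> complex^'d)"

definition complex_atlas :: "('s::t2_space, 'd::finite) chart set \<Rightarrow> bool" where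
  "complex_atlas \<A> \<longleftrightarrow>
     \<Union>(fst ` \<A>) = UNIV \<and>
     (\<forall>(U, \<phi>)\<in>\<A>. open U \<and> open (\<phi> ` U) \<and> homeomorphism U (\<phi> ` U) \<phi> (inv_into U \<phi>)) \<and>
     (\<forall>(U, \<phi>)\<in>\<A>. \<forall>(U', \<psi>)\<in>\<A>. hol_on (\<phi> ` (U \<inter> U')) (\<lambda>z. \<psi> (inv_into U \<phi> z)))"

definition locally_constant_on :: "'s::topological_space set \<Rightarrow> ('s \<Rightarrow> 'a) \<Rightarrow> bool" where
  "locally_constant_on U f \<longleftrightarrow>
     (\<forall>s\<in>U. \<exists>N. open N \<and> s \<in> N \<and> (\<forall>t\<in>N \<inter> U. f t = f s))"


section \<open>Holomorphically varying filtrations\<close>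

definition filt_section ::
    "(complex^'d \<Rightarrow> 'n::finite filtration) \<Rightarrow> int \<Rightarrow> (complex^'d) set \<Rightarrow> (complex^'d \<Rightarrow> complex^'n) \<Rightarrow> bool" where
  "filt_section \<Psi> p N \<sigma> \<longleftrightarrow> open N \<and> hol_on N \<sigma> \<and> (\<forall>z\<in>N. \<sigma> z \<in> \<Psi> z p)"

text \<open>A map into a flag variety is holomorphic iff its steps have local holomorphic frames.\<close>

definition holomorphic_filtration :: "(complex^'d) set \<Rightarrow> (complex^'d \<Rightarrow> 'n::finite filtration) \<Rightarrow> bool" where
  "holomorphic_filtration A \<Psi> \<longleftrightarrow> (\<forall>p. \<forall>z\<^sub>0\<in>A. \<exists>N (r::nat) e. z\<^sub>0 \<in> N \<and> N \<subseteq> A \<and>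
     (\<forall>i<r. filt_section \<Psi> p N (e i)) \<and> open N \<and>
     (\<forall>z\<in>N. inj_on (\<lambda>i. e i z) {..<r} \<and> vec.independent ((\<lambda>i. e i z) ` {..<r}) \<and>
            \<Psi> z p = vec.span ((\<lambda>i. e i z) ` {..<r})))"

definition griffiths_transversal :: "(complex^'d::finite) set \<Rightarrow> (complex^'d \<Rightarrow> 'n::finite filtration) \<Rightarrow> bool" where
  "griffiths_transversal A \<Psi> \<longleftrightarrow> (\<forall>p N \<sigma>. N \<subseteq> A \<longrightarrow> filt_section \<Psi> p N \<sigma> \<longrightarrow>
     (\<forall>z\<in>N. \<forall>v. frechet_derivative \<sigma> (at z) v \<in> \<Psi> z (p - 1)))"

text \<open>
  The tangent space at \<open>F\<close> of the flag variety lies in the product of the \<open>Hom(F\<^sup>p, V/F\<^sup>p)\<close>.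
  There the derivative of \<open>\<Psi>\<close> along \<open>v\<close> sends \<open>\<sigma>(z)\<close> to the class of the derivative of \<open>\<sigma>\<close>, for local
  holomorphic sections \<open>\<sigma>\<close> of \<open>F\<^sup>p\<close>, and the initial velocity of \<open>exp(tu) F\<close> sends \<open>x\<close> to the class
  of \<open>u x\<close>. So the element of the tangent algebra singled out below represents the derivative of \<open>\<Psi>\<close>.
\<close>

definition period_derivative ::
    "'n::finite filtration \<Rightarrow> 'n graded_form \<Rightarrow> (complex^'d::finite) set \<Rightarrow> (complex^'d \<Rightarrow> 'n filtration) \<Rightarrow>
     complex^'d \<Rightarrow> complex^'d \<Rightarrow> complex^'n^'n" where
  "period_derivative W Q A \<Psi> z v = (THE u. u \<in> tangent_algebra W Q (\<Psi> z) \<and>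
     (\<forall>p N \<sigma>. N \<subseteq> A \<longrightarrow> z \<in> N \<longrightarrow> filt_section \<Psi> p N \<sigma> \<longrightarrow>
        frechet_derivative \<sigma> (at z) v - u *v \<sigma> z \<in> \<Psi> z p))"


section \<open>Variations of mixed Hodge structure\<close>

text \<open>
  Each fibre is identified with the fixed space, compatibly with the lattice, \<open>W\<close> and \<open>Q\<close>; these
  identifications need not be continuous in the base point. The local system is recorded by its
  flat frames \<open>(U, g)\<close>: for \<open>s \<in> U\<close> the matrix \<open>g s\<close> maps the fixed space to the fibre at \<open>s\<close>, and the
  transitions are locally constant. So \<open>s \<mapsto> (g s)\<^sup>-\<^sup>1 \<cdot> F s\<close> is the local lift to \<open>D\<close> of the period map
  that belongs to the frame, and two lifts differ by elements of \<open>aut_int W Q\<close>.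
\<close>

record ('s, 'n) variation =
  weight :: "int \<Rightarrow> (complex^'n) set"
  form :: "int \<Rightarrow> complex^'n \<Rightarrow> complex^'n \<Rightarrow> complex"
  hodge_number :: "int \<Rightarrow> int \<Rightarrow> nat"
  frames :: "('s set \<times> ('s \<Rightarrow> complex^'n^'n)) set"
  hodge :: "'s \<Rightarrow> int \<Rightarrow> (complex^'n) set"

definition aut_int :: "'n::finite filtration \<Rightarrow> 'n graded_form \<Rightarrow> (complex^'n^'n) set" where
  "aut_int W Q = {g \<in> GL_int. \<forall>k. (*v) g ` W k = W k \<and>
     (\<forall>x\<in>W k. \<forall>y\<in>W k. Q k (g *v x) (g *v y) = Q k x y)}"

definition lift_domain :: "('s, 'd) chart \<Rightarrow> 's set \<times> ('s \<Rightarrow> complex^'n^'n) \<Rightarrow> (complex^'d) set" where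
  "lift_domain c f = snd c ` (fst c \<inter> fst f)"

definition period_lift ::
    "('s, 'n::finite) variation \<Rightarrow> ('s, 'd) chart \<Rightarrow> 's set \<times> ('s \<Rightarrow> complex^'n^'n) \<Rightarrow> complex^'d \<Rightarrow> 'n filtration" where
  "period_lift V c f z p =
     (let s = inv_into (fst c) (snd c) z in (*v) (matrix_inv (snd f s)) ` hodge V s p)"

definition vmhs :: "('s::t2_space, 'd::finite) chart set \<Rightarrow> ('s, 'n::finite) variation \<Rightarrow> bool" where
  "vmhs \<A> V \<longleftrightarrow>
     \<Union>(fst ` frames V) = UNIV \<and>
     (\<forall>(U, g)\<in>frames V. open U \<and> (\<forall>s\<in>U. g s \<in> aut_int (weight V) (form V))) \<and>
     (\<forall>(U, g)\<in>frames V. \<forall>(U', g')\<in>frames V.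
        locally_constant_on (U \<inter> U') (\<lambda>s. matrix_inv (g' s) ** g s)) \<and>
     (\<forall>s. hodge V s \<in> classifying_space (weight V) (form V) (hodge_number V)) \<and>
     (\<forall>c\<in>\<A>. \<forall>f\<in>frames V.
        holomorphic_filtration (lift_domain c f) (period_lift V c f) \<and>
        griffiths_transversal (lift_domain c f) (period_lift V c f))"

definition pure_of_weight :: "int \<Rightarrow> ('s, 'n::finite) variation \<Rightarrow> bool" where
  "pure_of_weight w V \<longleftrightarrow> (\<forall>k. weight V k = (if k < w then {0} else UNIV))"

definition constant_variation :: "('s::topological_space, 'n::finite) variation \<Rightarrow> bool" where
  "constant_variation V \<longleftrightarrow> (\<exists>g. (\<forall>s. g s \<in> GL_int) \<and>
     (\<forall>(U, f)\<in>frames V. locally_constant_on U (\<lambda>s. matrix_inv (f s) ** g s)) \<and>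
     (\<forall>s t p. (*v) (matrix_inv (g s)) ` hodge V s p = (*v) (matrix_inv (g t)) ` hodge V t p))"

definition Z0 :: "('s, 1) variation" where
  "Z0 = \<lparr> weight = (\<lambda>k. if k < 0 then {0} else UNIV),
          form = (\<lambda>k x y. if k = 0 then x $ 1 * y $ 1 else 0),
          hodge_number = (\<lambda>p q. if p = 0 \<and> q = 0 then 1 else 0),
          frames = {(UNIV, \<lambda>s. mat 1)},
          hodge = (\<lambda>s p. if p \<le> 0 then UNIV else {0}) \<rparr>"

definition vmhs_morphism ::
    "('s::topological_space, 'm::finite) variation \<Rightarrow> ('s, 'n::finite) variation \<Rightarrow> ('s \<Rightarrow> complex^'m^'n) \<Rightarrow> bool" where
  "vmhs_morphism A B \<phi> \<longleftrightarrow>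
     (\<forall>s. integral_mat (\<phi> s) \<and>
        (\<forall>k. (*v) (\<phi> s) ` weight A k \<subseteq> weight B k) \<and>
        (\<forall>p. (*v) (\<phi> s) ` hodge A s p \<subseteq> hodge B s p)) \<and>
     (\<forall>(U, f)\<in>frames A. \<forall>(U', g)\<in>frames B.
        locally_constant_on (U \<inter> U') (\<lambda>s. matrix_inv (g s) ** (\<phi> s ** f s)))"

text \<open>
  The sequence is exact on the lattices. The last two clauses say that the graded
  polarization of \<open>V\<close> is the given one on \<open>H\<close> and the standard one on \<open>\<int>(0)\<close>.
\<close>

definition extension_by_Z0 ::
    "('s::topological_space, 'm::finite) variation \<Rightarrow> ('s, 'n::finite) variation \<Rightarrow>
     ('s \<Rightarrow> complex^'m^'n) \<Rightarrow> ('s \<Rightarrow> complex^'n^1) \<Rightarrow> bool" where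
  "extension_by_Z0 H V \<iota> \<pi> \<longleftrightarrow>
     vmhs_morphism H V \<iota> \<and> vmhs_morphism V Z0 \<pi> \<and>
     (\<forall>s. inj_on ((*v) (\<iota> s)) {x. integral_vec x} \<and>
        (*v) (\<iota> s) ` {x. integral_vec x} = {y. integral_vec y \<and> \<pi> s *v y = 0} \<and>
        (*v) (\<pi> s) ` {y. integral_vec y} = {x. integral_vec x}) \<and>
     (\<forall>s. \<forall>x\<in>weight H (-1). \<forall>y\<in>weight H (-1).
        form V (-1) (\<iota> s *v x) (\<iota> s *v y) = form H (-1) x y) \<and>
     (\<forall>s. \<forall>x\<in>weight V 0. \<forall>y\<in>weight V 0.
        form V 0 x y = form (Z0 :: ('s, 1) variation) 0 (\<pi> s *v x) (\<pi> s *v y))"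

text \<open>
  The pullback of the mixed Hodge metric along a local lift of the period map, in a chart. The
  holomorphic tangent spaces are \<open>\<complex>\<^sup>d\<close> via the coordinate fields.
\<close>

definition pullback_metric ::
    "('s, 'n::finite) variation \<Rightarrow> ('s, 'd::finite) chart \<Rightarrow> 's set \<times> ('s \<Rightarrow> complex^'n^'n) \<Rightarrow>
     complex^'d \<Rightarrow> complex^'d \<Rightarrow> complex^'d \<Rightarrow> complex" where
  "pullback_metric V c f z v w =
     (let d = period_derivative (weight V) (form V) (lift_domain c f) (period_lift V c f) z
      in mixed_hodge_metric (weight V) (form V) (period_lift V c f z) (d v) (d w))"


section \<open>Pseudo-metrics and curvature in holomorphic coordinates\<close>

primrec Ck_on :: "nat \<Rightarrow> 'a::real_normed_vector set \<Rightarrow> ('a \<Rightarrow> 'b::real_normed_vector) \<Rightarrow> bool" where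
  "Ck_on 0 A f \<longleftrightarrow> continuous_on A f"
| "Ck_on (Suc k) A f \<longleftrightarrow> (\<forall>z\<in>A. f differentiable at z) \<and>
     (\<forall>v. Ck_on k A (\<lambda>z. frechet_derivative f (at z) v))"

definition smooth_on :: "'a::real_normed_vector set \<Rightarrow> ('a \<Rightarrow> 'b::real_normed_vector) \<Rightarrow> bool" where
  "smooth_on A f \<longleftrightarrow> (\<forall>k. Ck_on k A f)"

definition pseudo_metric_on :: "(complex^'d) set \<Rightarrow> (complex^'d \<Rightarrow> complex^'d \<Rightarrow> complex^'d \<Rightarrow> complex) \<Rightarrow> bool" where
  "pseudo_metric_on A h \<longleftrightarrow>
     (\<forall>v w. smooth_on A (\<lambda>z. h z v w)) \<and>
     (\<forall>z\<in>A. sesquilinear (h z) \<and> (\<forall>v w. h z w v = cnj (h z v w)) \<and> (\<forall>v. Re (h z v v) \<ge> 0))"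

text \<open>In coordinates \<open>i/2 \<Sum> h\<^bsub>jk\<^esub> dz\<^sub>j \<and> d\<zeta>\<^sub>k\<close>, where \<open>\<zeta>\<^sub>k\<close> is the conjugate of \<open>z\<^sub>k\<close>.\<close>

definition associated_form :: "(complex^'d \<Rightarrow> complex^'d \<Rightarrow> complex^'d \<Rightarrow> complex) \<Rightarrow>
    complex^'d \<Rightarrow> complex^'d \<Rightarrow> complex^'d \<Rightarrow> real" where
  "associated_form h z v w = - Im (h z v w)"

text \<open>Exterior derivative of a 2-form, evaluated on constant vector fields.\<close>

definition ext_deriv2 :: "('a::real_normed_vector \<Rightarrow> 'a \<Rightarrow> 'a \<Rightarrow> real) \<Rightarrow> 'a \<Rightarrow> 'a \<Rightarrow> 'a \<Rightarrow> 'a \<Rightarrow> real" where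
  "ext_deriv2 \<omega> z u v w =
     frechet_derivative (\<lambda>x. \<omega> x v w) (at z) u
   - frechet_derivative (\<lambda>x. \<omega> x u w) (at z) v
   + frechet_derivative (\<lambda>x. \<omega> x u v) (at z) w"

definition pseudo_kaehler_on :: "(complex^'d::finite) set \<Rightarrow> (complex^'d \<Rightarrow> complex^'d \<Rightarrow> complex^'d \<Rightarrow> complex) \<Rightarrow> bool" where
  "pseudo_kaehler_on A h \<longleftrightarrow> pseudo_metric_on A h \<and>
     (\<forall>z\<in>A. \<forall>u v w. ext_deriv2 (associated_form h) z u v w = 0)"

definition del :: "complex^'d::finite \<Rightarrow> (complex^'d \<Rightarrow> complex) \<Rightarrow> complex^'d \<Rightarrow> complex" where
  "del v f z = (frechet_derivative f (at z) v - \<i> * frechet_derivative f (at z) (\<i> *s v)) / 2"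

definition delbar :: "complex^'d::finite \<Rightarrow> (complex^'d \<Rightarrow> complex) \<Rightarrow> complex^'d \<Rightarrow> complex" where
  "delbar v f z = (frechet_derivative f (at z) v + \<i> * frechet_derivative f (at z) (\<i> *s v)) / 2"

definition gram :: "(complex^'d \<Rightarrow> complex^'d \<Rightarrow> complex^'d \<Rightarrow> complex) \<Rightarrow> complex^'d::finite \<Rightarrow> complex^'d^'d" where
  "gram h z = (\<chi> j k. h z (axis j 1) (axis k 1))"

text \<open>
  With \<open>H = gram h\<close> the Chern connection is given by \<open>\<theta> = \<partial>H H\<^sup>-\<^sup>1\<close>, that is \<open>D e\<^sub>j = \<Sum>\<^sub>k \<theta>\<^bsub>jk\<^esub> e\<^sub>k\<close> for the
  coordinate fields \<open>e\<^sub>j\<close>. Its curvature is \<open>\<Theta>\<close>, the (0,1)-derivative of \<open>\<theta>\<close>. Below, \<open>\<theta>\<close> is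
  evaluated on \<open>v\<close>, and \<open>\<Theta>\<close> on \<open>v\<close> and the conjugate of \<open>v\<close>; the order of the arguments gives the sign.
\<close>

definition chern_connection :: "(complex^'d \<Rightarrow> complex^'d \<Rightarrow> complex^'d \<Rightarrow> complex) \<Rightarrow>
    complex^'d \<Rightarrow> complex^'d \<Rightarrow> complex^'d::finite^'d" where
  "chern_connection h v z = (\<chi> j k. del v (\<lambda>x. gram h x $ j $ k) z) ** matrix_inv (gram h z)"

definition chern_curvature :: "(complex^'d \<Rightarrow> complex^'d \<Rightarrow> complex^'d \<Rightarrow> complex) \<Rightarrow>
    complex^'d \<Rightarrow> complex^'d \<Rightarrow> complex^'d::finite^'d" where
  "chern_curvature h v z = (\<chi> j k. - delbar v (\<lambda>x. chern_connection h v x $ j $ k) z)"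

text \<open>In dimension one this is \<open>- (1/h) \<partial>\<^sub>s\<partial>\<^sub>t log h\<close>, where \<open>t\<close> is the conjugate of \<open>s\<close>.\<close>

definition hol_sectional_curvature :: "(complex^'d \<Rightarrow> complex^'d \<Rightarrow> complex^'d \<Rightarrow> complex) \<Rightarrow>
    complex^'d \<Rightarrow> complex^'d::finite \<Rightarrow> real" where
  "hol_sectional_curvature h z v = Re (h z (v v* chern_curvature h v z) v) / (Re (h z v v))\<^sup>2"

definition nondegenerate_form :: "(complex^'d \<Rightarrow> complex^'d \<Rightarrow> complex) \<Rightarrow> bool" where
  "nondegenerate_form b \<longleftrightarrow> (\<forall>v. (\<forall>w. b v w = 0) \<longrightarrow> v = 0)"

end

theory Submission
  imports Defs "HOL-Complex_Analysis.Complex_Analysis"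
begin

text \<open>
  In a local lift of the period map let \<open>P\<^sub>p(z)\<close> be the projection of \<open>W\<^bsub>-1\<^esub>\<close> onto \<open>F\<^sup>p \<inter> W\<^bsub>-1\<^esub>\<close> along the conjugate
  of \<open>F\<^bsup>-p\<^esup> \<inter> W\<^bsub>-1\<^esub>\<close>, and \<open>e(z)\<close> the unique real vector in \<open>F\<^sup>0\<close> that lifts 1. By transversality the derivative
  \<open>dP\<^sub>p(v)\<close> only exchanges the Hodge components of types \<open>(p, - 1 - p)\<close> and \<open>(p - 1, - p)\<close>. The derivative of
  the period map along \<open>v\<close> acts on the former as \<open>dP\<^sub>p(v)\<close> and sends \<open>e\<close> to \<open>\<xi>(v)\<close>, the component of \<open>de(v)\<close>
  of type \<open>(-1, 0)\<close>. Computing adjoints, the pulled back metric \<open>g\<close> is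
  \<open>g(v, w) = - \<Sum>\<^sub>p Tr(dP\<^sub>p(v) dP\<^sub>p(w) (1 - P\<^sub>p)) - i Q(\<xi>(v), \<xi>(w)\<^sup>c)\<close>, with \<open>c\<close> for conjugation, hence
  \<open>g(v, w) - g(w, v) = \<Sum>\<^sub>p Tr(P\<^sub>p [dP\<^sub>p(v), dP\<^sub>p(w)]) - i Q(de(v), de(w))\<close>.
  The first term is closed because traces of products of three derivatives of \<open>P\<^sub>p\<close> vanish, the second because it
  is the pullback of a constant form under \<open>e\<close>.

  If \<open>H\<close> is constant, the \<open>P\<^sub>p\<close> are locally constant and \<open>\<xi>\<close> is the derivative of a holomorphic map into a
  fixed hermitian vector space. So \<open>g\<close> is induced from a flat metric, and the curvature decreases.
\<close>

section \<open>Smooth maps\<close>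

text \<open>The bigrading, the Hodge form and its adjoints are definite descriptions that change
  with the point, so nothing can be differentiated before they are made explicit. The projections do
  this: they are matrices on one fixed space. They are smooth but in general not holomorphic, since
  \<open>P p\<close> depends on F^p and on the conjugate of F^(-p). On the image of P_p the
  derivative dP_p(w) is complex linear in w, on the kernel it is conjugate linear; the factor 1 -
  P_p in the formula for g selects the kernel, so g has the right type in its second argument
  although no conjugate is visible. Holomorphic sections are only assumed complex differentiable at
  each point, hence smoothness has to be drawn from Cauchy's formula, and closedness needs the
  symmetry of second derivatives. That only the weights -1 and 0 occur is not part of the definition
  of an extension. It follows from the polarization of the pure part, which rules out lower weights,
  and from the position of F^1 and its conjugate, which rules out higher ones.\<close>

lemma Ck_on_cong_imp:
  fixes f g :: "'a::real_normed_vector \<Rightarrow> 'b::real_normed_vector"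
  assumes "open A" "\<And>z. z \<in> A \<Longrightarrow> f z = g z" "Ck_on k A f"
  shows "Ck_on k A g"
  using assms(2,3)
proof (induction k arbitrary: f g)
  case 0
  then show ?case by (simp cong: continuous_on_cong)
next
  case (Suc k)
  have *: "(f has_derivative D) (at z) \<Longrightarrow> (g has_derivative D) (at z)" if "z \<in> A" for z D
    using has_derivative_transform_within_open[of f D z UNIV A g] assms(1) that Suc.prems(1) by auto
  have d: "g differentiable at z" "frechet_derivative f (at z) = frechet_derivative g (at z)" if "z \<in> A" for z
  proof -
    have "(f has_derivative frechet_derivative f (at z)) (at z)"
      using Suc.prems(2) that by (simp add: frechet_derivative_works)
    from *[OF that this] show "g differentiable at z"
      "frechet_derivative f (at z) = frechet_derivative g (at z)"
      using frechet_derivative_at by (blast intro: differentiableI)+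
  qed
  have "Ck_on k A (\<lambda>z. frechet_derivative g (at z) v)" for v
    using Suc.IH[of "\<lambda>z. frechet_derivative f (at z) v" "\<lambda>z. frechet_derivative g (at z) v"] Suc.prems(2) d(2)
    by simp
  then show ?case using d by simp
qed

lemma Ck_on_SucI:
  assumes "open A" "\<And>z. z \<in> A \<Longrightarrow> (f has_derivative f' z) (at z)" "\<And>v. Ck_on k A (\<lambda>z. f' z v)"
  shows "Ck_on (Suc k) A f"
proof -
  have "frechet_derivative f (at z) = f' z" if "z \<in> A" for z
    using frechet_derivative_at[OF assms(2)[OF that]] by simp
  then have "Ck_on k A (\<lambda>z. frechet_derivative f (at z) v)" for v
    by (intro Ck_on_cong_imp[OF assms(1) _ assms(3)[of v]]) simp
  then show ?thesis using assms(2) by (auto intro: differentiableI)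
qed

lemma Ck_on_Suc_D: "Ck_on (Suc k) A f \<Longrightarrow> Ck_on k A f"
proof (induction k arbitrary: f)
  case 0
  then have "continuous (at z) f" if "z \<in> A" for z
    using that differentiable_imp_continuous_within by auto
  then show ?case by (simp add: continuous_at_imp_continuous_on)
next
  case (Suc k)
  then show ?case by simp
qed

lemma Ck_on_has_derivative:
  "Ck_on (Suc k) A f \<Longrightarrow> z \<in> A \<Longrightarrow> (f has_derivative frechet_derivative f (at z)) (at z)"
  by (simp add: frechet_derivative_works)

text \<open>Holomorphic frames exist only near a point, so the smoothness of projections and of the
  real lift is proved locally and glued here.\<close>

lemma Ck_on_local:
  fixes f :: "'a::real_normed_vector \<Rightarrow> 'b::real_normed_vector"
  assumes "\<And>z. z \<in> A \<Longrightarrow> \<exists>N. open N \<and> z \<in> N \<and> Ck_on k N f"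
  shows "Ck_on k A f"
  using assms
proof (induction k arbitrary: f)
  case 0
  show ?case unfolding Ck_on.simps
  proof (rule continuous_at_imp_continuous_on, rule ballI)
    fix z assume "z \<in> A"
    from 0[OF this] obtain N where "open N" "z \<in> N" "continuous_on N f" by auto
    then show "continuous (at z) f" by (simp add: continuous_on_eq_continuous_at)
  qed
next
  case (Suc k)
  have "Ck_on k A (\<lambda>z. frechet_derivative f (at z) v)" for v
  proof (rule Suc.IH)
    fix z assume "z \<in> A"
    from Suc.prems[OF this] show "\<exists>N. open N \<and> z \<in> N \<and> Ck_on k N (\<lambda>z. frechet_derivative f (at z) v)"
      by auto
  qed
  moreover have "f differentiable at z" if "z \<in> A" for z using Suc.prems[OF that] by auto
  ultimately show ?case by simp
qed

lemma Ck_on_subset: "Ck_on k A f \<Longrightarrow> B \<subseteq> A \<Longrightarrow> Ck_on k B f"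
proof (induction k arbitrary: f)
  case 0
  then show ?case using continuous_on_subset by auto
next
  case (Suc k)
  then show ?case by auto
qed

lemma Ck_on_const: "open A \<Longrightarrow> Ck_on k A (\<lambda>z. c)"
proof (induction k arbitrary: c)
  case (Suc k)
  then show ?case by (intro Ck_on_SucI[where f' = "\<lambda>z v. 0"]) auto
qed auto

lemma Ck_on_linear:
  assumes "bounded_linear L" "open A" "Ck_on k A f"
  shows "Ck_on k A (\<lambda>z. L (f z))"
  using assms(3)
proof (induction k arbitrary: f)
  case 0
  then show ?case using assms(1) by (auto intro: bounded_linear.continuous_on)
next
  case (Suc k)
  show ?case
  proof (rule Ck_on_SucI[where f' = "\<lambda>z v. L (frechet_derivative f (at z) v)", OF assms(2)])
    show "((\<lambda>z. L (f z)) has_derivative (\<lambda>v. L (frechet_derivative f (at z) v))) (at z)" if "z \<in> A" for z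
      using bounded_linear.has_derivative[OF assms(1) Ck_on_has_derivative[OF Suc.prems that]] .
    show "Ck_on k A (\<lambda>z. L (frechet_derivative f (at z) v))" for v
      using Suc by auto
  qed
qed

lemma Ck_on_add:
  assumes "open A" "Ck_on k A f" "Ck_on k A g"
  shows "Ck_on k A (\<lambda>z. f z + g z)"
  using assms(2,3)
proof (induction k arbitrary: f g)
  case 0
  then show ?case by (auto intro: continuous_on_add)
next
  case (Suc k)
  show ?case
  proof (rule Ck_on_SucI[OF assms(1)])
    show "((\<lambda>z. f z + g z) has_derivative (\<lambda>v. frechet_derivative f (at z) v + frechet_derivative g (at z) v)) (at z)"
      if "z \<in> A" for z
      by (intro has_derivative_add Ck_on_has_derivative[OF Suc.prems(1) that] Ck_on_has_derivative[OF Suc.prems(2) that])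
    show "Ck_on k A (\<lambda>z. frechet_derivative f (at z) v + frechet_derivative g (at z) v)" for v
      using Suc by auto
  qed
qed

lemma Ck_on_bilinear:
  assumes B: "bounded_bilinear B" and "open A" "Ck_on k A f" "Ck_on k A g"
  shows "Ck_on k A (\<lambda>z. B (f z) (g z))"
  using assms(3,4)
proof (induction k arbitrary: f g)
  case 0
  then show ?case using bounded_bilinear.continuous_on[OF B] by auto
next
  case (Suc k)
  show ?case
  proof (rule Ck_on_SucI[OF assms(2)])
    show "((\<lambda>z. B (f z) (g z)) has_derivative
        (\<lambda>v. B (f z) (frechet_derivative g (at z) v) + B (frechet_derivative f (at z) v) (g z))) (at z)"
      if "z \<in> A" for z
      by (intro bounded_bilinear.FDERIV[OF B] Ck_on_has_derivative[OF Suc.prems(1) that] Ck_on_has_derivative[OF Suc.prems(2) that])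
    show "Ck_on k A (\<lambda>z. B (f z) (frechet_derivative g (at z) v) + B (frechet_derivative f (at z) v) (g z))" for v
      using Suc Ck_on_Suc_D[OF Suc.prems(1)] Ck_on_Suc_D[OF Suc.prems(2)] by (intro Ck_on_add assms) auto
  qed
qed

lemma Ck_on_sum:
  assumes "open A" "\<And>i. i \<in> I \<Longrightarrow> Ck_on k A (f i)"
  shows "Ck_on k A (\<lambda>z. \<Sum>i\<in>I. f i z)"
  using assms(2)
proof (induction I rule: infinite_finite_induct)
  case (insert x F)
  then show ?case using Ck_on_add[OF assms(1)] by auto
qed (auto intro: Ck_on_const assms(1))

lemma Ck_on_mult:
  fixes f g :: "'a::real_normed_vector \<Rightarrow> 'b::real_normed_algebra"
  assumes "open A" "Ck_on k A f" "Ck_on k A g"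
  shows "Ck_on k A (\<lambda>z. f z * g z)"
  by (rule Ck_on_bilinear[OF bounded_bilinear_mult assms])

lemma Ck_on_prod:
  fixes f :: "'i \<Rightarrow> 'a::real_normed_vector \<Rightarrow> 'b::real_normed_field"
  assumes "open A" "\<And>i. i \<in> I \<Longrightarrow> Ck_on k A (f i)"
  shows "Ck_on k A (\<lambda>z. \<Prod>i\<in>I. f i z)"
  using assms(2)
proof (induction I rule: infinite_finite_induct)
  case (insert x F)
  then show ?case using Ck_on_mult[OF assms(1)] by auto
qed (auto intro: Ck_on_const assms(1))

lemma Ck_on_inverse:
  fixes f :: "'a::real_normed_vector \<Rightarrow> 'b::real_normed_field"
  assumes "open A" "Ck_on k A f" "\<And>z. z \<in> A \<Longrightarrow> f z \<noteq> 0"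
  shows "Ck_on k A (\<lambda>z. inverse (f z))"
  using assms(2)
proof (induction k)
  case 0
  then show ?case using assms(3) by (auto intro: continuous_on_inverse)
next
  case (Suc k)
  show ?case
  proof (rule Ck_on_SucI[OF assms(1)])
    show "((\<lambda>z. inverse (f z)) has_derivative
        (\<lambda>v. (-1) * (inverse (f z) * (frechet_derivative f (at z) v * inverse (f z))))) (at z)" if "z \<in> A" for z
      using Deriv.has_derivative_inverse[OF assms(3)[OF that] Ck_on_has_derivative[OF Suc.prems that]]
      by (simp add: mult.assoc)
    show "Ck_on k A (\<lambda>z. (-1) * (inverse (f z) * (frechet_derivative f (at z) v * inverse (f z))))" for v
      using Suc Ck_on_Suc_D[OF Suc.prems] by (intro Ck_on_mult Ck_on_const assms) auto
  qed
qed

section \<open>Vector-valued maps, determinants and inverse matrices\<close>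

lemma bounded_linear_axis: "bounded_linear (\<lambda>x::'b::real_normed_vector. axis (i::'n::finite) x)"
proof
  have "norm (axis i x) \<le> norm x" for x :: 'b
    proof -
    have "(\<Sum>j\<in>UNIV. (norm (axis i x $ j))\<^sup>2) = (\<Sum>j\<in>UNIV. if j = i then (norm x)\<^sup>2 else 0)"
      by (rule sum.cong) (auto simp: axis_def)
    then show ?thesis by (simp add: norm_vec_def L2_set_def)
  qed
  then show "\<exists>K. \<forall>x::'b. norm (axis i x) \<le> norm x * K" by (metis mult.right_neutral)
qed (auto simp: axis_def vec_eq_iff)

lemma Ck_on_vec:
  fixes f :: "'a::real_normed_vector \<Rightarrow> 'b::real_normed_vector^'n::finite"
  assumes "open A" "\<And>i. Ck_on k A (\<lambda>z. f z $ i)"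
  shows "Ck_on k A f"
proof -
  have "f z = (\<Sum>i\<in>UNIV. axis i (f z $ i))" for z
    by (simp add: vec_eq_iff axis_def)
  moreover have "Ck_on k A (\<lambda>z. \<Sum>i\<in>UNIV. axis i (f z $ i))"
    by (intro Ck_on_sum Ck_on_linear[OF bounded_linear_axis] assms)
  ultimately show ?thesis by presburger
qed

lemma Ck_on_nth:
  fixes f :: "'a::real_normed_vector \<Rightarrow> 'b::real_normed_vector^'n::finite"
  assumes "open A" "Ck_on k A f"
  shows "Ck_on k A (\<lambda>z. f z $ i)"
  by (rule Ck_on_linear[OF bounded_linear_vec_nth assms])

lemma Ck_on_det:
  fixes M :: "'a::real_normed_vector \<Rightarrow> complex^'n^'n::finite"
  assumes "open A" "Ck_on k A M"
  shows "Ck_on k A (\<lambda>z. det (M z))"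
  unfolding det_def
  by (intro Ck_on_sum Ck_on_mult Ck_on_prod Ck_on_const Ck_on_nth assms)

lemma matrix_vector_axis: "(A *v axis j 1) $ i = A $ i $ j" for A :: "complex^'n::finite^'m"
proof -
  have "(A *v axis j 1) $ i = (\<Sum>l\<in>UNIV. if l = j then A $ i $ l else 0)"
    unfolding matrix_vector_mult_def vec_lambda_beta by (rule sum.cong) (auto simp: axis_def)
  then show ?thesis by simp
qed

lemma matrix_inv_left_right:
  fixes A :: "complex^'n^'n::finite"
  assumes "invertible A"
  shows "matrix_inv A ** A = mat 1" "A ** matrix_inv A = mat 1"
  using someI_ex[of "\<lambda>A'. A ** A' = mat 1 \<and> A' ** A = mat 1"] assms
  unfolding invertible_def matrix_inv_def by auto

text \<open>By Cramer's rule each entry of the inverse is a determinant divided by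
  \<open>det (M z)\<close>. In \<open>?C\<close> the column i of M is replaced by the j-th unit
  vector.\<close>

lemma Ck_on_matrix_inv:
  fixes M :: "'a::real_normed_vector \<Rightarrow> complex^'n^'n::finite"
  assumes A: "open A" and M: "Ck_on k A M" and inv: "\<And>z. z \<in> A \<Longrightarrow> invertible (M z)"
  shows "Ck_on k A (\<lambda>z. matrix_inv (M z))"
proof (intro Ck_on_vec A)
  fix i j
  let ?C = "\<lambda>z. \<chi> i' l. if l = i then axis j 1 $ i' else M z $ i' $ l"
  have "det (?C z) * inverse (det (M z)) = matrix_inv (M z) $ i $ j" if "z \<in> A" for z
  proof -
    have d: "det (M z) \<noteq> 0" using inv[OF that] by (simp add: invertible_det_nz)
    have "M z *v (matrix_inv (M z) *v axis j 1) = axis j 1"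
      using matrix_inv_left_right[OF inv[OF that]] by (simp add: matrix_vector_mul_assoc)
    then have "matrix_inv (M z) *v axis j 1 =
        (\<chi> k. det (\<chi> i l. if l = k then axis j 1 $ i else M z $ i $ l) / det (M z))"
      using cramer[OF d] by blast
    then have "(matrix_inv (M z) *v axis j 1) $ i = det (?C z) / det (M z)" by simp
    moreover have "(matrix_inv (M z) *v axis j 1) $ i = matrix_inv (M z) $ i $ j"
      by (rule matrix_vector_axis)
    ultimately show ?thesis by (simp add: divide_inverse)
  qed
  moreover have "Ck_on k A (\<lambda>z. det (?C z) * inverse (det (M z)))"
  proof (intro Ck_on_mult Ck_on_inverse Ck_on_det A M)
    show "Ck_on k A ?C"
    proof (intro Ck_on_vec A)
      fix i' l
      show "Ck_on k A (\<lambda>z. ?C z $ i' $ l)"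
        by (cases "l = i") (auto intro!: Ck_on_const Ck_on_nth A M)
    qed
    show "det (M z) \<noteq> 0" if "z \<in> A" for z
      using inv[OF that] by (simp add: invertible_det_nz)
  qed
  ultimately show "Ck_on k A (\<lambda>z. matrix_inv (M z) $ i $ j)"
    using Ck_on_cong_imp[OF A] by (metis (no_types, lifting))
qed

lemma smooth_onI: "(\<And>k. Ck_on k A f) \<Longrightarrow> smooth_on A f"
  by (simp add: smooth_on_def)

lemma smooth_on_Ck: "smooth_on A f \<Longrightarrow> Ck_on k A f"
  by (simp add: smooth_on_def)

lemma smooth_on_derivative: "smooth_on A f \<Longrightarrow> smooth_on A (\<lambda>z. frechet_derivative f (at z) v)"
  unfolding smooth_on_def using Ck_on.simps(2) by blast

lemma smooth_on_has_derivative: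
  "smooth_on A f \<Longrightarrow> z \<in> A \<Longrightarrow> (f has_derivative frechet_derivative f (at z)) (at z)"
  using Ck_on_has_derivative smooth_on_Ck by blast

section \<open>Symmetry of second derivatives\<close>

text \<open>Differentiate \<open>f (x + t v) - f x\<close>, as an integral of derivatives along \<open>v\<close>, under the integral sign.\<close>

lemma frechet_derivative_commute:
  fixes f :: "'a::real_normed_vector \<Rightarrow> 'b::euclidean_space"
  assumes A: "open A" and f: "Ck_on 2 A f" and z: "z \<in> A"
  shows "frechet_derivative (\<lambda>x. frechet_derivative f (at x) v) (at z) u =
         frechet_derivative (\<lambda>x. frechet_derivative f (at x) u) (at z) v"
proof -
  have f1: "(f has_derivative frechet_derivative f (at x)) (at x)" if "x \<in> A" for x
    using f that by (auto simp: numeral_2_eq_2 frechet_derivative_works)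
  let ?f = "\<lambda>u x. frechet_derivative f (at x) u"
  let ?ff = "\<lambda>u v x. frechet_derivative (?f v) (at x) u"
  have f2: "(?f v has_derivative (\<lambda>u. ?ff u v x)) (at x)" if "x \<in> A" for x v
    using f that by (auto simp: numeral_2_eq_2 frechet_derivative_works)
  have c2: "continuous_on A (?ff u v)" for u v
    using f by (auto simp: numeral_2_eq_2)
  obtain e where e: "e > 0" "ball z e \<subseteq> A" using A z open_contains_ball by metis
  \<comment> \<open>This size keeps z + s u + t v in the ball for |s|, |t| < d; the summand 1 makes
    the denominator positive.\<close>
  define d where "d = e / (norm u + norm v + 1)"
  have npos: "norm u + norm v + 1 > 0" by (smt (verit) norm_ge_zero)
  have d: "d > 0" unfolding d_def using e npos by auto
  have inA: "z + s *\<^sub>R u + t *\<^sub>R v \<in> A" if "\<bar>s\<bar> < d" "\<bar>t\<bar> < d" for s t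
  proof -
    have "norm (s *\<^sub>R u + t *\<^sub>R v) \<le> \<bar>s\<bar> * norm u + \<bar>t\<bar> * norm v"
      by (metis norm_scaleR norm_triangle_ineq)
    also have "\<dots> \<le> d * norm u + d * norm v"
      using that by (intro add_mono mult_right_mono) auto
    also have "\<dots> < d * (norm u + norm v + 1)" using d by (simp add: algebra_simps)
    also have "\<dots> = e" unfolding d_def using npos by simp
    finally have "z + s *\<^sub>R u + t *\<^sub>R v \<in> ball z e"
      using norm_minus_cancel[of "s *\<^sub>R u + t *\<^sub>R v"] by (simp add: dist_norm)
    then show ?thesis using e by auto
  qed
  define h where "h = d / 2"
  have h: "h > 0" "h < d" using d by (auto simp: h_def)
  define U where "U = {-h<..<h}"
  have at0: "at 0 within U = at 0"
    by (rule at_within_open) (use h in \<open>auto simp: U_def\<close>)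
  have line: "((\<lambda>t. z + s *\<^sub>R u + t *\<^sub>R v) has_derivative (\<lambda>t. t *\<^sub>R v)) (at t within S)" for s t S
    by (auto intro!: derivative_eq_intros)
  have line': "((\<lambda>s. z + s *\<^sub>R u + t *\<^sub>R v) has_derivative (\<lambda>t. t *\<^sub>R u)) (at s within S)" for s t S
    by (auto intro!: derivative_eq_intros)
  have dv: "((\<lambda>t. f (z + s *\<^sub>R u + t *\<^sub>R v)) has_vector_derivative ?f v (z + s *\<^sub>R u + t *\<^sub>R v)) (at t within S)"
    if "\<bar>s\<bar> < d" "\<bar>t\<bar> < d" for s t S
  proof -
    have D: "(f has_derivative frechet_derivative f (at (z + s *\<^sub>R u + t *\<^sub>R v))) (at (z + s *\<^sub>R u + t *\<^sub>R v))"
      using f1[OF inA[OF that]] .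
    have "((\<lambda>t. f (z + s *\<^sub>R u + t *\<^sub>R v)) has_derivative
      (\<lambda>r. frechet_derivative f (at (z + s *\<^sub>R u + t *\<^sub>R v)) (r *\<^sub>R v))) (at t within S)"
      using has_derivative_compose[OF line D] .
    then show ?thesis unfolding has_vector_derivative_def
      using linear_scale[OF has_derivative_linear[OF D]] by simp
  qed
  have dvu: "((\<lambda>s. ?f w (z + s *\<^sub>R u + t *\<^sub>R v)) has_vector_derivative ?ff u w (z + s *\<^sub>R u + t *\<^sub>R v)) (at s within S)"
    if "\<bar>s\<bar> < d" "\<bar>t\<bar> < d" for s t S w
  proof -
    have D: "(?f w has_derivative (\<lambda>a. ?ff a w (z + s *\<^sub>R u + t *\<^sub>R v))) (at (z + s *\<^sub>R u + t *\<^sub>R v))"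
      using f2[OF inA[OF that], of w] by simp
    have "((\<lambda>s. ?f w (z + s *\<^sub>R u + t *\<^sub>R v)) has_derivative
      (\<lambda>r. ?ff (r *\<^sub>R u) w (z + s *\<^sub>R u + t *\<^sub>R v))) (at s within S)"
      using has_derivative_compose[OF line' D] .
    then show ?thesis unfolding has_vector_derivative_def
      using linear_scale[OF has_derivative_linear[OF D]] by simp
  qed
  have du: "((\<lambda>s. f (z + s *\<^sub>R u + t *\<^sub>R v)) has_vector_derivative ?f u (z + s *\<^sub>R u + t *\<^sub>R v)) (at s within S)"
    if "\<bar>s\<bar> < d" "\<bar>t\<bar> < d" for s t S
  proof -
    have D: "(f has_derivative frechet_derivative f (at (z + s *\<^sub>R u + t *\<^sub>R v))) (at (z + s *\<^sub>R u + t *\<^sub>R v))"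
      using f1[OF inA[OF that]] .
    have "((\<lambda>s. f (z + s *\<^sub>R u + t *\<^sub>R v)) has_derivative
      (\<lambda>r. frechet_derivative f (at (z + s *\<^sub>R u + t *\<^sub>R v)) (r *\<^sub>R u))) (at s within S)"
      using has_derivative_compose[OF line' D] .
    then show ?thesis unfolding has_vector_derivative_def
      using linear_scale[OF has_derivative_linear[OF D]] by simp
  qed
  \<comment> \<open>Two computations of the derivative at s = 0 of f(z + s u + t v) - f(z + s u):
    directly, and under the integral along v.\<close>
  have key: "?f u (z + t *\<^sub>R v) - ?f u z = integral {0..t} (\<lambda>r. ?ff u v (z + r *\<^sub>R v))"
    if t: "0 \<le> t" "t < h" for t
  proof -
    have int: "((\<lambda>s. integral (cbox 0 t) (\<lambda>r. ?f v (z + s *\<^sub>R u + r *\<^sub>R v))) has_vector_derivative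
        integral (cbox 0 t) (\<lambda>r. ?ff u v (z + 0 *\<^sub>R u + r *\<^sub>R v))) (at 0 within U)"
    proof (rule leibniz_rule_vector_derivative[where fx="\<lambda>s r. ?ff u v (z + s *\<^sub>R u + r *\<^sub>R v)"])
      show "((\<lambda>s. ?f v (z + s *\<^sub>R u + r *\<^sub>R v)) has_vector_derivative
          ?ff u v (z + s *\<^sub>R u + r *\<^sub>R v)) (at s within U)" if "s \<in> U" "r \<in> cbox 0 t" for s r
        by (rule dvu) (use that t h in \<open>auto simp: U_def\<close>)
      show "(\<lambda>r. ?f v (z + s *\<^sub>R u + r *\<^sub>R v)) integrable_on cbox 0 t" if "s \<in> U" for s
      proof -
        have "((\<lambda>r. ?f v (z + s *\<^sub>R u + r *\<^sub>R v)) has_integral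
            f (z + s *\<^sub>R u + t *\<^sub>R v) - f (z + s *\<^sub>R u + 0 *\<^sub>R v)) {0..t}"
          by (rule fundamental_theorem_of_calculus) (use t h that in \<open>auto intro!: dv simp: U_def\<close>)
        then show ?thesis by (auto simp: has_integral_integrable)
      qed
      show "continuous_on (U \<times> cbox 0 t) (\<lambda>(s, r). ?ff u v (z + s *\<^sub>R u + r *\<^sub>R v))"
        unfolding split_beta
        using continuous_on_compose2[OF c2[of v u], of "U \<times> cbox 0 t" "\<lambda>p. z + fst p *\<^sub>R u + snd p *\<^sub>R v"] t h
        by (fastforce intro!: continuous_intros inA simp: U_def)
      show "0 \<in> U" "convex U" using h by (auto simp: U_def)
    qed
    have eq: "integral (cbox 0 t) (\<lambda>r. ?f v (z + s *\<^sub>R u + r *\<^sub>R v)) =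
        f (z + s *\<^sub>R u + t *\<^sub>R v) - f (z + s *\<^sub>R u + 0 *\<^sub>R v)" if "s \<in> U" for s
      unfolding box_real
      by (rule integral_unique, rule fundamental_theorem_of_calculus)
        (use t h that in \<open>auto intro!: dv simp: U_def\<close>)
    have 0: "((\<lambda>s. f (z + s *\<^sub>R u + t *\<^sub>R v) - f (z + s *\<^sub>R u + 0 *\<^sub>R v)) has_vector_derivative
        integral (cbox 0 t) (\<lambda>r. ?ff u v (z + 0 *\<^sub>R u + r *\<^sub>R v))) (at 0 within U)"
      by (rule has_vector_derivative_transform[OF _ _ int]) (use eq h in \<open>auto simp: U_def\<close>)
    have 1: "((\<lambda>s. f (z + s *\<^sub>R u + t *\<^sub>R v) - f (z + s *\<^sub>R u + 0 *\<^sub>R v)) has_vector_derivative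
        integral (cbox 0 t) (\<lambda>r. ?ff u v (z + 0 *\<^sub>R u + r *\<^sub>R v))) (at 0)"
      using 0 unfolding at0 .
    have 2: "((\<lambda>s. f (z + s *\<^sub>R u + t *\<^sub>R v) - f (z + s *\<^sub>R u + 0 *\<^sub>R v)) has_vector_derivative
        ?f u (z + 0 *\<^sub>R u + t *\<^sub>R v) - ?f u (z + 0 *\<^sub>R u + 0 *\<^sub>R v)) (at 0)"
      by (rule has_vector_derivative_diff; rule du) (use d t h in auto)
    show ?thesis using vector_derivative_unique_at[OF 1 2] by simp
  qed
  \<comment> \<open>Now \<open>key\<close> is differentiated in t at 0, from the right because the
    integral starts at 0.\<close>
  have "((\<lambda>t. integral {0..t} (\<lambda>r. ?ff u v (z + r *\<^sub>R v))) has_vector_derivative ?ff u v (z + 0 *\<^sub>R v))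
      (at 0 within {0..h/2})"
  proof (rule integral_has_vector_derivative)
    show "continuous_on {0..h/2} (\<lambda>r. ?ff u v (z + r *\<^sub>R v))"
      using continuous_on_compose2[OF c2[of v u], of "{0..h/2}" "\<lambda>r. z + r *\<^sub>R v"] inA[of 0] d h
      by (fastforce intro!: continuous_intros)
  qed (use h in auto)
  then have 1: "((\<lambda>t. ?f u (z + t *\<^sub>R v) - ?f u z) has_vector_derivative ?ff u v z) (at 0 within {0..h/2})"
    unfolding scaleR_zero_left add_0_right
    by (rule has_vector_derivative_transform[rotated 2]) (use key h in auto)
  have D: "(?f u has_derivative (\<lambda>w. ?ff w u (z + 0 *\<^sub>R v))) (at (z + 0 *\<^sub>R v))"
    using f2[of z u] z by simp
  have "((\<lambda>t. ?f u (z + t *\<^sub>R v)) has_derivative (\<lambda>r. ?ff (r *\<^sub>R v) u (z + 0 *\<^sub>R v))) (at 0 within {0..h/2})"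
    by (rule has_derivative_compose[where f = "\<lambda>t. z + t *\<^sub>R v" and g = "?f u", OF _ D])
      (auto intro!: derivative_eq_intros)
  then have "((\<lambda>t. ?f u (z + t *\<^sub>R v) - ?f u z) has_vector_derivative ?ff v u z) (at 0 within {0..h/2})"
    unfolding has_vector_derivative_def
    using linear_scale[OF has_derivative_linear[OF D]]
    by (auto intro!: derivative_eq_intros)
  from vector_derivative_unique_within[OF _ this 1]
  show ?thesis using h by (simp add: at_within_Icc_at_right)
qed

section \<open>Holomorphic maps of several variables\<close>

lemma hol_on_has_derivative:
  assumes "hol_on A f" "z \<in> A"
  shows "(f has_derivative frechet_derivative f (at z)) (at z)"
    "frechet_derivative f (at z) (c *s v) = c *s frechet_derivative f (at z) v"
proof -
  obtain D where D: "(f has_derivative D) (at z)" "\<And>c x. D (c *s x) = c *s D x"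
    using assms unfolding hol_on_def by blast
  have "frechet_derivative f (at z) = D" using frechet_derivative_at[OF D(1)] by simp
  then show "(f has_derivative frechet_derivative f (at z)) (at z)"
    "frechet_derivative f (at z) (c *s v) = c *s frechet_derivative f (at z) v"
    using D by auto
qed

lemma hol_on_continuous: "hol_on A f \<Longrightarrow> continuous_on A f"
  using hol_on_has_derivative(1) has_derivative_continuous
  by (blast intro: continuous_at_imp_continuous_on)

lemma hol_on_subset: "hol_on A f \<Longrightarrow> B \<subseteq> A \<Longrightarrow> hol_on B f"
  unfolding hol_on_def by blast

lemma bounded_linear_scale_left: "bounded_linear (\<lambda>c. c *s (v::complex^'d::finite))"
  by (rule linear_conv_bounded_linear[THEN iffD1])
    (auto intro!: linearI simp: vec_eq_iff algebra_simps)

lemma continuous_on_scale [continuous_intros]: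
  fixes v :: "complex^'d::finite"
  shows "continuous_on S f \<Longrightarrow> continuous_on S (\<lambda>x. f x *s v)"
  using bounded_linear.continuous_on[OF bounded_linear_scale_left] .

text \<open>One radius serves all x near z, so that circle integrals can be differentiated in x.
  Convexity of U is what the Leibniz rule asks for.\<close>

lemma line_in_open:
  fixes v :: "complex^'d::finite"
  assumes "open A" "z \<in> A"
  obtains U r where "r > 0" "open U" "convex U" "z \<in> U"
    "\<And>x \<zeta>. x \<in> U \<Longrightarrow> norm \<zeta> \<le> r \<Longrightarrow> x + \<zeta> *s v \<in> A"
proof -
  obtain e where e: "e > 0" "ball z e \<subseteq> A" using assms open_contains_ball by metis
  obtain K where K: "K > 0" "\<And>c. norm (c *s v) \<le> norm c * K"
    using bounded_linear.pos_bounded[OF bounded_linear_scale_left[of v]] by auto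
  define r where "r = e / (2 * K)"
  have r: "r > 0" using e K by (simp add: r_def)
  have "x + \<zeta> *s v \<in> A" if "x \<in> ball z (e / 2)" "norm \<zeta> \<le> r" for x \<zeta>
  proof -
    have "norm (\<zeta> *s v) \<le> r * K" using K(2)[of \<zeta>] mult_right_mono[OF that(2), of K] K(1) by linarith
    also have "\<dots> = e / 2" using K by (simp add: r_def)
    finally have "dist x (x + \<zeta> *s v) \<le> e / 2" by (simp add: dist_norm)
    then have "dist z (x + \<zeta> *s v) < e" using that(1) dist_triangle[of z "x + \<zeta> *s v" x] by auto
    then show ?thesis using e by auto
  qed
  then show thesis using that[of r "ball z (e/2)"] r e by auto
qed

text \<open>Cauchy's formula for the first derivative on the complex line through x in direction v.
  The derivative becomes an integral of values of f against a kernel independent of x, which gives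
  regularity in x.\<close>

lemma Cauchy_directional:
  fixes f :: "complex^'d::finite \<Rightarrow> complex^'n::finite"
  assumes f: "hol_on A f" and r: "r > 0" and line: "\<And>\<zeta>. norm \<zeta> \<le> r \<Longrightarrow> x + \<zeta> *s v \<in> A"
  shows "((\<lambda>t. f (x + (of_real r * cis t) *s v) $ i * (1 / (2 * of_real pi * of_real r * cis t)))
           has_integral (frechet_derivative f (at x) v $ i)) {0..2*pi}"
proof -
  let ?g = "\<lambda>\<zeta>. f (x + \<zeta> *s v) $ i"
  have d: "(?g has_field_derivative (frechet_derivative f (at (x + \<zeta> *s v)) v $ i)) (at \<zeta>)" if "norm \<zeta> \<le> r" for \<zeta>
  proof -
    note D = hol_on_has_derivative[OF f line[OF that]]
    have "((\<lambda>\<zeta>. x + \<zeta> *s v) has_derivative (\<lambda>c. c *s v)) (at \<zeta>)"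
      by (auto intro!: derivative_eq_intros bounded_linear.has_derivative[OF bounded_linear_scale_left])
    from has_derivative_compose[OF this D(1)]
    have "((\<lambda>\<zeta>. f (x + \<zeta> *s v)) has_derivative (\<lambda>c. c *s frechet_derivative f (at (x + \<zeta> *s v)) v)) (at \<zeta>)"
      by (simp add: D(2))
    from bounded_linear.has_derivative[OF bounded_linear_vec_nth this, of i]
    show ?thesis by (simp add: has_field_derivative_def mult.commute[of _ "frechet_derivative f _ v $ i"])
  qed
  have hol: "?g holomorphic_on ball 0 r"
  proof (unfold holomorphic_on_def field_differentiable_def, intro ballI exI)
    fix \<zeta> :: complex assume "\<zeta> \<in> ball 0 r"
    then show "(?g has_field_derivative (frechet_derivative f (at (x + \<zeta> *s v)) v $ i)) (at \<zeta> within ball 0 r)"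
      by (intro has_field_derivative_at_within[OF d]) simp
  qed
  have cont: "continuous_on (cball 0 r) ?g"
    using DERIV_isCont[OF d] by (intro continuous_at_imp_continuous_on) simp
  have "((\<lambda>u. ?g u / (u - 0) ^ Suc 1) has_contour_integral (2 * pi * \<i>) / fact 1 * (deriv ^^ 1) ?g 0) (circlepath 0 r)"
    by (rule Cauchy_has_contour_integral_higher_derivative_circlepath[OF cont hol]) (use r in auto)
  moreover have "deriv ?g 0 = frechet_derivative f (at x) v $ i"
    using DERIV_imp_deriv[OF d[of 0]] r by simp
  ultimately have "((\<lambda>u. ?g u / u\<^sup>2) has_contour_integral (2 * pi * \<i>) * (frechet_derivative f (at x) v $ i)) (part_circlepath 0 r 0 (2 * pi))"
    by (simp add: power2_eq_square circlepath_def)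
  then have "((\<lambda>t. ?g (of_real r * cis t) / (of_real r * cis t)\<^sup>2 * of_real r * \<i> * cis t)
      has_integral (2 * pi * \<i>) * (frechet_derivative f (at x) v $ i)) {0..2*pi}"
    by (subst (asm) has_contour_integral_part_circlepath_iff) auto
  from has_integral_divide[OF this, of "2 * pi * \<i>"]
  have *: "((\<lambda>t. ?g (of_real r * cis t) / (of_real r * cis t)\<^sup>2 * of_real r * \<i> * cis t / (2 * pi * \<i>))
      has_integral (frechet_derivative f (at x) v $ i)) {0..2*pi}"
    by simp
  have aux: "a / (b * c)\<^sup>2 * b * \<i> * c / (2 * p * \<i>) = a * (1 / (2 * p * b * c))" if "b \<noteq> 0" "c \<noteq> 0" "p \<noteq> 0"
    for a b c p :: complex
    using that by (simp add: power2_eq_square)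
  show ?thesis
  proof (rule has_integral_eq[OF _ *])
    fix t
    show "?g (of_real r * cis t) / (of_real r * cis t)\<^sup>2 * of_real r * \<i> * cis t / (2 * pi * \<i>)
        = ?g (of_real r * cis t) * (1 / (2 * of_real pi * of_real r * cis t))"
      using aux[of "of_real r" "cis t" "of_real pi" "?g (of_real r * cis t)"] r by simp
  qed
qed

lemma continuous_on_circle:
  fixes v :: "complex^'d::finite"
  assumes "r > 0" "\<And>x \<zeta>. x \<in> U \<Longrightarrow> norm \<zeta> \<le> r \<Longrightarrow> x + \<zeta> *s v \<in> A" "continuous_on A g"
  shows "continuous_on (U \<times> S) (\<lambda>(x, t). g (x + (of_real r * cis t) *s v))"
  unfolding split_beta
  by (rule continuous_on_compose2[OF assms(3)])
    (use assms(1) in \<open>auto intro!: continuous_intros assms(2) simp: norm_mult\<close>)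

lemma hol_on_derivative_continuous:
  fixes f :: "complex^'d::finite \<Rightarrow> complex^'n::finite"
  assumes A: "open A" and f: "hol_on A f"
  shows "continuous_on A (\<lambda>x. frechet_derivative f (at x) v)"
proof (rule continuous_at_imp_continuous_on, rule ballI)
  fix z assume "z \<in> A"
  from line_in_open[OF A this, of v] obtain U r where U: "r > 0" "open U" "convex U" "z \<in> U"
    "\<And>x \<zeta>. x \<in> U \<Longrightarrow> norm \<zeta> \<le> r \<Longrightarrow> x + \<zeta> *s v \<in> A" by metis
  have "continuous_on U (\<lambda>x. frechet_derivative f (at x) v $ i)" for i
  proof -
    have "continuous_on (U \<times> cbox 0 (2*pi)) (\<lambda>(x, t). f (x + (of_real r * cis t) *s v) $ i * (1 / (2 * of_real pi * of_real r * cis t)))"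
      using continuous_on_circle[OF U(1,5) hol_on_continuous[OF f], of U "cbox 0 (2*pi)"] U(1)
      unfolding split_beta by (auto intro!: continuous_intros)
    from integral_continuous_on_param[OF this]
    have c: "continuous_on U (\<lambda>x. integral (cbox 0 (2*pi)) (\<lambda>t. f (x + (of_real r * cis t) *s v) $ i * (1 / (2 * of_real pi * of_real r * cis t))))" .
    have "integral (cbox 0 (2*pi)) (\<lambda>t. f (x + (of_real r * cis t) *s v) $ i * (1 / (2 * of_real pi * of_real r * cis t)))
        = frechet_derivative f (at x) v $ i" if "x \<in> U" for x
      using integral_unique[OF Cauchy_directional[OF f U(1) U(5)[OF that]]] by simp
    with c show ?thesis by (simp cong: continuous_on_cong)
  qed
  from continuous_on_vec_lambda[of U "\<lambda>i x. frechet_derivative f (at x) v $ i", OF this] have "continuous_on U (\<lambda>x. frechet_derivative f (at x) v)"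
    by simp
  then show "continuous (at z) (\<lambda>x. frechet_derivative f (at x) v)"
    using continuous_on_eq_continuous_at[OF U(2)] U(4) by blast
qed

lemma has_derivative_vec:
  fixes f :: "'a::real_normed_vector \<Rightarrow> 'b::real_normed_vector^'n::finite"
  assumes "\<And>i. ((\<lambda>x. f x $ i) has_derivative D i) F"
  shows "(f has_derivative (\<lambda>w. \<chi> i. D i w)) F"
proof -
  have "((\<lambda>x. \<Sum>i\<in>UNIV. axis i (f x $ i)) has_derivative (\<lambda>w. \<Sum>i\<in>UNIV. axis i (D i w))) F"
    by (intro has_derivative_sum bounded_linear.has_derivative[OF bounded_linear_axis] assms)
  moreover have "(\<Sum>i\<in>UNIV. axis i (f x $ i)) = f x" for x by (simp add: vec_eq_iff axis_def)
  moreover have "(\<Sum>i\<in>UNIV. axis i (D i w)) = (\<chi> i. D i w)" for w by (simp add: vec_eq_iff axis_def)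
  ultimately show ?thesis by simp
qed

text \<open>In the circle integral x enters only through f, so one differentiates under the integral
  sign. The result is an integral of complex linear maps and so complex linear itself.\<close>

lemma hol_on_derivative:
  fixes f :: "complex^'d::finite \<Rightarrow> complex^'n::finite"
  assumes A: "open A" and f: "hol_on A f"
  shows "hol_on A (\<lambda>x. frechet_derivative f (at x) v)"
  unfolding hol_on_def
proof
  fix z assume "z \<in> A"
  from line_in_open[OF A this, of v] obtain U r where U: "r > 0" "open U" "convex U" "z \<in> U"
    "\<And>x \<zeta>. x \<in> U \<Longrightarrow> norm \<zeta> \<le> r \<Longrightarrow> x + \<zeta> *s v \<in> A" by metis
  let ?p = "\<lambda>x t. x + (of_real r * cis t) *s v"
  let ?k = "\<lambda>t. 1 / (2 * of_real pi * of_real r * cis t)"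
  have "\<exists>D. ((\<lambda>x. frechet_derivative f (at x) v $ i) has_derivative D) (at z) \<and> (\<forall>c x. D (c *s x) = c * D x)" for i
  proof -
    let ?F = "\<lambda>x t w. frechet_derivative f (at (?p x t)) w $ i * ?k t"
    have inA: "?p x t \<in> A" if "x \<in> U" for x t using U(5)[OF that, of "of_real r * cis t"] U(1) by (simp add: norm_mult)
    have deriv: "((\<lambda>x. f (?p x t) $ i * ?k t) has_derivative ?F x t) (at x within U)" if "x \<in> U" for x t
    proof -
      have "((\<lambda>x. ?p x t) has_derivative (\<lambda>w. w)) (at x within U)"
        by (auto intro!: derivative_eq_intros)
      from has_derivative_compose[OF this hol_on_has_derivative(1)[OF f inA[OF that]]]
      have "((\<lambda>x. f (?p x t)) has_derivative (\<lambda>w. frechet_derivative f (at (?p x t)) w)) (at x within U)" .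
      from has_derivative_mult_left[OF bounded_linear.has_derivative[OF bounded_linear_vec_nth this]]
      show ?thesis .
    qed
    have blin: "bounded_linear (?F x t)" if "x \<in> U" for x t
      using deriv[OF that] by (rule has_derivative_bounded_linear)
    \<comment> \<open>The Leibniz rule asks for derivatives as bounded linear maps that depend
      continuously on (x, t); continuity is tested vector by vector.\<close>
    define fx where "fx x t = Blinfun (?F x t)" for x t
    have fx: "blinfun_apply (fx x t) = ?F x t" if "x \<in> U" for x t
      unfolding fx_def by (rule bounded_linear_Blinfun_apply[OF blin[OF that]])
    have cf: "continuous_on (U \<times> cbox 0 (2*pi)) (\<lambda>(x, t). f (?p x t) $ i * ?k t)"
      using continuous_on_circle[OF U(1,5) hol_on_continuous[OF f], of U "cbox 0 (2*pi)"] U(1)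
      unfolding split_beta by (auto intro!: continuous_intros)
    have cfx: "continuous_on (U \<times> cbox 0 (2*pi)) (\<lambda>(x, t). fx x t)"
    proof (rule continuous_on_blinfun_componentwise)
      fix b :: "complex^'d"
      have "continuous_on (U \<times> cbox 0 (2*pi)) (\<lambda>(x, t). ?F x t b)"
        using continuous_on_circle[OF U(1,5) hol_on_derivative_continuous[OF A f], of U "cbox 0 (2*pi)" b] U(1)
        unfolding split_beta by (auto intro!: continuous_intros)
      then show "continuous_on (U \<times> cbox 0 (2*pi)) (\<lambda>y. blinfun_apply (case y of (x, t) \<Rightarrow> fx x t) b)"
        by (rule continuous_on_eq) (auto simp: fx)
    qed
    have "((\<lambda>x. integral (cbox 0 (2*pi)) (\<lambda>t. f (?p x t) $ i * ?k t)) has_derivative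
        blinfun_apply (integral (cbox 0 (2*pi)) (fx z))) (at z within U)"
    proof (rule leibniz_rule[OF _ _ cfx U(4) U(3)])
      show "((\<lambda>x. f (?p x t) $ i * ?k t) has_derivative blinfun_apply (fx x t)) (at x within U)" if "x \<in> U" for x t
        using deriv[OF that] fx[OF that] by simp
      show "(\<lambda>t. f (?p x t) $ i * ?k t) integrable_on cbox 0 (2*pi)" if "x \<in> U" for x
        using Cauchy_directional[OF f U(1) U(5)[OF that], of i] by (auto simp: has_integral_integrable)
    qed
    then have "((\<lambda>x. frechet_derivative f (at x) v $ i) has_derivative
        blinfun_apply (integral (cbox 0 (2*pi)) (fx z))) (at z within U)"
    proof (rule has_derivative_transform[rotated 2])
      show "frechet_derivative f (at x) v $ i = integral (cbox 0 (2*pi)) (\<lambda>t. f (?p x t) $ i * ?k t)" if "x \<in> U" for x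
        using integral_unique[OF Cauchy_directional[OF f U(1) U(5)[OF that]]] by simp
    qed (rule U)
    then have "((\<lambda>x. frechet_derivative f (at x) v $ i) has_derivative
        blinfun_apply (integral (cbox 0 (2*pi)) (fx z))) (at z)"
      by (simp only: at_within_open[OF U(4,2)])
    moreover have "blinfun_apply (integral (cbox 0 (2*pi)) (fx z)) (c *s x) =
        c * blinfun_apply (integral (cbox 0 (2*pi)) (fx z)) x" for c x
    proof -
      have "continuous_on (cbox 0 (2*pi)) (fx z)"
        using continuous_on_compose2[OF cfx continuous_on_Pair[OF continuous_on_const[of _ z] continuous_on_id[of "cbox 0 (2*pi)"]]] U(4)
        by auto
      then have "fx z integrable_on cbox 0 (2*pi)" by (rule integrable_continuous)
      then have "blinfun_apply (integral (cbox 0 (2*pi)) (fx z)) w = integral (cbox 0 (2*pi)) (\<lambda>t. ?F z t w)" for w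
        by (simp add: blinfun_apply_integral fx[OF U(4)])
      moreover have "?F z t (c *s x) = c * ?F z t x" for t
        by (simp add: hol_on_has_derivative(2)[OF f inA[OF U(4)]])
      ultimately show ?thesis by (simp only: integral_mult_right)
    qed
    ultimately show ?thesis by blast
  qed
  then obtain D where D: "\<And>i. ((\<lambda>x. frechet_derivative f (at x) v $ i) has_derivative D i) (at z)"
    "\<And>i c x. D i (c *s x) = c * D i x" by metis
  show "\<exists>D. ((\<lambda>x. frechet_derivative f (at x) v) has_derivative D) (at z) \<and> (\<forall>c x. D (c *s x) = c *s D x)"
    by (rule exI[of _ "\<lambda>w. \<chi> i. D i w"]) (auto intro!: has_derivative_vec D(1) simp: D(2) vec_eq_iff)
qed

lemma hol_on_Ck:
  fixes f :: "complex^'d::finite \<Rightarrow> complex^'n::finite"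
  assumes A: "open A"
  shows "hol_on A f \<Longrightarrow> Ck_on k A f"
proof (induction k arbitrary: f)
  case 0
  then show ?case by (simp add: hol_on_continuous)
next
  case (Suc k)
  show ?case
    by (rule Ck_on_SucI[OF A hol_on_has_derivative(1)[OF Suc.prems]])
      (auto intro: Suc.IH hol_on_derivative A Suc.prems)
qed

section \<open>Conjugation and matrices\<close>

lemma vcnj_simps [simp]:
  "vcnj (x + y) = vcnj x + vcnj y" "vcnj (x - y) = vcnj x - vcnj y" "vcnj (- x) = - vcnj x"
  "vcnj (c *s x) = cnj c *s vcnj x" "vcnj (vcnj x) = x" "vcnj 0 = 0"
  by (simp_all add: vcnj_def vec_eq_iff)

lemma vcnj_eq_0 [simp]: "vcnj x = 0 \<longleftrightarrow> x = 0"
  by (simp add: vcnj_def vec_eq_iff)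

lemma mv_scale [simp]: "A *v (c *s x) = c *s (A *v x)" for A :: "complex^'n::finite^'m"
  by (simp add: matrix_vector_mult_def vec_eq_iff sum_distrib_left mult_ac)

lemmas mv_simps = matrix_vector_right_distrib matrix_vector_mult_diff_distrib
  matrix_vector_mult_add_rdistrib matrix_vector_mult_diff_rdistrib

lemma mv_sum: "A *v (sum f T) = (\<Sum>t\<in>T. A *v f t)" for A :: "complex^'n::finite^'m::finite"
  by (induction T rule: infinite_finite_induct) (auto simp: mv_simps)

lemma sum_mv: "(sum f T) *v x = (\<Sum>t\<in>T. f t *v x)" for f :: "'i \<Rightarrow> complex^'n::finite^'m::finite"
  by (induction T rule: infinite_finite_induct) (auto simp: mv_simps)

lemma linear_matrixI:
  fixes f :: "complex^'n::finite \<Rightarrow> complex^'m::finite"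
  assumes "\<And>x y. f (x + y) = f x + f y" "\<And>c x. f (c *s x) = c *s f x"
  shows "matrix f *v x = f x"
  by (rule matrix_works) (unfold_locales, auto simp: assms)

lemma sum_telescope_int:
  fixes f :: "int \<Rightarrow> 'a::ab_group_add"
  assumes "a \<le> b"
  shows "(\<Sum>p\<in>{a..<b}. f p - f (p + 1)) = f a - f b"
  using assms
proof (induction b rule: int_ge_induct)
  case (step i)
  then have "{a..<i + 1} = insert i {a..<i}" by auto
  then show ?case using step by simp
qed simp

text \<open>\<open>ipow p\<close> is \<open>i\<^bsup>p-q\<^esup>\<close> for the type \<open>(p, q)\<close> with \<open>p + q = -1\<close>.\<close>

definition ipow :: "int \<Rightarrow> complex" where
  "ipow p = \<i> powi (2 * p + 1)"

lemma ipow_eq: "ipow p = \<i> * (-1) powi p"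
  by (simp add: ipow_def power_int_add power_int_mult)

lemma ipow_simps: "ipow (p - 1) = - ipow p" "ipow (-1) = - \<i>" "cnj (ipow p) = - ipow p"
proof -
  show "ipow (p - 1) = - ipow p"
    by (simp add: ipow_eq power_int_diff)
  show "ipow (-1) = - \<i>" by (simp add: ipow_eq)
  have "((-1::complex) powi p) \<in> {1, -1}"
    by (simp add: power_int_def)
       (metis (no_types) minus_one_power_iff)
  then show "cnj (ipow p) = - ipow p" by (auto simp: ipow_eq)
qed

section \<open>Positive definite hermitian forms\<close>

lemma sesq_simps:
  assumes "sesquilinear h"
  shows "h (x + y) z = h x z + h y z" "h x (y + z) = h x y + h x z"
    "h (c *s x) y = c * h x y" "h x (c *s y) = cnj c * h x y"
    "h 0 y = 0" "h x 0 = 0"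
    "h (x - y) z = h x z - h y z" "h x (y - z) = h x y - h x z"
proof -
  show a: "h (x + y) z = h x z + h y z" "h x (y + z) = h x y + h x z"
    "h (c *s x) y = c * h x y" "h x (c *s y) = cnj c * h x y" for x y z c
    using assms unfolding sesquilinear_def by auto
  show "h 0 y = 0" "h x 0 = 0" using a(3)[of 0 0 y] a(4)[of x 0 0] by auto
  show "h (x - y) z = h x z - h y z" using a(1)[of "x - y" y z] by simp
  show "h x (y - z) = h x y - h x z" using a(2)[of x "y - z" z] by simp
qed

lemma sesq_sum_left: "sesquilinear h \<Longrightarrow> h (sum f T) y = (\<Sum>t\<in>T. h (f t) y)"
  by (induction T rule: infinite_finite_induct) (auto simp: sesq_simps)

lemma sesq_sum_right: "sesquilinear h \<Longrightarrow> h x (sum f T) = (\<Sum>t\<in>T. h x (f t))"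
  by (induction T rule: infinite_finite_induct) (auto simp: sesq_simps)

definition posdef :: "(complex^'n \<Rightarrow> complex^'n \<Rightarrow> complex) \<Rightarrow> bool" where
  "posdef h \<longleftrightarrow> sesquilinear h \<and> (\<forall>x y. h y x = cnj (h x y)) \<and> (\<forall>x. x \<noteq> 0 \<longrightarrow> Re (h x x) > 0)"

lemma posdefD:
  assumes "posdef h"
  shows "sesquilinear h" "h y x = cnj (h x y)" "x \<noteq> 0 \<Longrightarrow> Re (h x x) > 0"
  using assms unfolding posdef_def by blast+

text \<open>Gram-Schmidt, one vector at a time. Asking for expansions of the vectors of X allows
  dependent vectors: a zero residue leaves S as it is.\<close>

lemma orthonormal_extension:
  fixes h :: "complex^'n::finite \<Rightarrow> complex^'n \<Rightarrow> complex"
  assumes h: "posdef h" and "finite X"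
  shows "\<exists>S. finite S \<and> (\<forall>s\<in>S. \<forall>t\<in>S. h s t = (if s = t then 1 else 0)) \<and>
           (\<forall>x\<in>X. x = (\<Sum>s\<in>S. h x s *s s))"
  using assms(2)
proof (induction X)
  case empty
  show ?case by (rule exI[of _ "{}"]) auto
next
  case (insert x X)
  note sq = posdefD(1)[OF h] and herm = posdefD(2)[OF h]
  obtain S where S: "finite S" "\<And>s t. s \<in> S \<Longrightarrow> t \<in> S \<Longrightarrow> h s t = (if s = t then 1 else 0)"
    "\<And>x. x \<in> X \<Longrightarrow> x = (\<Sum>s\<in>S. h x s *s s)"
    using insert.IH by blast
  define y where "y = x - (\<Sum>s\<in>S. h x s *s s)"
  have ys: "h y t = 0" if "t \<in> S" for t
  proof -
    have "(\<Sum>s\<in>S. h (h x s *s s) t) = (\<Sum>s\<in>S. if s = t then h x t else 0)"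
      by (rule sum.cong) (auto simp: sesq_simps[OF sq] S(2) that)
    then show ?thesis using that S(1) by (simp add: y_def sesq_simps[OF sq] sesq_sum_left[OF sq])
  qed
  have ys': "h t y = 0" if "t \<in> S" for t using ys[OF that] herm[of y t] by simp
  show ?case
  proof (cases "y = 0")
    case True
    then show ?thesis using S by (intro exI[of _ S]) (auto simp: y_def)
  next
    case False
    define r where "r = complex_of_real (sqrt (Re (h y y)))"
    have pos: "Re (h y y) > 0" using posdefD(3)[OF h False] .
    have "h y y = cnj (h y y)" by (rule herm)
    then have "Im (h y y) = 0" by (simp add: complex_eq_iff)
    then have hyy: "h y y = r * r"
      using pos by (simp add: r_def complex_eq_iff)
    have r: "r \<noteq> 0" "cnj r = r" using pos by (auto simp: r_def)
    define u where "u = (1 / r) *s y"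
    have uu: "h u u = 1" using r by (simp add: u_def sesq_simps[OF sq] hyy)
    have us: "h u t = 0" "h t u = 0" if "t \<in> S" for t
      using ys ys' that by (auto simp: u_def sesq_simps[OF sq])
    have unS: "u \<notin> S" using us uu by force
    have ex: "x = (\<Sum>s\<in>insert u S. h x s *s s)"
    proof -
      have "h x u = h (y + (\<Sum>s\<in>S. h x s *s s)) u" by (simp add: y_def)
      also have "\<dots> = h y u" by (simp add: sesq_simps[OF sq] sesq_sum_left[OF sq] us)
      also have "\<dots> = r" using r by (simp add: u_def sesq_simps[OF sq] hyy)
      finally have "h x u *s u = y" using r by (simp add: u_def vec_eq_iff)
      then show ?thesis using S(1) unS by (simp add: y_def)
    qed
    have "x' = (\<Sum>s\<in>insert u S. h x' s *s s)" if "x' \<in> X" for x'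
    proof -
      have "h x' u = h (\<Sum>s\<in>S. h x' s *s s) u" using S(3)[OF that] by simp
      also have "\<dots> = 0" by (simp add: sesq_simps[OF sq] sesq_sum_left[OF sq] us)
      finally show ?thesis using S(1) unS S(3)[OF that] by simp
    qed
    then show ?thesis using S ex uu us unS by (intro exI[of _ "insert u S"]) auto
  qed
qed

lemma vec_expand: "x = (\<Sum>j\<in>UNIV. x $ j *s axis j 1)" for x :: "complex^'n::finite"
  by (simp add: vec_eq_iff axis_def if_distrib[of "\<lambda>y. _ * y"] cong: if_cong)

text \<open>The expansion is kept as the only conclusion because adjoints and traces are computed
  from it alone.\<close>

lemma orthonormal_basis:
  fixes h :: "complex^'n::finite \<Rightarrow> complex^'n \<Rightarrow> complex"
  assumes h: "posdef h"
  obtains S where "finite S" "\<And>x. x = (\<Sum>s\<in>S. h x s *s s)"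
proof -
  note sq = posdefD(1)[OF h]
  obtain S where S: "finite S" "\<And>j. axis j 1 = (\<Sum>s\<in>S. h (axis j 1) s *s s)"
    using orthonormal_extension[OF h, of "range (\<lambda>j. axis j 1)"] by auto
  have "x = (\<Sum>s\<in>S. h x s *s s)" for x
  proof -
    have "x = (\<Sum>j\<in>UNIV. x $ j *s (\<Sum>s\<in>S. h (axis j 1) s *s s))"
      using vec_expand[of x] S(2) by simp
    also have "\<dots> = (\<Sum>s\<in>S. \<Sum>j\<in>UNIV. (x $ j * h (axis j 1) s) *s s)"
      by (simp add: vec.scale_sum_right sum.swap[of _ S UNIV])
    also have "\<dots> = (\<Sum>s\<in>S. h x s *s s)"
    proof (rule sum.cong)
      fix s
      have "h x s = (\<Sum>j\<in>UNIV. x $ j * h (axis j 1) s)"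
        by (subst vec_expand[of x]) (simp add: sesq_sum_left[OF sq] sesq_simps[OF sq])
      then show "(\<Sum>j\<in>UNIV. (x $ j * h (axis j 1) s) *s s) = h x s *s s"
        by (simp add: vec.scale_sum_left)
    qed simp
    finally show ?thesis .
  qed
  then show thesis using that S(1) by blast
qed

lemma posdef_eqI:
  assumes "posdef h" "\<And>x. h x y = h x z"
  shows "y = z"
proof -
  have "h (y - z) (y - z) = 0"
    using assms(2) by (simp add: sesq_simps[OF posdefD(1)[OF assms(1)]])
  then show ?thesis using posdefD(3)[OF assms(1), of "y - z"] by fastforce
qed

lemma form_adjoint_eqI:
  assumes "posdef h" "\<And>x y. h (B *v x) y = h x (C *v y)"
  shows "form_adjoint h B = C"
  unfolding form_adjoint_def
proof (rule the_equality)
  show "\<forall>x y. h (B *v x) y = h x (C *v y)" using assms(2) by blast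
  fix D assume D: "\<forall>x y. h (B *v x) y = h x (D *v y)"
  have "D *v y = C *v y" for y
    by (rule posdef_eqI[OF assms(1)]) (use D assms(2) in metis)
  then show "D = C" by (simp add: matrix_eq)
qed

lemma form_adjoint_works:
  assumes h: "posdef h"
  shows "h (B *v x) y = h x (form_adjoint h B *v y)"
proof -
  note sq = posdefD(1)[OF h] and herm = posdefD(2)[OF h]
  obtain S where S: "finite S" "\<And>x. x = (\<Sum>s\<in>S. h x s *s s)" using orthonormal_basis[OF h] by metis
  \<comment> \<open>The coefficient of the adjoint of B applied to y along s must be h(y, B s), so
    this is the only candidate.\<close>
  define f where "f y = (\<Sum>s\<in>S. h y (B *v s) *s s)" for y
  have f: "matrix f *v y = f y" for y
    by (rule linear_matrixI) (auto simp: f_def sesq_simps[OF sq] vec.scale_left_distrib sum.distrib vec.scale_sum_right)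
  have "h (B *v x) y = h x (matrix f *v y)" for x y
  proof -
    have "h (B *v x) y = h (B *v (\<Sum>s\<in>S. h x s *s s)) y" using S(2) by simp
    also have "\<dots> = (\<Sum>s\<in>S. h x s * h (B *v s) y)"
      by (simp add: mv_sum sesq_sum_left[OF sq] sesq_simps[OF sq])
    also have "\<dots> = (\<Sum>s\<in>S. cnj (h y (B *v s)) * h x s)"
      by (rule sum.cong[OF refl], subst herm) (rule mult.commute)
    also have "\<dots> = h x (f y)"
      by (simp add: f_def sesq_sum_right[OF sq] sesq_simps[OF sq])
    finally show ?thesis by (simp add: f)
  qed
  then have "form_adjoint h B = matrix f" by (rule form_adjoint_eqI[OF h])
  then show ?thesis using \<open>\<And>x y. h (B *v x) y = h x (matrix f *v y)\<close> by simp
qed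

lemma trace_orthonormal:
  assumes sq: "sesquilinear h" and S: "finite S" "\<And>x. x = (\<Sum>s\<in>S. h x s *s s)"
  shows "trace A = (\<Sum>s\<in>S. h (A *v s) s)"
proof -
  have "trace A = (\<Sum>j\<in>UNIV. (A *v axis j 1) $ j)"
    by (simp add: trace_def matrix_vector_axis)
  also have "\<dots> = (\<Sum>j\<in>UNIV. (A *v (\<Sum>s\<in>S. h (axis j 1) s *s s)) $ j)"
    using S(2) by simp
  also have "\<dots> = (\<Sum>s\<in>S. \<Sum>j\<in>UNIV. (A *v s) $ j * h (axis j 1) s)"
    by (simp add: mv_sum sum.swap[of _ S UNIV] mult.commute)
  also have "\<dots> = (\<Sum>s\<in>S. h (A *v s) s)"
  proof (rule sum.cong)
    fix s show "(\<Sum>j\<in>UNIV. (A *v s) $ j * h (axis j 1) s) = h (A *v s) s"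
      by (subst (2) vec_expand[of "A *v s"]) (simp add: sesq_sum_left[OF sq] sesq_simps[OF sq])
  qed simp
  finally show ?thesis .
qed

text \<open>In an expansion family, T(\<alpha>, \<beta>) is the sum over s of h(\<beta>* s,
  \<alpha>* s), the Hilbert-Schmidt product; symmetry and positivity are inherited from h.\<close>

lemma trace_adjoint:
  assumes h: "posdef h"
  defines "T \<equiv> \<lambda>\<alpha> \<beta>. trace (\<alpha> ** form_adjoint h \<beta>)"
  shows "T \<beta> \<alpha> = cnj (T \<alpha> \<beta>)" "Re (T \<alpha> \<alpha>) \<ge> 0"
proof -
  note sq = posdefD(1)[OF h] and herm = posdefD(2)[OF h]
  obtain S where S: "finite S" "\<And>x. x = (\<Sum>s\<in>S. h x s *s s)" using orthonormal_basis[OF h] by metis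
  have T: "T \<alpha> \<beta> = (\<Sum>s\<in>S. h (form_adjoint h \<beta> *v s) (form_adjoint h \<alpha> *v s))" for \<alpha> \<beta>
    unfolding T_def trace_orthonormal[OF sq S]
    by (simp add: form_adjoint_works[OF h] flip: matrix_vector_mul_assoc)
  show "T \<beta> \<alpha> = cnj (T \<alpha> \<beta>)" unfolding T cnj_sum by (rule sum.cong[OF refl], rule herm)
  have "Re (h x x) \<ge> 0" for x
    using posdefD(3)[OF h, of x] sesq_simps(5)[OF sq, of x] by (cases "x = 0") auto
  then show "Re (T \<alpha> \<alpha>) \<ge> 0" unfolding T Re_sum by (intro sum_nonneg) auto
qed

section \<open>Bigradings with given projections\<close>

lemma bigraded_sum_mono: "(\<And>a b. P a b \<Longrightarrow> P' a b) \<Longrightarrow> bigraded_sum I P \<subseteq> bigraded_sum I P'"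
  unfolding bigraded_sum_def by (rule vec.span_mono) blast

text \<open>The family f is total, with values in the pieces and zero off T, so that index sets can
  later be enlarged freely.\<close>

lemma bigraded_sumE:
  assumes "x \<in> bigraded_sum I P" "\<And>a b. vec.subspace (I a b)"
  obtains T f where "finite T" "\<And>a b. f (a, b) \<in> I a b" "\<And>t. t \<notin> T \<Longrightarrow> f t = 0"
    "\<And>a b. (a, b) \<in> T \<Longrightarrow> P a b" "x = sum f T"
proof -
  have "\<exists>T f. finite T \<and> (\<forall>a b. f (a, b) \<in> I a b) \<and> (\<forall>t. t \<notin> T \<longrightarrow> f t = 0) \<and>
      (\<forall>(a, b)\<in>T. P a b) \<and> x = sum f T"
    using assms(1) unfolding bigraded_sum_def
  proof (induction rule: vec.span_induct_alt)
    case base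
    show ?case
      by (rule exI[of _ "{}"], rule exI[of _ "\<lambda>_. 0"]) (auto simp: vec.subspace_0[OF assms(2)])
  next
    case (step c x y)
    then obtain a b where ab: "x \<in> I a b" "P a b" by auto
    obtain T f where T: "finite T" "\<And>a b. f (a, b) \<in> I a b" "\<And>t. t \<notin> T \<Longrightarrow> f t = 0"
      "\<And>a b. (a, b) \<in> T \<Longrightarrow> P a b" "y = sum f T" using step by blast
    let ?f = "f((a, b) := c *s x + f (a, b))"
    have "sum ?f (insert (a, b) T) = c *s x + (f (a, b) + sum f (T - {(a, b)}))"
      using T(1) by (simp add: sum.insert_remove add.assoc)
    moreover have "f (a, b) + sum f (T - {(a, b)}) = sum f T"
    proof (cases "(a, b) \<in> T")
      case True
      then show ?thesis using sum.remove[OF T(1) True, of f] by simp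
    next
      case False
      then show ?thesis using T(3) by simp
    qed
    ultimately have "sum ?f (insert (a, b) T) = c *s x + y" using T(5) by simp
    then show ?case
      using T ab by (intro exI[of _ "insert (a, b) T"] exI[of _ ?f])
        (auto intro!: vec.subspace_add[OF assms(2)] vec.subspace_scale[OF assms(2)])
  qed
  then obtain T f where "finite T" "\<forall>a b. f (a, b) \<in> I a b" "\<forall>t. t \<notin> T \<longrightarrow> f t = 0"
    "\<forall>(a, b)\<in>T. P a b" "x = sum f T" by blast
  then show thesis by (intro that[of T f]) auto
qed

text \<open>A direct sum decomposition is recorded by its component maps, so that membership in a
  partial sum becomes the vanishing of components.\<close>

locale bigrading =
  fixes I :: "int \<Rightarrow> int \<Rightarrow> (complex^'n::finite) set" and c :: "int \<Rightarrow> int \<Rightarrow> complex^'n \<Rightarrow> complex^'n"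
    and T0 :: "(int \<times> int) set"
  assumes I_sub: "vec.subspace (I a b)"
    and c_add: "c a b (x + y) = c a b x + c a b y" and c_scale: "c a b (k *s x) = k *s c a b x"
    and c_in: "c a b x \<in> I a b"
    and c_id: "x \<in> I a b \<Longrightarrow> c a b x = x"
    and c_other: "x \<in> I a b \<Longrightarrow> (a', b') \<noteq> (a, b) \<Longrightarrow> c a' b' x = 0"
    and T0: "finite T0" and c_sum: "(\<Sum>(a, b)\<in>T0. c a b x) = x"
begin

lemma c_0: "c a b 0 = 0" using c_scale[of a b 0 0] by simp

lemma c_sum_arg: "c a b (sum f T) = (\<Sum>t\<in>T. c a b (f t))"
  by (induction T rule: infinite_finite_induct) (auto simp: c_add c_0)

lemma bigraded_sum_iff: "x \<in> bigraded_sum I P \<longleftrightarrow> (\<forall>a b. \<not> P a b \<longrightarrow> c a b x = 0)"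
proof
  have "vec.subspace {x. \<forall>a b. \<not> P a b \<longrightarrow> c a b x = 0}"
    by (auto simp: vec.subspace_def c_0 c_add c_scale)
  moreover have "\<Union>{I a b | a b. P a b} \<subseteq> {x. \<forall>a b. \<not> P a b \<longrightarrow> c a b x = 0}"
  proof
    fix x assume "x \<in> \<Union>{I a b | a b. P a b}"
    then obtain a b where ab: "x \<in> I a b" "P a b" by blast
    have "c a' b' x = 0" if "\<not> P a' b'" for a' b'
      by (rule c_other[OF ab(1)]) (use ab(2) that in auto)
    then show "x \<in> {x. \<forall>a b. \<not> P a b \<longrightarrow> c a b x = 0}" by simp
  qed
  moreover assume "x \<in> bigraded_sum I P"
  ultimately show "\<forall>a b. \<not> P a b \<longrightarrow> c a b x = 0"
    unfolding bigraded_sum_def using vec.span_minimal by blast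
next
  assume x: "\<forall>a b. \<not> P a b \<longrightarrow> c a b x = 0"
  have "case t of (a, b) \<Rightarrow> c a b x \<in> bigraded_sum I P" for t
  proof (cases t)
    case (Pair a b)
    show ?thesis
    proof (cases "P a b")
      case True
      then have "c a b x \<in> \<Union>{I a b | a b. P a b}" using c_in by blast
      then show ?thesis unfolding Pair bigraded_sum_def by (simp add: vec.span_base)
    next
      case False
      then show ?thesis using x unfolding Pair bigraded_sum_def by (simp add: vec.span_zero)
    qed
  qed
  then have "(\<Sum>(a, b)\<in>T0. c a b x) \<in> bigraded_sum I P"
    unfolding bigraded_sum_def by (intro vec.span_sum) (auto split: prod.splits)
  then show "x \<in> bigraded_sum I P" by (simp add: c_sum)
qed

lemma independent_sum:
  assumes "finite T" "\<And>a b. (a, b) \<in> T \<Longrightarrow> f (a, b) \<in> I a b" "(a, b) \<in> T"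
  shows "c a b (sum f T) = f (a, b)"
proof -
  have "c a b (sum f T) = (\<Sum>t\<in>T. if t = (a, b) then f (a, b) else 0)"
    unfolding c_sum_arg
  proof (rule sum.cong)
    fix t assume "t \<in> T"
    moreover obtain a' b' where t: "t = (a', b')" by (cases t)
    ultimately have ft: "f t \<in> I a' b'" using assms(2) by simp
    show "c a b (f t) = (if t = (a, b) then f (a, b) else 0)"
    proof (cases "t = (a, b)")
      case True
      then show ?thesis using c_id[OF ft] t by simp
    next
      case False
      then have "c a b (f t) = 0" by (intro c_other[OF ft]) (use t in auto)
      then show ?thesis using False by simp
    qed
  qed simp
  then show ?thesis using assms by simp
qed

lemma eq_0I: "(\<And>a b. c a b x = 0) \<Longrightarrow> x = 0"
  using c_sum[of x] by simp

end

section \<open>Polarized Hodge structures of weight -1\<close>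

text \<open>
  The vector \<open>e0\<close> splits off \<open>ker \<pi>\<close>, so that forms and projections of \<open>ker \<pi>\<close> extend to the whole
  space and can be written as matrices of one fixed size.
\<close>

locale hs_space =
  fixes \<pi> :: "complex^'n::finite \<Rightarrow> complex" and e0 :: "complex^'n"
    and q :: "complex^'n \<Rightarrow> complex^'n \<Rightarrow> complex"
  assumes pi_add: "\<pi> (x + y) = \<pi> x + \<pi> y" and pi_scale: "\<pi> (c *s x) = c * \<pi> x"
    and pi_cnj: "\<pi> (vcnj x) = cnj (\<pi> x)" and pi_e0: "\<pi> e0 = 1" and e0_real: "vcnj e0 = e0"
    and q_add: "q (x + y) z = q x z + q y z" and q_scale: "q (c *s x) z = c * q x z"
    and q_skew: "q y x = - q x y" and q_cnj: "q (vcnj x) (vcnj y) = cnj (q x y)"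
begin

lemma pi_simps: "\<pi> 0 = 0" "\<pi> (- x) = - \<pi> x" "\<pi> (x - y) = \<pi> x - \<pi> y"
proof -
  show "\<pi> 0 = 0" using pi_scale[of 0 0] by simp
  show "\<pi> (- x) = - \<pi> x" using pi_scale[of "-1" x] by (simp add: vec.scale_minus_left)
  show "\<pi> (x - y) = \<pi> x - \<pi> y" using pi_add[of "x - y" y] by simp
qed

lemmas pi_all = pi_add pi_scale pi_cnj pi_e0 pi_simps

lemma pi_sum: "\<pi> (sum f T) = (\<Sum>t\<in>T. \<pi> (f t))"
  by (induction T rule: infinite_finite_induct) (auto simp: pi_all)

lemma q_add_right: "q x (y + z) = q x y + q x z"
  using q_add[of y z x] by (simp add: q_skew[of x])

lemma q_scale_right: "q x (c *s y) = c * q x y"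
  using q_scale[of c y x] by (simp add: q_skew[of x])

lemma q_simps: "q 0 y = 0" "q x 0 = 0" "q (- x) y = - q x y" "q x (- y) = - q x y"
  "q (x - y) z = q x z - q y z" "q x (y - z) = q x y - q x z"
proof -
  show "q 0 y = 0" "q x 0 = 0" using q_scale[of 0 0 y] q_scale_right[of x 0 0] by auto
  show "q (- x) y = - q x y" "q x (- y) = - q x y"
    using q_scale[of "-1" x y] q_scale_right[of x "-1" y] by (auto simp: vec.scale_minus_left)
  show "q (x - y) z = q x z - q y z" using q_add[of "x - y" y z] by simp
  show "q x (y - z) = q x y - q x z" using q_add_right[of x "y - z" z] by simp
qed

lemmas q_all = q_add q_scale q_add_right q_scale_right q_simps

lemma q_sum_left: "q (sum f T) y = (\<Sum>t\<in>T. q (f t) y)"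
  by (induction T rule: infinite_finite_induct) (auto simp: q_all)

lemma q_sum_right: "q x (sum f T) = (\<Sum>t\<in>T. q x (f t))"
  by (induction T rule: infinite_finite_induct) (auto simp: q_all)

definition kp :: "complex^'n \<Rightarrow> complex^'n" where
  "kp x = x - \<pi> x *s e0"

lemma kp_simps [simp]: "\<pi> (kp x) = 0" "kp e0 = 0" "kp (x + y) = kp x + kp y"
  "kp (c *s x) = c *s kp x" "vcnj (kp x) = kp (vcnj x)" "kp (x - y) = kp x - kp y"
  by (simp_all add: kp_def pi_all e0_real vec.scale_left_distrib vec.scale_right_diff_distrib
      vec.scale_left_diff_distrib)

lemma kp_id: "\<pi> x = 0 \<Longrightarrow> kp x = x"
  by (simp add: kp_def)

end

text \<open>
  The projection of \<open>ker \<pi>\<close> onto \<open>G p\<close> along the conjugate of \<open>G (- p)\<close>, extended by \<open>0\<close> on \<open>e0\<close>. In a Hodge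
  structure of weight -1, \<open>hcomp\<close> projects to the component of type \<open>(p, - 1 - p)\<close>.
\<close>

definition hproj :: "(complex^'n::finite \<Rightarrow> complex) \<Rightarrow> complex^'n \<Rightarrow> (int \<Rightarrow> (complex^'n) set) \<Rightarrow> int \<Rightarrow> complex^'n^'n" where
  "hproj \<pi> e0 G p = (SOME P. \<forall>x. P *v x \<in> G p \<and> vcnj (x - \<pi> x *s e0 - P *v x) \<in> G (- p))"

definition hcomp :: "(complex^'n::finite \<Rightarrow> complex) \<Rightarrow> complex^'n \<Rightarrow> (int \<Rightarrow> (complex^'n) set) \<Rightarrow> int \<Rightarrow> complex^'n^'n" where
  "hcomp \<pi> e0 G p = hproj \<pi> e0 G p - hproj \<pi> e0 G (p + 1)"

text \<open>The Hodge component of type (p, -1 - p) of a structure of weight -1.\<close>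

definition hpiece :: "(int \<Rightarrow> (complex^'n) set) \<Rightarrow> int \<Rightarrow> (complex^'n) set" where
  "hpiece G p = {x. x \<in> G p \<and> vcnj x \<in> G (- 1 - p)}"

text \<open>A polarized Hodge structure of weight -1 on \<open>ker \<pi>\<close>: the filtration
  step opposed to F^p is the conjugate of F^(-p). The bound N confines the types to - N <= p < N,
  which gives sums over types a range independent of the point of a family.\<close>

locale pure_hs = hs_space \<pi> e0 q
  for \<pi> :: "complex^'n::finite \<Rightarrow> complex" and e0 q +
  fixes G :: "int \<Rightarrow> (complex^'n) set" and N :: int
  assumes N_nonneg: "N \<ge> 0"
    and G_sub: "vec.subspace (G p)"
    and G_K: "x \<in> G p \<Longrightarrow> \<pi> x = 0"
    and G_anti: "p \<le> r \<Longrightarrow> x \<in> G r \<Longrightarrow> x \<in> G p"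
    and G_top: "p \<le> - N \<Longrightarrow> \<pi> x = 0 \<Longrightarrow> x \<in> G p"
    and G_bot: "N \<le> p \<Longrightarrow> x \<in> G p \<Longrightarrow> x = 0"
    and G_decomp: "\<pi> x = 0 \<Longrightarrow> \<exists>y\<in>G p. vcnj (x - y) \<in> G (- p)"
    and G_int: "x \<in> G p \<Longrightarrow> vcnj x \<in> G (- p) \<Longrightarrow> x = 0"
    and G_q: "x \<in> G p \<Longrightarrow> y \<in> G (- p) \<Longrightarrow> q x y = 0"
    and G_pos: "x \<in> hpiece G p \<Longrightarrow> x \<noteq> 0 \<Longrightarrow> Re (ipow p * q x (vcnj x)) > 0"
begin

abbreviation P :: "int \<Rightarrow> complex^'n^'n" where "P \<equiv> hproj \<pi> e0 G"
abbreviation C :: "int \<Rightarrow> complex^'n^'n" where "C \<equiv> hcomp \<pi> e0 G"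
abbreviation H :: "int \<Rightarrow> (complex^'n) set" where "H \<equiv> hpiece G"

lemmas G_simps = vec.subspace_0[OF G_sub] vec.subspace_add[OF G_sub] vec.subspace_diff[OF G_sub]
  vec.subspace_scale[OF G_sub] vec.subspace_neg[OF G_sub] vec.subspace_sum[OF G_sub]

lemma vcnj_G_K: "vcnj x \<in> G p \<Longrightarrow> \<pi> x = 0"
  using G_K[of "vcnj x"] by (simp add: pi_all)

lemma G_unique:
  assumes "y \<in> G p" "vcnj (x - y) \<in> G (- p)" "z \<in> G p" "vcnj (x - z) \<in> G (- p)"
  shows "y = z"
proof -
  have "vcnj (y - z) \<in> G (- p)"
    using G_simps(3)[OF assms(4,2)] by (simp add: algebra_simps)
  then show ?thesis using G_int[of "y - z" p] G_simps(3)[OF assms(1,3)] by simp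
qed

text \<open>A matrix as required exists because the decomposition is unique: pointwise choices are
  then automatically linear.\<close>

lemma P_works: "P p *v x \<in> G p" "vcnj (kp x - P p *v x) \<in> G (- p)"
proof -
  define f where "f x = (SOME y. y \<in> G p \<and> vcnj (kp x - y) \<in> G (- p))" for x
  have f: "f x \<in> G p" "vcnj (kp x - f x) \<in> G (- p)" for x
    using someI_ex[of "\<lambda>y. y \<in> G p \<and> vcnj (kp x - y) \<in> G (- p)"] G_decomp[of "kp x" p]
    unfolding f_def by auto
  have "matrix f *v x = f x" for x
  proof (rule linear_matrixI)
    fix x y c
    have "f x + f y \<in> G p" "vcnj (kp (x + y) - (f x + f y)) \<in> G (- p)"
      using G_simps(2)[OF f(1)[of x] f(1)[of y]] G_simps(2)[OF f(2)[of x] f(2)[of y]]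
      by (auto simp: algebra_simps)
    then show "f (x + y) = f x + f y" by (rule G_unique[OF f])
    have "c *s f x \<in> G p" "vcnj (kp (c *s x) - c *s f x) \<in> G (- p)"
      using G_simps(4)[OF f(1)[of x]] G_simps(4)[OF f(2)[of x], of "cnj c"]
      by (auto simp: vec.scale_right_diff_distrib)
    then show "f (c *s x) = c *s f x" by (rule G_unique[OF f])
  qed
  then have "\<exists>P. \<forall>x. P *v x \<in> G p \<and> vcnj (x - \<pi> x *s e0 - P *v x) \<in> G (- p)"
    using f unfolding kp_def by (intro exI[of _ "matrix f"]) simp
  from someI_ex[OF this] show "P p *v x \<in> G p" "vcnj (kp x - P p *v x) \<in> G (- p)"
    unfolding hproj_def kp_def by blast+
qed

lemma P_eqI: "y \<in> G p \<Longrightarrow> vcnj (kp x - y) \<in> G (- p) \<Longrightarrow> P p *v x = y"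
  by (rule G_unique[OF P_works])

lemma P_K: "\<pi> (P p *v x) = 0"
  using G_K P_works(1) by blast

lemma P_kp: "P p *v kp x = P p *v x"
  by (rule P_eqI) (use P_works(1)[of p x] P_works(2)[of x p] in \<open>auto simp: kp_id\<close>)

lemma P_e0: "P p *v e0 = 0"
  by (rule P_eqI) (auto simp: G_simps)

lemma P_id: "x \<in> G p \<Longrightarrow> P p *v x = x"
  by (rule P_eqI) (auto simp: G_simps kp_id G_K)

lemma P_zero: "vcnj x \<in> G (- p) \<Longrightarrow> P p *v x = 0"
  by (rule P_eqI) (auto simp: G_simps kp_id vcnj_G_K)

text \<open>Conjugation carries the splitting into F^p and the conjugate of F^(-p) to the splitting
  for - p with the summands exchanged.\<close>

lemma P_cnj: "vcnj (P p *v vcnj x) = kp x - P (- p) *v x"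
proof -
  have "P (- p) *v x = kp x - vcnj (P p *v vcnj x)"
    by (rule P_eqI) (use P_works(1)[of p "vcnj x"] P_works(2)[of "vcnj x" p] in auto)
  then show ?thesis by simp
qed

lemma P_idem: "P p *v (P p *v x) = P p *v x"
  by (rule P_id[OF P_works(1)])

text \<open>F^p and F^(-p) annihilate each other, and so do their conjugates. Hence the transpose of
  P_p under q is the complementary projection for - p.\<close>

lemma P_q:
  assumes "\<pi> x = 0" "\<pi> y = 0"
  shows "q (P p *v x) y = q x (y - P (- p) *v y)"
proof -
  let ?a = "P p *v x" and ?b = "P (- p) *v y"
  have e2: "q ?a ?b = 0" using G_q[OF P_works(1) P_works(1)] .
  have "q (vcnj (x - ?a)) (vcnj (y - ?b)) = 0"
    using G_q[of _ "- p"] P_works(2)[of x p] P_works(2)[of y "- p"] assms by (auto simp: kp_id)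
  then have "q (x - ?a) (y - ?b) = 0" by (simp only: q_cnj complex_cnj_zero_iff)
  then have "q x y - q ?a y - (q x ?b - q ?a ?b) = 0" by (simp add: q_all)
  with e2 show ?thesis unfolding q_simps(6) by algebra
qed

lemma C_mv: "C p *v x = P p *v x - P (p + 1) *v x"
  by (simp add: hcomp_def mv_simps)

lemma H_sub: "vec.subspace (H p)"
  unfolding hpiece_def vec.subspace_def by (auto simp: G_simps)

lemma H_K: "x \<in> H p \<Longrightarrow> \<pi> x = 0"
  unfolding hpiece_def using G_K by blast

lemma H_vcnj: "x \<in> H p \<Longrightarrow> vcnj x \<in> H (- 1 - p)"
  unfolding hpiece_def by simp

lemma C_in: "C p *v x \<in> H p"
proof -
  have "P (p + 1) *v x \<in> G p" using G_anti[of p "p + 1"] P_works(1) by simp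
  then have 1: "C p *v x \<in> G p" unfolding C_mv using P_works(1) G_simps by blast
  have "vcnj (kp x - P p *v x) \<in> G (- 1 - p)" using G_anti[of "-1-p" "-p"] P_works(2)[of x p] by simp
  from G_simps(3)[OF _ this, of "vcnj (kp x - P (p + 1) *v x)"] P_works(2)[of x "p + 1"]
  have "vcnj (C p *v x) \<in> G (- 1 - p)" by (simp add: C_mv algebra_simps)
  with 1 show ?thesis by (simp add: hpiece_def)
qed

lemma P_H: "x \<in> H r \<Longrightarrow> P p *v x = (if p \<le> r then x else 0)"
  unfolding hpiece_def using G_anti[of p r x] G_anti[of "- p" "-1-r" "vcnj x"] by (auto simp: P_id P_zero)

lemma C_H: "x \<in> H r \<Longrightarrow> C p *v x = (if p = r then x else 0)"
  by (auto simp: C_mv P_H)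

lemma C_kp: "C p *v kp x = C p *v x"
  by (simp add: C_mv P_kp)

lemma P_top: "p \<le> - N \<Longrightarrow> P p *v x = kp x"
  using P_id[OF G_top[of p "kp x"]] by (simp add: P_kp)

lemma P_bot: "N \<le> p \<Longrightarrow> P p *v x = 0"
  using G_bot P_works(1) by blast

lemma C_sum: "(\<Sum>p\<in>{- N..<N}. C p *v x) = kp x"
  using sum_telescope_int[of "- N" N "\<lambda>p. P p *v x"] N_nonneg by (simp add: C_mv P_top P_bot)

lemma H_bot: "x \<in> H p \<Longrightarrow> x \<noteq> 0 \<Longrightarrow> p \<in> {- N..<N}"
  using G_bot[of p x] G_bot[of "-1-p" "vcnj x"] unfolding hpiece_def
  by (cases "N \<le> p"; cases "p < - N") auto

lemma G_iff_C: "\<pi> x = 0 \<Longrightarrow> x \<in> G p \<longleftrightarrow> (\<forall>r<p. C r *v x = 0)"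
proof
  assume x: "x \<in> G p"
  show "\<forall>r<p. C r *v x = 0"
  proof (intro allI impI)
    fix r assume "r < p"
    then have "x \<in> G r" "x \<in> G (r + 1)" using x G_anti[of r p] G_anti[of "r + 1" p] by auto
    then show "C r *v x = 0" by (simp add: C_mv P_id)
  qed
next
  assume x: "\<pi> x = 0" "\<forall>r<p. C r *v x = 0"
  have "C r *v x \<in> G p" for r
    using C_in[of r x] x(2) G_anti[of p r] unfolding hpiece_def by (cases "r < p") (auto simp: G_simps)
  then have "(\<Sum>r\<in>{- N..<N}. C r *v x) \<in> G p" by (intro G_simps) auto
  then show "x \<in> G p" using x by (simp add: C_sum kp_id)
qed

text \<open>If p > r, the conjugate of y lies in F^(-p), which q pairs to zero with F^p; the other
  case is the conjugate of this one.\<close>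

lemma H_q:
  assumes "x \<in> H p" "y \<in> H r" "p \<noteq> r"
  shows "q x (vcnj y) = 0"
proof (cases "p > r")
  case True
  then have "vcnj y \<in> G (- p)" using assms(2) G_anti[of "- p" "-1-r"] by (auto simp: hpiece_def)
  then show ?thesis using assms(1) G_q by (auto simp: hpiece_def)
next
  case False
  then have "vcnj x \<in> G (- r)" using assms G_anti[of "- r" "-1-p"] by (auto simp: hpiece_def)
  then have "q y (vcnj x) = 0" using assms(2) G_q by (auto simp: hpiece_def)
  then show ?thesis using q_cnj[of "vcnj x" y] q_skew[of y "vcnj x"] by (simp add: q_cnj)
qed

end

section \<open>Extensions by a one-dimensional space of weight 0\<close>

definition kfilt :: "(complex^'n \<Rightarrow> complex) \<Rightarrow> 'n filtration \<Rightarrow> 'n filtration" where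
  "kfilt \<pi> F p = {x \<in> F p. \<pi> x = 0}"

text \<open>
  As only the weights -1 and 0 occur, the mixed Hodge structure is split over the reals and \<open>I\<^bsup>0,0\<^esup>\<close> is
  spanned by this vector.
\<close>

definition real_lift :: "(complex^'n \<Rightarrow> complex) \<Rightarrow> 'n filtration \<Rightarrow> complex^'n" where
  "real_lift \<pi> F = (THE e. e \<in> F 0 \<and> vcnj e = e \<and> \<pi> e = 1)"

text \<open>The quotient by \<open>ker \<pi>\<close> has type (0, 0): \<open>F_pos\<close> says that
  F^1 maps to zero there, \<open>F_0\<close> that F^0 maps onto it.\<close>

locale mixed_hs = pure_hs \<pi> e0 q "kfilt \<pi> F" N
  for \<pi> :: "complex^'n::finite \<Rightarrow> complex" and e0 q F N +
  assumes F_sub: "vec.subspace (F p)"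
    and F_anti: "p \<le> r \<Longrightarrow> x \<in> F r \<Longrightarrow> x \<in> F p"
    and F_pos: "p \<ge> 1 \<Longrightarrow> x \<in> F p \<Longrightarrow> \<pi> x = 0"
    and F_0: "\<exists>x\<in>F 0. \<pi> x = 1"
begin

abbreviation e :: "complex^'n" where "e \<equiv> real_lift \<pi> F"

lemmas F_simps = vec.subspace_0[OF F_sub] vec.subspace_add[OF F_sub] vec.subspace_diff[OF F_sub]
  vec.subspace_scale[OF F_sub] vec.subspace_neg[OF F_sub]

lemma real_lift_unique:
  assumes "x \<in> F 0" "vcnj x = x" "\<pi> x = 1" "y \<in> F 0" "vcnj y = y" "\<pi> y = 1"
  shows "x = y"
  using G_int[of "x - y" 0] assms F_simps(3)[OF assms(1,4)] by (simp add: kfilt_def pi_all)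

text \<open>For a lift s in F^0, the vector conj(s) - s lies in \<open>ker \<pi>\<close>; adding its
  F^0-part to s gives e. Then e - conj(e) lies in F^0 and in its conjugate, which meet in 0 on
  \<open>ker \<pi>\<close>. The formula also shows that e is smooth once s and \<open>P 0\<close>
  are.\<close>

lemma real_lift_works:
  assumes s: "s \<in> F 0" "\<pi> s = 1"
  shows "e = s + P 0 *v (vcnj s - s)" "e \<in> F 0" "vcnj e = e" "\<pi> e = 1"
proof -
  let ?y = "P 0 *v (vcnj s - s)"
  let ?e = "s + ?y"
  have k: "\<pi> (vcnj s - s) = 0" by (simp add: pi_all s)
  have y: "?y \<in> F 0" using P_works(1)[of 0 "vcnj s - s"] by (simp add: kfilt_def)
  have e0: "?e \<in> F 0" using F_simps(2)[OF s(1) y] .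
  have e1: "\<pi> ?e = 1" using P_K[of 0 "vcnj s - s"] by (simp add: pi_all s)
  have c: "s - vcnj s - vcnj ?y \<in> kfilt \<pi> F 0"
    using P_works(2)[of "vcnj s - s" 0] unfolding kp_id[OF k] by simp
  have d: "?e - vcnj ?e \<in> kfilt \<pi> F 0"
    using G_simps(2)[OF c P_works(1)[of 0 "vcnj s - s"]] by (simp add: algebra_simps)
  have "vcnj (?e - vcnj ?e) \<in> kfilt \<pi> F (- 0)"
    using G_simps(5)[OF d] by simp
  from G_int[OF d this] have e2: "vcnj ?e = ?e" by simp
  have "e = ?e" unfolding real_lift_def
    by (rule the_equality) (use e0 e1 e2 real_lift_unique in auto)
  then show "e = ?e" "e \<in> F 0" "vcnj e = e" "\<pi> e = 1" using e0 e1 e2 by auto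
qed

lemma e_props: "e \<in> F 0" "vcnj e = e" "\<pi> e = 1"
  using F_0 real_lift_works by blast+

text \<open>Projection to \<open>ker \<pi>\<close> along the real lift. Unlike \<open>kp\<close>,
  which uses the fixed vector \<open>e0\<close>, it depends on F and respects the bigrading.\<close>

definition R :: "complex^'n \<Rightarrow> complex^'n" where
  "R x = x - \<pi> x *s e"

lemma R_simps [simp]: "\<pi> (R x) = 0" "R e = 0" "R (x + y) = R x + R y" "R (c *s x) = c *s R x"
  "vcnj (R x) = R (vcnj x)"
  by (simp_all add: R_def pi_all e_props vec.scale_left_distrib vec.scale_right_diff_distrib)

lemma R_0 [simp]: "R 0 = 0"
  by (simp add: R_def pi_simps)

lemma e_nz: "e \<noteq> 0"
  using e_props(3) pi_simps(1) by auto

lemma R_id: "\<pi> x = 0 \<Longrightarrow> R x = x"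
  by (simp add: R_def)

lemma F_iff_R: "x \<in> F p \<longleftrightarrow> R x \<in> kfilt \<pi> F p \<and> (p \<ge> 1 \<longrightarrow> \<pi> x = 0)"
proof (cases "p \<ge> 1")
  case True
  then show ?thesis using F_pos[of p x] by (auto simp: kfilt_def R_def)
next
  case False
  then have e: "\<pi> x *s e \<in> F p" using F_simps(4) F_anti[OF _ e_props(1)] by simp
  have "R x \<in> F p" if "x \<in> F p" using F_simps(3)[OF that e] by (simp add: R_def)
  moreover have "x \<in> F p" if "R x \<in> F p" using F_simps(2)[OF that e] by (simp add: R_def)
  ultimately show ?thesis using False by (auto simp: kfilt_def)
qed

text \<open>The candidate for the Deligne bigrading; \<open>comp\<close> below gives its component
  maps.\<close>

definition I0 :: "int \<Rightarrow> int \<Rightarrow> (complex^'n) set" where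
  "I0 p r = (if p + r = -1 then H p else if p = 0 \<and> r = 0 then range (\<lambda>c. c *s e) else {0})"

definition comp :: "int \<Rightarrow> int \<Rightarrow> complex^'n \<Rightarrow> complex^'n" where
  "comp p r x = (if p + r = -1 then C p *v R x else if p = 0 \<and> r = 0 then \<pi> x *s e else 0)"

definition T0 :: "(int \<times> int) set" where
  "T0 = insert (0, 0) ((\<lambda>p. (p, - 1 - p)) ` {- N..<N})"

lemma I0_sub: "vec.subspace (I0 p r)"
proof -
  have "vec.subspace (range (\<lambda>c. c *s e))"
    unfolding vec.subspace_def
    by (auto intro: range_eqI[of _ _ "_ + _"] range_eqI[of _ _ 0] range_eqI[of _ _ "_ * _"] simp: vec.scale_left_distrib)
  then show ?thesis by (auto simp: I0_def H_sub)
qed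

sublocale grading: bigrading I0 comp T0
proof
  show "vec.subspace (I0 a b)" for a b by (rule I0_sub)
  show "comp a b (x + y) = comp a b x + comp a b y" for a b x y
    by (simp add: comp_def mv_simps pi_all vec.scale_left_distrib)
  show "comp a b (k *s x) = k *s comp a b x" for a b k x
    by (simp add: comp_def pi_all)
  show "comp a b x \<in> I0 a b" for a b x
    by (auto simp: comp_def I0_def C_in)
  show "comp a b x = x" if "x \<in> I0 a b" for a b x
    using that by (auto simp: comp_def I0_def C_H R_id[OF H_K] pi_all e_props split: if_splits)
  show "comp a' b' x = 0" if "x \<in> I0 a b" "(a', b') \<noteq> (a, b)" for a b a' b' x
    using that by (auto simp: comp_def I0_def C_H R_id[OF H_K] H_K pi_all e_props split: if_splits)
  show "finite T0" by (simp add: T0_def)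
  show "(\<Sum>(a, b)\<in>T0. comp a b x) = x" for x
  proof -
    have "(\<Sum>(a, b)\<in>T0. comp a b x) = comp 0 0 x + (\<Sum>(a, b)\<in>(\<lambda>p. (p, - 1 - p)) ` {- N..<N}. comp a b x)"
      unfolding T0_def by (subst sum.insert) auto
    also have "(\<Sum>(a, b)\<in>(\<lambda>p. (p, - 1 - p)) ` {- N..<N}. comp a b x) = (\<Sum>p\<in>{- N..<N}. C p *v R x)"
      by (subst sum.reindex) (auto simp: inj_on_def comp_def)
    also have "comp 0 0 x = \<pi> x *s e" by (simp add: comp_def)
    also have "(\<Sum>p\<in>{- N..<N}. C p *v R x) = R x" by (simp add: C_sum kp_id)
    finally show ?thesis by (simp add: R_def)
  qed
qed

lemma F_eq: "F p = bigraded_sum I0 (\<lambda>a b. a \<ge> p)"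
proof (rule set_eqI)
  fix x
  have "x \<in> bigraded_sum I0 (\<lambda>a b. a \<ge> p) \<longleftrightarrow> (\<forall>a<p. C a *v R x = 0) \<and> (p \<ge> 1 \<longrightarrow> \<pi> x = 0)"
  proof -
    have "(\<forall>a b. \<not> a \<ge> p \<longrightarrow> comp a b x = 0) \<longleftrightarrow> (\<forall>a<p. C a *v R x = 0) \<and> (p \<ge> 1 \<longrightarrow> \<pi> x = 0)"
    proof
      assume l: "\<forall>a b. \<not> a \<ge> p \<longrightarrow> comp a b x = 0"
      have "C a *v R x = 0" if "a < p" for a
        using l[rule_format, of a "-1-a"] that by (simp add: comp_def)
      moreover have "\<pi> x = 0" if "p \<ge> 1"
      proof -
        show ?thesis
          using l[rule_format, of 0 0] that e_nz by (simp add: comp_def)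
      qed
      ultimately show "(\<forall>a<p. C a *v R x = 0) \<and> (p \<ge> 1 \<longrightarrow> \<pi> x = 0)" by simp
    qed (auto simp: comp_def)
    then show ?thesis by (simp add: grading.bigraded_sum_iff)
  qed
  then show "x \<in> F p \<longleftrightarrow> x \<in> bigraded_sum I0 (\<lambda>a b. a \<ge> p)"
    by (simp add: F_iff_R G_iff_C)
qed

lemma I0_vcnj: "x \<in> I0 p r \<Longrightarrow> vcnj x \<in> I0 r p"
proof -
  assume x: "x \<in> I0 p r"
  show ?thesis
  proof (cases "p + r = -1")
    case True
    then have "r = - 1 - p" by simp
    then show ?thesis using x H_vcnj[of x p] by (simp add: I0_def)
  next
    case False
    then show ?thesis using x by (auto simp: I0_def e_props split: if_splits)
  qed
qed

lemma vcnj_I0: "vcnj ` I0 p r = I0 r p"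
  using I0_vcnj by (metis image_eqI image_subsetI subset_antisym subsetI vcnj_simps(5))

end

section \<open>The Deligne bigrading and the Hodge form\<close>

locale polarized_mixed_hs = mixed_hs \<pi> e0 q F N
  for \<pi> :: "complex^'n::finite \<Rightarrow> complex" and e0 q F N +
  fixes W :: "'n filtration" and Q :: "'n graded_form"
  assumes W_eq: "W k = (if k < -1 then {0} else if k = -1 then {x. \<pi> x = 0} else UNIV)"
    and Q_neg: "k < -1 \<Longrightarrow> Q k 0 0 = 0"
    and Q_m1: "\<pi> x = 0 \<Longrightarrow> \<pi> y = 0 \<Longrightarrow> Q (-1) x y = q x y"
    and Q_0: "Q 0 x y = \<pi> x * \<pi> y"
    and Q_pos: "k \<ge> 1 \<Longrightarrow> Q k x y = 0"
begin

text \<open>Conjugation exchanges the pieces exactly, so the congruence in the last clause holds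
  with equal sets on both sides.\<close>

lemma I0_bigrading: "is_deligne_bigrading W F I0"
  unfolding is_deligne_bigrading_def
proof (intro conjI allI impI ballI)
  show "vec.subspace (I0 p r)" for p r by (rule I0_sub)
  show "bigraded_sum I0 (\<lambda>a b. True) = UNIV" by (auto simp: grading.bigraded_sum_iff)
  show "f t = 0" if "finite T" "\<forall>(a, b)\<in>T. f (a, b) \<in> I0 a b" "sum f T = 0" "t \<in> T" for T f t
    using grading.independent_sum[of T f "fst t" "snd t"] that by (auto simp: grading.c_0)
  show "F p = bigraded_sum I0 (\<lambda>a b. a \<ge> p)" for p by (rule F_eq)
  show "W k = bigraded_sum I0 (\<lambda>a b. a + b \<le> k)" for k
  proof (rule set_eqI)
    fix x
    consider "k < -1" | "k = -1" | "k \<ge> 0" by linarith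
    then show "x \<in> W k \<longleftrightarrow> x \<in> bigraded_sum I0 (\<lambda>a b. a + b \<le> k)"
    proof cases
      case 1
      have "x = 0" if l: "\<forall>a b. \<not> a + b \<le> k \<longrightarrow> comp a b x = 0"
      proof (rule grading.eq_0I)
        fix a b
        show "comp a b x = 0"
        proof (cases "a + b \<le> k")
          case True
          then show ?thesis using 1 by (auto simp: comp_def)
        qed (use l in blast)
      qed
      then show ?thesis using 1 unfolding grading.bigraded_sum_iff by (auto simp: W_eq grading.c_0)
    next
      case 2
      have "(\<forall>a b. \<not> a + b \<le> -1 \<longrightarrow> comp a b x = 0) \<longleftrightarrow> \<pi> x = 0"
      proof
        assume "\<forall>a b. \<not> a + b \<le> -1 \<longrightarrow> comp a b x = 0"
        from this[rule_format, of 0 0] show "\<pi> x = 0" by (simp add: comp_def e_nz)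
      qed (auto simp: comp_def)
      then show ?thesis using 2 unfolding grading.bigraded_sum_iff by (simp add: W_eq)
    next
      case 3
      then show ?thesis unfolding grading.bigraded_sum_iff by (auto simp: W_eq comp_def)
    qed
  qed
  fix p r
  show "{vcnj x + s | x s. x \<in> I0 p r \<and> s \<in> bigraded_sum I0 (\<lambda>a b. a < r \<and> b < p)} =
        {y + s | y s. y \<in> I0 r p \<and> s \<in> bigraded_sum I0 (\<lambda>a b. a < r \<and> b < p)}"
    unfolding vcnj_I0[of p r, symmetric] by blast
qed

text \<open>It is enough that each piece of I lies in the corresponding piece of I0. Then a vector
  of I0 decomposes along I, and its I0-component is the single summand of the same index.\<close>

lemma bigrading_unique:
  assumes I: "is_deligne_bigrading W F I"
  shows "I = I0"
proof -
  have sub: "vec.subspace (I p r)" for p r using I by (simp add: is_deligne_bigrading_def)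
  have univ: "bigraded_sum I (\<lambda>a b. True) = UNIV" using I by (simp add: is_deligne_bigrading_def)
  have indep: "f t = 0" if "finite T" "\<forall>(a, b)\<in>T. f (a, b) \<in> I a b" "sum f T = 0" "t \<in> T" for T f t
    using that
    by (rule I[unfolded is_deligne_bigrading_def, THEN conjunct2, THEN conjunct2, THEN conjunct1,
        THEN spec[of _ T], THEN spec[of _ f], THEN mp, THEN mp, THEN mp, THEN bspec])
  have FI: "F p = bigraded_sum I (\<lambda>a b. a \<ge> p)" for p using I by (simp add: is_deligne_bigrading_def)
  have WI: "W k = bigraded_sum I (\<lambda>a b. a + b \<le> k)" for k using I by (simp add: is_deligne_bigrading_def)
  have base: "x \<in> bigraded_sum I Q" if "x \<in> I a b" "Q a b" for x a b Q
    unfolding bigraded_sum_def using that by (intro vec.span_base) blast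
  \<comment> \<open>Such an x, moved to the other side, gives a vanishing sum over distinct pieces,
    and independence makes every term zero.\<close>
  have disj: "x = 0" if x: "x \<in> I a b" and xs: "x \<in> bigraded_sum I Q" and n: "\<not> Q a b" for x a b Q
  proof -
    from bigraded_sumE[OF xs sub] obtain T f where T: "finite T" "\<And>a b. f (a, b) \<in> I a b"
      "\<And>a b. (a, b) \<in> T \<Longrightarrow> Q a b" "x = sum f T" by metis
    let ?f = "f((a, b) := - x)"
    have nT: "(a, b) \<notin> T" using T(3) n by auto
    then have "sum ?f T = sum f T" by (intro sum.cong) auto
    then have "sum ?f (insert (a, b) T) = 0" using T(1,4) nT by simp
    moreover have "\<forall>(a', b')\<in>insert (a, b) T. ?f (a', b') \<in> I a' b'"
      using T(2) x vec.subspace_neg[OF sub] by auto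
    ultimately have "?f (a, b) = 0" using indep[of "insert (a, b) T" ?f "(a, b)"] T(1) by auto
    then show ?thesis by simp
  qed
  have W2: "bigraded_sum I (\<lambda>a b. a + b \<le> - 2) = {0}" using WI[of "-2"] by (simp add: W_eq)
  have K: "\<pi> x = 0" if "x \<in> I a b" "a + b \<le> -1" for x a b
    using WI[of "-1"] base[of x a b "\<lambda>a b. a + b \<le> -1"] that by (auto simp: W_eq)
  have inF: "x \<in> F a" if "x \<in> I a b" for x a b
    unfolding FI using base[OF that] by simp
  \<comment> \<open>The correction term has a + b <= p + r - 2 <= -2, where the weight filtration is
    zero.\<close>
  have conj: "vcnj x \<in> I r p" if x: "x \<in> I p r" and w: "p + r \<in> {-1, 0}" for x p r
  proof -
    have s0: "s = 0" if "s \<in> bigraded_sum I (\<lambda>a b. a < r \<and> b < p)" for s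
    proof -
      have "a + b \<le> -2" if "a < r \<and> b < p" for a b using that w by auto
      from bigraded_sum_mono[of "\<lambda>a b. a < r \<and> b < p" "\<lambda>a b. a + b \<le> -2" I, OF this] that
      have "s \<in> bigraded_sum I (\<lambda>a b. a + b \<le> -2)" by blast
      then show ?thesis using W2 by simp
    qed
    have "{vcnj x + s | x s. x \<in> I p r \<and> s \<in> bigraded_sum I (\<lambda>a b. a < r \<and> b < p)} =
        {y + s | y s. y \<in> I r p \<and> s \<in> bigraded_sum I (\<lambda>a b. a < r \<and> b < p)}"
      using I by (simp add: is_deligne_bigrading_def)
    moreover have "vcnj x + 0 \<in> {vcnj x + s | x s. x \<in> I p r \<and> s \<in> bigraded_sum I (\<lambda>a b. a < r \<and> b < p)}"
      using x vec.span_zero unfolding bigraded_sum_def by blast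
    ultimately have "vcnj x + 0 \<in> {y + s | y s. y \<in> I r p \<and> s \<in> bigraded_sum I (\<lambda>a b. a < r \<and> b < p)}"
      by (simp only:)
    then obtain y s where "vcnj x = y + s" "y \<in> I r p" "s \<in> bigraded_sum I (\<lambda>a b. a < r \<and> b < p)"
      by auto
    then show ?thesis using s0[of s] by simp
  qed
  \<comment> \<open>In weight 0 away from (0, 0), either x or its conjugate lies in F^1, hence in
    \<open>ker \<pi>\<close>, which is the sum of the pieces of weight at most -1. Independence then
    gives zero.\<close>
  have sub0: "x \<in> I0 a b" if x: "x \<in> I a b" for x a b
  proof -
    consider "a + b \<le> -2" | "a + b = -1" | "a + b = 0" "a \<ge> 1" | "a + b = 0" "a \<le> -1" | "a = 0" "b = 0" | "a + b \<ge> 1"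
      by linarith
    then show ?thesis
    proof cases
      case 1
      then have "x = 0" using W2 base[OF x, of "\<lambda>a b. a + b \<le> -2"] by auto
      then show ?thesis using I0_sub vec.subspace_0 by blast
    next
      case 2
      then have b: "b = - 1 - a" by simp
      have "x \<in> F a" "\<pi> x = 0" using inF[OF x] K[OF x] 2 by auto
      moreover have "vcnj x \<in> F b" using inF[OF conj[OF x]] 2 by auto
      ultimately show ?thesis unfolding b by (simp add: I0_def hpiece_def kfilt_def pi_all)
    next
      case 3
      then have "\<pi> x = 0" using F_pos inF[OF x] by blast
      then have "x \<in> bigraded_sum I (\<lambda>a b. a + b \<le> -1)" using WI[of "-1"] by (auto simp: W_eq)
      then have "x = 0" using disj[OF x] 3 by simp
      then show ?thesis using I0_sub vec.subspace_0 by blast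
    next
      case 4
      have v: "vcnj x \<in> I b a" using conj[OF x] 4 by simp
      have "\<pi> (vcnj x) = 0" using F_pos[OF _ inF[OF v]] 4 by simp
      then have "vcnj x \<in> bigraded_sum I (\<lambda>a b. a + b \<le> -1)" using WI[of "-1"] by (auto simp: W_eq)
      then have "vcnj x = 0" using disj[OF v] 4 by simp
      then have "x = 0" by simp
      then show ?thesis using I0_sub vec.subspace_0 by blast
    next
      case 5
      have 1: "x \<in> F 0" using inF[OF x] 5 by simp
      have 2: "vcnj x \<in> F 0" using inF[OF conj[OF x]] 5 by simp
      have "R x \<in> kfilt \<pi> F 0" "R (vcnj x) \<in> kfilt \<pi> F 0" using 1 2 F_iff_R by auto
      then have "R x = 0" using G_int[of "R x" 0] by simp
      then have "x = \<pi> x *s e" by (simp add: R_def)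
      then show ?thesis using 5 by (auto simp: I0_def)
    next
      case 6
      have "x \<in> bigraded_sum I (\<lambda>a b. a + b \<le> 0)" using WI[of 0] by (auto simp: W_eq)
      then have "x = 0" using disj[OF x] 6 by simp
      then show ?thesis using I0_sub vec.subspace_0 by blast
    qed
  qed
  have "x \<in> I a b" if x: "x \<in> I0 a b" for x a b
  proof -
    have "x \<in> bigraded_sum I (\<lambda>a b. True)" using univ by simp
    from bigraded_sumE[OF this sub] obtain T f where T: "finite T" "\<And>a b. f (a, b) \<in> I a b"
      "\<And>t. t \<notin> T \<Longrightarrow> f t = 0" "x = sum f T" by metis
    have "x = comp a b (sum f (insert (a, b) T))"
    proof -
      have "sum f (insert (a, b) T) = sum f T"
        using T(1,3) by (cases "(a, b) \<in> T") (auto simp: insert_absorb)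
      then show ?thesis using grading.c_id[OF x] T(4) by simp
    qed
    also have "\<dots> = f (a, b)"
      by (rule grading.independent_sum) (use T sub0 in auto)
    finally show ?thesis using T(2) by simp
  qed
  then show ?thesis using sub0 by (intro ext) blast
qed

lemma deligne_bigrading_eq: "deligne_bigrading W F = I0"
  unfolding deligne_bigrading_def
  by (rule the_equality, rule I0_bigrading, rule bigrading_unique)

text \<open>Applying \<open>R\<close> in both arguments makes the real lift orthogonal to
  \<open>ker \<pi>\<close>; \<open>ipow p\<close> is the polarization sign of type (p, -1 -
  p).\<close>

definition hform :: "complex^'n \<Rightarrow> complex^'n \<Rightarrow> complex" where
  "hform x y = (\<Sum>p\<in>{- N..<N}. ipow p * q (C p *v R x) (vcnj (C p *v R y))) + \<pi> x * cnj (\<pi> y)"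

lemma hform_sesq: "sesquilinear hform"
  unfolding sesquilinear_def hform_def
  by (auto simp: mv_simps q_all pi_all algebra_simps sum.distrib sum_distrib_left)

lemma hform_posdef: "posdef hform"
  unfolding posdef_def
proof (intro conjI allI impI)
  show "sesquilinear hform" by (rule hform_sesq)
  fix x y
  have "ipow p * q a (vcnj b) = cnj (ipow p * q b (vcnj a))" for p a b
    using q_skew[of "vcnj a" b] q_cnj[of "vcnj b" a] q_cnj[of b "vcnj a"]
    by (simp add: ipow_simps q_skew[of b "vcnj a"] flip: q_cnj)
  then have "hform x y = cnj (hform y x)"
    unfolding hform_def complex_cnj_add cnj_sum
    by (intro arg_cong2[where f = "(+)"] sum.cong) auto
  then show "hform y x = cnj (hform x y)" by simp
next
  fix x :: "complex^'n"
  assume x: "x \<noteq> 0"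
  have nn: "Re (ipow p * q (C p *v R x) (vcnj (C p *v R x))) \<ge> 0" for p
    using G_pos[OF C_in[of p "R x"]] by (cases "C p *v R x = 0") (auto simp: q_all)
  have Re: "Re (hform x x) = (\<Sum>p\<in>{- N..<N}. Re (ipow p * q (C p *v R x) (vcnj (C p *v R x)))) + (cmod (\<pi> x))\<^sup>2"
    unfolding hform_def by (simp only: plus_complex.sel Re_sum complex_norm_square[symmetric] Re_complex_of_real flip: of_real_power)
  show "Re (hform x x) > 0"
  proof (cases "\<pi> x = 0")
    case False
    then show ?thesis unfolding Re by (intro add_nonneg_pos sum_nonneg nn) auto
  next
    case True
    have "\<exists>p\<in>{- N..<N}. C p *v R x \<noteq> 0"
    proof (rule ccontr)
      assume "\<not> ?thesis"
      then have "R x = 0" using C_sum[of "R x"] by (simp add: kp_id)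
      then show False using x True by (simp add: R_def)
    qed
    then obtain p where p: "p \<in> {- N..<N}" "C p *v R x \<noteq> 0" by blast
    have "(\<Sum>p\<in>{- N..<N}. Re (ipow p * q (C p *v R x) (vcnj (C p *v R x)))) > 0"
    proof (rule sum_pos2[where i = p])
      show "0 < Re (ipow p * q (C p *v R x) (vcnj (C p *v R x)))" by (rule G_pos[OF C_in p(2)])
      show "0 \<le> Re (ipow i * q (C i *v R x) (vcnj (C i *v R x)))" for i by (rule nn)
    qed (use p in auto)
    then show ?thesis unfolding Re by (simp add: add_pos_nonneg)
  qed
qed

lemma hform_I0:
  assumes "u \<in> I0 p r" "v \<in> I0 a b"
  shows "hform u v = (if (p, r) = (a, b) then \<i> powi (p - r) * Q (p + r) u (vcnj v) else 0)"
proof -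
  have C0: "C s *v R x = (if s + r' = -1 \<and> p' = s then x else 0)" if "x \<in> I0 p' r'" for s p' r' x
    using that by (auto simp: I0_def C_H R_id[OF H_K] split: if_splits)
  have pi0: "\<pi> x = 0 \<or> p' = 0 \<and> r' = 0" if "x \<in> I0 p' r'" for p' r' x
    using that by (auto simp: I0_def H_K pi_all split: if_splits)
  consider "(p, r) \<noteq> (a, b)" | "(p, r) = (a, b)" "p + r = -1" | "(p, r) = (a, b)" "p = 0" "r = 0"
    | "(p, r) = (a, b)" "p + r \<noteq> -1" "\<not> (p = 0 \<and> r = 0)" by blast
  then show ?thesis
  proof cases
    case 1
    have "q (C s *v R u) (vcnj (C s *v R v)) = 0" for s
      using 1 by (auto simp: C0[OF assms(1)] C0[OF assms(2)] q_all)
    moreover have "\<pi> u * cnj (\<pi> v) = 0" using pi0[OF assms(1)] pi0[OF assms(2)] 1 by auto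
    ultimately show ?thesis using 1 unfolding hform_def by (auto simp del: mult_eq_0_iff)
  next
    case 2
    have K: "\<pi> u = 0" "\<pi> v = 0" using pi0[OF assms(1)] pi0[OF assms(2)] 2 by auto
    have uH: "u \<in> H p" using assms 2 by (simp add: I0_def)
    have "hform u v = (\<Sum>s\<in>{- N..<N}. ipow s * q (C s *v R u) (vcnj (C s *v R v)))"
      by (simp add: hform_def K)
    also have "\<dots> = (\<Sum>s\<in>{- N..<N}. if s = p then ipow p * q u (vcnj v) else 0)"
      by (rule sum.cong) (use 2 in \<open>auto simp: C0[OF assms(1)] C0[OF assms(2)] q_all\<close>)
    also have "\<dots> = ipow p * q u (vcnj v)"
      using H_bot[OF uH] by (cases "u = 0") (auto simp: q_all)
    also have "\<dots> = \<i> powi (p - r) * Q (p + r) u (vcnj v)"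
    proof -
      have "2 * p + 1 = p - r" using 2 by simp
      then have "ipow p = \<i> powi (p - r)" unfolding ipow_def by (rule arg_cong)
      moreover have "Q (p + r) u (vcnj v) = q u (vcnj v)" using 2 K by (simp add: Q_m1 pi_all)
      ultimately show ?thesis by simp
    qed
    finally show ?thesis using 2 by simp
  next
    case 3
    have "q (C s *v R u) (vcnj (C s *v R v)) = 0" for s
      using 3 C0[OF assms(1), of s] by (auto simp: q_all split: if_splits)
    then show ?thesis using 3 by (simp add: hform_def Q_0 pi_all)
  next
    \<comment> \<open>All remaining pieces are zero, so only the values of Q at 0 matter.\<close>
    case 4
    then have uv: "u = 0" "v = 0" using assms by (auto simp: I0_def)
    have "Q (p + r) 0 0 = 0"
    proof -
      have "p + r < -1 \<or> p + r = 0 \<or> p + r \<ge> 1" using 4 by linarith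
      then show ?thesis by (auto simp: Q_neg Q_0 Q_pos pi_all)
    qed
    then show ?thesis using 4 uv by (simp add: sesq_simps[OF hform_sesq])
  qed
qed

lemma hodge_form_eq: "hodge_form W Q F = hform"
  unfolding hodge_form_def deligne_bigrading_eq
proof (rule the_equality, intro conjI allI impI ballI)
  show "sesquilinear hform" by (rule hform_sesq)
  show "hform u v = 0" if "(p, r) \<noteq> (a, b)" "u \<in> I0 p r" "v \<in> I0 a b" for p r a b u v
    using hform_I0[OF that(2,3)] that(1) by auto
  show "hform u v = \<i> powi (p - r) * Q (p + r) u (vcnj v)" if "u \<in> I0 p r" "v \<in> I0 p r" for p r u v
    using hform_I0[OF that] by simp
  fix h
  assume "sesquilinear h \<and>
     (\<forall>p q a b. (p, q) \<noteq> (a, b) \<longrightarrow> (\<forall>u\<in>I0 p q. \<forall>v\<in>I0 a b. h u v = 0)) \<and>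
     (\<forall>p q. \<forall>u\<in>I0 p q. \<forall>v\<in>I0 p q. h u v = \<i> powi (p - q) * Q (p + q) u (vcnj v))"
  then have sq: "sesquilinear h"
    and h: "\<And>p r a b u v. u \<in> I0 p r \<Longrightarrow> v \<in> I0 a b \<Longrightarrow>
      h u v = (if (p, r) = (a, b) then \<i> powi (p - r) * Q (p + r) u (vcnj v) else 0)"
    by auto
  have "h x y = hform x y" for x y
  proof -
    have "f x y = (\<Sum>s\<in>T0. \<Sum>t\<in>T0. f (case s of (a, b) \<Rightarrow> comp a b x) (case t of (a, b) \<Rightarrow> comp a b y))"
      if f: "sesquilinear f" for f
      using grading.c_sum[of x] grading.c_sum[of y]
        sesq_sum_left[OF f, of "\<lambda>s. case s of (a, b) \<Rightarrow> comp a b x" T0 y]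
        sesq_sum_right[OF f, of _ "\<lambda>s. case s of (a, b) \<Rightarrow> comp a b y" T0] by simp
    note e = this[OF sq] this[OF hform_sesq]
    show ?thesis unfolding e
      by (intro sum.cong refl) (auto simp: h[OF grading.c_in grading.c_in] hform_I0[OF grading.c_in grading.c_in] split: prod.splits)
  qed
  then show "h = hform" by blast
qed

section \<open>The tangent algebra\<close>

lemma tangent_shift:
  assumes X: "X \<in> tangent_algebra W Q F" and x: "x \<in> I0 p r" and a: "a \<ge> p"
  shows "comp a b (X *v x) = 0"
proof -
  obtain f T where T: "X = sum f T" "finite T" "\<And>r s. (r, s) \<in> T \<Longrightarrow> r < 0 \<and> f (r, s) \<in> lie_component W Q F r s"
    using X unfolding tangent_algebra_def by blast
  have "comp a b (f t *v x) = 0" if "t \<in> T" for t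
  proof -
    obtain r' s' where t: "t = (r', s')" by (cases t)
    have r': "r' < 0" "f t \<in> lie_component W Q F r' s'" using T(3) that t by auto
    then have "f t *v x \<in> I0 (p + r') (r + s')"
      using x unfolding lie_component_def deligne_bigrading_eq by blast
    then show ?thesis by (rule grading.c_other) (use r' a in auto)
  qed
  then show ?thesis unfolding T(1) sum_mv grading.c_sum_arg by simp
qed

text \<open>On a piece of first index p a tangent element takes values in pieces of first index
  below p, which meet F^p in 0. This makes the definite description of the period derivative
  determinate.\<close>

lemma tangent_unique:
  assumes X: "X \<in> tangent_algebra W Q F" and Y: "Y \<in> tangent_algebra W Q F"
    and XY: "\<And>p x. x \<in> F p \<Longrightarrow> X *v x - Y *v x \<in> F p"
  shows "X = Y"
proof -
  have "X *v x = Y *v x" if x: "x \<in> I0 p r" for x p r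
  proof -
    have "x \<in> bigraded_sum I0 (\<lambda>a b. a \<ge> p)"
      unfolding bigraded_sum_def by (rule vec.span_base) (use x in auto)
    then have "x \<in> F p" by (rule F_eq[THEN equalityD2, THEN subsetD])
    then have F: "X *v x - Y *v x \<in> F p" by (rule XY)
    have cd: "comp a b (X *v x - Y *v x) = comp a b (X *v x) - comp a b (Y *v x)" for a b
      using grading.c_add[of a b "X *v x - Y *v x" "Y *v x"] by simp
    have "comp a b (X *v x - Y *v x) = 0" for a b
    proof (cases "a \<ge> p")
      case True
      then show ?thesis using tangent_shift[OF X x True] tangent_shift[OF Y x True] cd by simp
    next
      case False
      then show ?thesis
        using F_eq[THEN equalityD1, THEN subsetD, OF F] unfolding grading.bigraded_sum_iff by blast
    qed
    then have "X *v x - Y *v x = 0" by (rule grading.eq_0I)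
    then show ?thesis by simp
  qed
  then have "X *v comp a b x = Y *v comp a b x" for a b x using grading.c_in by blast
  then have "X *v (\<Sum>(a, b)\<in>T0. comp a b x) = Y *v (\<Sum>(a, b)\<in>T0. comp a b x)" for x
    unfolding mv_sum by (intro sum.cong) auto
  then show ?thesis by (simp add: matrix_eq grading.c_sum)
qed

text \<open>A has type (-1, 1) and moves the pure Hodge structure; B has type (-1, 0) and moves the
  extension.\<close>

lemma tangent_algebraI:
  assumes aK: "\<And>x. \<pi> (A *v x) = 0" and ae: "A *v e = 0"
    and aH: "\<And>p x. x \<in> H p \<Longrightarrow> A *v x \<in> H (p - 1)"
    and aq: "\<And>x y. \<pi> x = 0 \<Longrightarrow> \<pi> y = 0 \<Longrightarrow> q (A *v x) y + q x (A *v y) = 0"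
    and xi: "\<xi> \<in> H (-1)" and B: "\<And>x. B *v x = \<pi> x *s \<xi>"
  shows "A + B \<in> tangent_algebra W Q F"
proof -
  have lie: "X \<in> lie_algebra W Q"
    if X: "\<And>x. \<pi> (X *v x) = 0" "\<And>x y. \<pi> x = 0 \<Longrightarrow> \<pi> y = 0 \<Longrightarrow> q (X *v x) y + q x (X *v y) = 0" for X
    unfolding lie_algebra_def
  proof (rule CollectI, rule allI, rule conjI)
    fix k :: int
    show "(*v) X ` W k \<subseteq> W k" by (auto simp: W_eq X)
    have "k < -1 \<or> k = -1 \<or> k = 0 \<or> k \<ge> 1" by linarith
    then show "\<forall>x\<in>W k. \<forall>y\<in>W k. Q k (X *v x) y + Q k x (X *v y) = 0"
      by (elim disjE) (auto simp: W_eq Q_neg Q_m1 Q_0 Q_pos X)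
  qed
  have A: "A \<in> lie_component W Q F (-1) 1"
    unfolding lie_component_def deligne_bigrading_eq
  proof (rule CollectI, intro conjI allI)
    show "A \<in> lie_algebra W Q" by (rule lie[OF aK aq])
    show "(*v) A ` I0 p r \<subseteq> I0 (p + - 1) (r + 1)" for p r
      using aH[of _ p] ae vec.subspace_0[OF H_sub] by (auto simp: I0_def)
  qed
  have xiK: "\<pi> \<xi> = 0" by (rule H_K[OF xi])
  have "B \<in> lie_component W Q F (-1) 0"
    unfolding lie_component_def deligne_bigrading_eq
  proof (rule CollectI, intro conjI allI)
    show "B \<in> lie_algebra W Q" by (rule lie) (auto simp: B pi_all xiK q_all)
    show "(*v) B ` I0 p r \<subseteq> I0 (p + - 1) (r + 0)" for p r
      using vec.subspace_0[OF H_sub] vec.subspace_scale[OF H_sub xi]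
      by (auto simp: I0_def B pi_all e_props H_K split: if_splits)
  qed
  then have "\<forall>(r, s)\<in>{(-1, 1), (-1, 0)}. r < 0 \<and> (if (r, s) = (-1, 1) then A else B) \<in> lie_component W Q F r s"
    using A by simp
  moreover have "A + B = (\<Sum>t\<in>{(-1, 1), (-1, 0::int)}. if t = (-1::int, 1) then A else B)" by simp
  ultimately show ?thesis unfolding tangent_algebra_def
    by (intro CollectI exI[of _ "\<lambda>t. if t = (-1::int, 1::int) then A else B"] exI[of _ "{(-1, 1), (-1, 0)}"]) auto
qed

end

section \<open>Local sections\<close>

lemma scaleR_vec: "r *\<^sub>R x = complex_of_real r *s x" for x :: "complex^'n::finite"
  by (simp add: vec_eq_iff complex_eq_iff)

lemma has_derivative_eq_on:
  assumes "(f has_derivative f') (at z)" "(g has_derivative g') (at z)" "open N" "z \<in> N"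
    "\<And>x. x \<in> N \<Longrightarrow> f x = g x"
  shows "f' v = g' v"
proof -
  have "(g has_derivative f') (at z)"
    by (rule has_derivative_transform_within_open[OF assms(1,3,4)]) (use assms(5) in auto)
  from has_derivative_unique[OF this assms(2)] show ?thesis by simp
qed

lemma hol_on_add:
  assumes "hol_on A f" "hol_on A g"
  shows "hol_on A (\<lambda>z. f z + g z)"
  unfolding hol_on_def
proof
  fix z assume z: "z \<in> A"
  show "\<exists>D. ((\<lambda>z. f z + g z) has_derivative D) (at z) \<and> (\<forall>c x. D (c *s x) = c *s D x)"
    using has_derivative_add[OF hol_on_has_derivative(1)[OF assms(1) z] hol_on_has_derivative(1)[OF assms(2) z]]
    by (auto simp: hol_on_has_derivative(2)[OF assms(1) z] hol_on_has_derivative(2)[OF assms(2) z]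
        vec.scale_right_distrib)
qed

lemma hol_on_matrix:
  fixes f :: "complex^'d::finite \<Rightarrow> complex^'n::finite"
  assumes "hol_on A f"
  shows "hol_on A (\<lambda>z. M *v f z)"
  unfolding hol_on_def
proof
  fix z assume z: "z \<in> A"
  have "bounded_linear (\<lambda>x. M *v x)"
    by (rule linear_conv_bounded_linear[THEN iffD1]) (auto intro!: linearI simp: scaleR_vec mv_simps)
  from bounded_linear.has_derivative[OF this hol_on_has_derivative(1)[OF assms z]]
  show "\<exists>D. ((\<lambda>z. M *v f z) has_derivative D) (at z) \<and> (\<forall>c x. D (c *s x) = c *s D x)"
    by (auto simp: hol_on_has_derivative(2)[OF assms z])
qed

lemma hol_on_scale: "hol_on A (\<lambda>z. c *s f z)" if "hol_on A f" for f :: "complex^'d::finite \<Rightarrow> complex^'n::finite"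
proof -
  have "mat c *v f z = c *s f z" for z
    by (simp add: matrix_vector_mult_def mat_def vec_eq_iff if_distrib[of "\<lambda>y. y * _"] cong: if_cong)
  then show ?thesis using hol_on_matrix[OF that, of "mat c"] by simp
qed

lemma hol_on_zero: "hol_on A (\<lambda>z. 0)"
  unfolding hol_on_def by (auto intro!: exI[of _ "\<lambda>x. 0"])

lemma hol_on_sum:
  fixes f :: "'i \<Rightarrow> complex^'d::finite \<Rightarrow> complex^'n::finite"
  shows "(\<And>i. i \<in> I \<Longrightarrow> hol_on A (f i)) \<Longrightarrow> hol_on A (\<lambda>z. \<Sum>i\<in>I. f i z)"
  by (induction I rule: infinite_finite_induct) (auto intro: hol_on_add hol_on_zero)

lemma bounded_bilinear_vec_scale: "bounded_bilinear (\<lambda>c (x::complex^'n::finite). c *s x)"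
proof -
  have "bilinear (\<lambda>(c::complex) (x::complex^'n). c *s x)"
    unfolding bilinear_def
    by (auto intro!: linearI simp: scaleR_vec scaleR_conv_of_real vec.scale_left_distrib vec.scale_right_distrib mult_ac)
  then show ?thesis by (simp add: bilinear_conv_bounded_bilinear)
qed

lemma hol_on_scalar:
  fixes f :: "complex^'d::finite \<Rightarrow> complex^'n::finite"
  assumes f: "hol_on A f"
    and g: "\<And>z. z \<in> A \<Longrightarrow> (g has_derivative g' z) (at z)" "\<And>z c x. z \<in> A \<Longrightarrow> g' z (c *s x) = c * g' z x"
  shows "hol_on A (\<lambda>z. g z *s f z)"
  unfolding hol_on_def
proof
  fix z assume z: "z \<in> A"
  from bounded_bilinear.FDERIV[OF bounded_bilinear_vec_scale g(1)[OF z] hol_on_has_derivative(1)[OF f z]]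
  show "\<exists>D. ((\<lambda>z. g z *s f z) has_derivative D) (at z) \<and> (\<forall>c x. D (c *s x) = c *s D x)"
    by (auto simp: hol_on_has_derivative(2)[OF f z] g(2)[OF z] vec.scale_right_distrib mult_ac)
qed

lemma bounded_linear_vcnj: "bounded_linear (vcnj :: complex^'n::finite \<Rightarrow> _)"
  by (rule linear_conv_bounded_linear[THEN iffD1]) (auto intro!: linearI simp: scaleR_vec)

lemma bounded_bilinear_mv: "bounded_bilinear (\<lambda>(A :: complex^'n::finite^'m::finite) x. A *v x)"
proof -
  have "r *\<^sub>R A *v x = r *\<^sub>R (A *v x)" for r and A :: "complex^'n::finite^'m::finite" and x
    by (simp add: vec_eq_iff matrix_vector_mult_def scaleR_sum_right)
  then have "bilinear (\<lambda>(A :: complex^'n::finite^'m::finite) x. A *v x)"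
    unfolding bilinear_def by (auto intro!: linearI simp: mv_simps scaleR_vec[where 'n = 'n] scaleR_vec[symmetric, where 'n = 'm])
  then show ?thesis by (simp add: bilinear_conv_bounded_bilinear)
qed

lemma mm_add_left: "(A + B) ** C = A ** C + B ** C" for A B :: "complex^'n::finite^'n" and C :: "complex^'n^'n"
  by (simp add: vec_eq_iff matrix_matrix_mult_def algebra_simps sum.distrib)

lemma bounded_bilinear_mm: "bounded_bilinear (\<lambda>(A :: complex^'n::finite^'n) (B :: complex^'n^'n). A ** B)"
proof -
  have 1: "(r *\<^sub>R A) ** B = r *\<^sub>R (A ** B)" "A ** (r *\<^sub>R B) = r *\<^sub>R (A ** B)"
    for r and A B :: "complex^'n::finite^'n"
    by (simp_all add: vec_eq_iff matrix_matrix_mult_def scaleR_sum_right)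
  have "bilinear (\<lambda>(A :: complex^'n::finite^'n) (B :: complex^'n^'n). A ** B)"
    unfolding bilinear_def
    by (auto intro!: linearI simp: 1 matrix_add_ldistrib mm_add_left)
  then show ?thesis by (simp add: bilinear_conv_bounded_bilinear)
qed

lemma bounded_linear_trace: "bounded_linear (trace :: complex^'n::finite^'n \<Rightarrow> complex)"
  by (rule linear_conv_bounded_linear[THEN iffD1])
    (auto intro!: linearI simp: trace_def sum.distrib scaleR_sum_right)

lemma matrix_eq_axis:
  fixes A B :: "complex^'n::finite^'m"
  assumes "\<And>j. A *v axis j 1 = B *v axis j 1"
  shows "A = B"
proof -
  have "A $ i $ j = B $ i $ j" for i j
    using arg_cong[OF assms[of j], of "\<lambda>x. x $ i"] by (simp add: matrix_vector_axis)
  then show ?thesis by (simp add: vec_eq_iff)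
qed

section \<open>Families of mixed Hodge structures over a chart\<close>

locale period_family = hs_space \<pi> e0 q
  for \<pi> :: "complex^'n::finite \<Rightarrow> complex" and e0 q +
  fixes A :: "(complex^'d::finite) set" and \<Psi> :: "complex^'d \<Rightarrow> 'n filtration" and N :: int
    and W :: "'n filtration" and Q :: "'n graded_form"
  assumes open_A: "open A"
    and fib: "z \<in> A \<Longrightarrow> polarized_mixed_hs \<pi> e0 q (\<Psi> z) N W Q"
    and hol: "holomorphic_filtration A \<Psi>"
    and griffiths: "griffiths_transversal A \<Psi>"
begin

abbreviation G :: "complex^'d \<Rightarrow> 'n filtration" where "G z \<equiv> kfilt \<pi> (\<Psi> z)"
abbreviation P :: "int \<Rightarrow> complex^'d \<Rightarrow> complex^'n^'n" where "P p z \<equiv> hproj \<pi> e0 (G z) p"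
abbreviation C :: "int \<Rightarrow> complex^'d \<Rightarrow> complex^'n^'n" where "C p z \<equiv> hcomp \<pi> e0 (G z) p"
abbreviation H :: "complex^'d \<Rightarrow> int \<Rightarrow> (complex^'n) set" where "H z p \<equiv> hpiece (G z) p"
abbreviation E :: "complex^'d \<Rightarrow> complex^'n" where "E z \<equiv> real_lift \<pi> (\<Psi> z)"
abbreviation dP :: "int \<Rightarrow> complex^'d \<Rightarrow> complex^'d \<Rightarrow> complex^'n^'n" where
  "dP p z v \<equiv> frechet_derivative (P p) (at z) v"
abbreviation dE :: "complex^'d \<Rightarrow> complex^'d \<Rightarrow> complex^'n" where
  "dE z v \<equiv> frechet_derivative E (at z) v"

lemma fib_mixed: "z \<in> A \<Longrightarrow> mixed_hs \<pi> e0 q (\<Psi> z) N"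
  using fib polarized_mixed_hs.axioms(1) by blast

lemma fib_pure: "z \<in> A \<Longrightarrow> pure_hs \<pi> e0 q (G z) N"
  using fib_mixed mixed_hs.axioms(1) by blast

lemma bounded_linear_pi: "bounded_linear \<pi>"
  by (rule linear_conv_bounded_linear[THEN iffD1])
    (auto intro!: linearI simp: scaleR_vec pi_all scaleR_conv_of_real)

lemma bounded_bilinear_q: "bounded_bilinear q"
proof -
  have "bilinear q"
    unfolding bilinear_def by (auto intro!: linearI simp: scaleR_vec q_all scaleR_conv_of_real)
  then show ?thesis by (simp add: bilinear_conv_bounded_bilinear)
qed

text \<open>A combination of the local frame with constant coefficients. It lets pointwise
  statements about derivatives be tested on sections.\<close>

lemma section_through:
  assumes z0: "z0 \<in> A" and x: "x \<in> \<Psi> z0 p"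
  obtains B \<sigma> where "filt_section \<Psi> p B \<sigma>" "B \<subseteq> A" "z0 \<in> B" "\<sigma> z0 = x"
proof -
  obtain B and r :: nat and s where B: "z0 \<in> B" "B \<subseteq> A" "\<And>i. i < r \<Longrightarrow> filt_section \<Psi> p B (s i)" "open B"
    and fr: "\<And>z. z \<in> B \<Longrightarrow> inj_on (\<lambda>i. s i z) {..<r}"
      "\<And>z. z \<in> B \<Longrightarrow> \<Psi> z p = vec.span ((\<lambda>i. s i z) ` {..<r})"
    using hol z0 unfolding holomorphic_filtration_def by metis
  have "x \<in> range (\<lambda>u. \<Sum>v\<in>(\<lambda>i. s i z0) ` {..<r}. u v *s v)"
    using x fr(2)[OF B(1)] vec.span_finite[of "(\<lambda>i. s i z0) ` {..<r}"] by auto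
  then obtain u where "x = (\<Sum>v\<in>(\<lambda>i. s i z0) ` {..<r}. u v *s v)" by blast
  then have x: "x = (\<Sum>i<r. u (s i z0) *s s i z0)"
    by (simp add: sum.reindex[OF fr(1)[OF B(1)]])
  let ?s = "\<lambda>z. \<Sum>i<r. u (s i z0) *s s i z"
  have "hol_on B ?s"
    by (intro hol_on_sum hol_on_scale) (use B(3) in \<open>auto simp: filt_section_def\<close>)
  moreover have "?s z \<in> \<Psi> z p" if "z \<in> B" for z
    unfolding fr(2)[OF that] by (intro vec.span_sum vec.span_scale vec.span_base) auto
  ultimately have "filt_section \<Psi> p B ?s" using B(4) by (simp add: filt_section_def)
  then show thesis using that B x by blast
qed

lemma derivative_pi:
  assumes "(\<sigma> has_derivative D) (at z)"
  shows "((\<lambda>z. \<pi> (\<sigma> z)) has_derivative (\<lambda>v. \<pi> (D v))) (at z)"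
  using bounded_linear.has_derivative[OF bounded_linear_pi assms] .

text \<open>A section of F^0 with nonzero image under \<pi> is divided by that image, which is a
  holomorphic function.\<close>

lemma unit_section:
  assumes z0: "z0 \<in> A"
  obtains B \<sigma> where "filt_section \<Psi> 0 B \<sigma>" "B \<subseteq> A" "z0 \<in> B" "\<And>z. z \<in> B \<Longrightarrow> \<pi> (\<sigma> z) = 1"
proof -
  obtain x where x: "x \<in> \<Psi> z0 0" "\<pi> x = 1" using mixed_hs.F_0[OF fib_mixed[OF z0]] by blast
  obtain B \<sigma> where B: "filt_section \<Psi> 0 B \<sigma>" "B \<subseteq> A" "z0 \<in> B" "\<sigma> z0 = x"
    using section_through[OF z0 x(1)] by blast
  have h: "hol_on B \<sigma>" "open B" using B(1) by (auto simp: filt_section_def)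
  define B' where "B' = {z \<in> B. \<pi> (\<sigma> z) \<noteq> 0}"
  have "continuous_on B (\<lambda>z. \<pi> (\<sigma> z))"
    using bounded_linear.continuous_on[OF bounded_linear_pi hol_on_continuous[OF h(1)]] .
  then have "open (B \<inter> (\<lambda>z. \<pi> (\<sigma> z)) -` (- {0}))"
    using continuous_open_preimage h(2) open_Compl by blast
  moreover have "B' = B \<inter> (\<lambda>z. \<pi> (\<sigma> z)) -` (- {0})" by (auto simp: B'_def)
  ultimately have oB': "open B'" by simp
  have h': "hol_on B' \<sigma>" by (rule hol_on_subset[OF h(1)]) (auto simp: B'_def)
  have "hol_on B' (\<lambda>z. inverse (\<pi> (\<sigma> z)) *s \<sigma> z)"
  proof (rule hol_on_scalar[OF h'])
    fix z assume z: "z \<in> B'"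
    show "((\<lambda>z. inverse (\<pi> (\<sigma> z))) has_derivative
      (\<lambda>v. - (inverse (\<pi> (\<sigma> z)) * \<pi> (frechet_derivative \<sigma> (at z) v) * inverse (\<pi> (\<sigma> z))))) (at z)"
      by (rule Deriv.has_derivative_inverse[OF _ derivative_pi[OF hol_on_has_derivative(1)[OF h' z]]])
        (use z in \<open>simp add: B'_def\<close>)
  qed (simp add: hol_on_has_derivative(2)[OF h'] pi_all)
  moreover have "inverse (\<pi> (\<sigma> z)) *s \<sigma> z \<in> \<Psi> z 0" if "z \<in> B'" for z
  proof -
    have "z \<in> A" "\<sigma> z \<in> \<Psi> z 0" using that B by (auto simp: B'_def filt_section_def)
    then show ?thesis using mixed_hs.F_simps(4)[OF fib_mixed] by blast
  qed
  ultimately have "filt_section \<Psi> 0 B' (\<lambda>z. inverse (\<pi> (\<sigma> z)) *s \<sigma> z)"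
    using oB' by (simp add: filt_section_def)
  moreover have "B' \<subseteq> A" "z0 \<in> B'" using B x by (auto simp: B'_def)
  ultimately show thesis by (rule that) (auto simp: pi_all B'_def)
qed

definition ksection :: "int \<Rightarrow> (complex^'d) set \<Rightarrow> (complex^'d \<Rightarrow> complex^'n) \<Rightarrow> bool" where
  "ksection p B \<sigma> \<longleftrightarrow> open B \<and> B \<subseteq> A \<and> hol_on B \<sigma> \<and> (\<forall>z\<in>B. \<sigma> z \<in> G z p)"

text \<open>Subtracting a multiple of a unit section moves a section of F^p into
  \<open>ker \<pi>\<close>. For p <= 0 the unit section lies in F^p; for p >= 1 the multiple is
  zero.\<close>

lemma ksection_through:
  assumes z0: "z0 \<in> A" and x: "x \<in> G z0 p"
  obtains B \<sigma> where "ksection p B \<sigma>" "z0 \<in> B" "\<sigma> z0 = x"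
proof -
  have x': "x \<in> \<Psi> z0 p" "\<pi> x = 0" using x by (auto simp: kfilt_def)
  obtain B1 \<sigma> where B1: "filt_section \<Psi> p B1 \<sigma>" "B1 \<subseteq> A" "z0 \<in> B1" "\<sigma> z0 = x"
    using section_through[OF z0 x'(1)] by blast
  obtain B2 \<tau> where B2: "filt_section \<Psi> 0 B2 \<tau>" "B2 \<subseteq> A" "z0 \<in> B2" "\<And>z. z \<in> B2 \<Longrightarrow> \<pi> (\<tau> z) = 1"
    using unit_section[OF z0] by blast
  let ?B = "B1 \<inter> B2"
  have h: "hol_on ?B \<sigma>" "hol_on ?B \<tau>" "open ?B"
    using B1(1) B2(1) by (auto simp: filt_section_def intro: hol_on_subset)
  let ?s = "\<lambda>z. \<sigma> z + (- \<pi> (\<sigma> z)) *s \<tau> z"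
  have "hol_on ?B (\<lambda>z. (- \<pi> (\<sigma> z)) *s \<tau> z)"
  proof (rule hol_on_scalar[OF h(2)])
    fix z assume "z \<in> ?B"
    from derivative_pi[OF hol_on_has_derivative(1)[OF h(1) this]]
    show "((\<lambda>z. - \<pi> (\<sigma> z)) has_derivative (\<lambda>v. - \<pi> (frechet_derivative \<sigma> (at z) v))) (at z)"
      by (rule has_derivative_minus)
  qed (simp add: hol_on_has_derivative(2)[OF h(1)] pi_all)
  with h(1) have hs: "hol_on ?B ?s" by (rule hol_on_add)
  have "?s z \<in> G z p" if z: "z \<in> ?B" for z
  proof -
    interpret m: mixed_hs \<pi> e0 q "\<Psi> z" N using fib_mixed z B1(2) by blast
    have s: "\<sigma> z \<in> \<Psi> z p" and t: "\<tau> z \<in> \<Psi> z 0"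
      using z B1(1) B2(1) by (auto simp: filt_section_def)
    have "(- \<pi> (\<sigma> z)) *s \<tau> z \<in> \<Psi> z p"
    proof (cases "p \<ge> 1")
      case True
      then show ?thesis using m.F_pos[OF _ s] m.F_simps(1) by simp
    next
      case False
      then show ?thesis using m.F_simps(4)[OF m.F_anti[OF _ t], of p "- \<pi> (\<sigma> z)"] by simp
    qed
    then have "?s z \<in> \<Psi> z p" using m.F_simps(2)[OF s] by blast
    then show ?thesis using B2(4) z by (simp add: kfilt_def pi_all)
  qed
  with h(3) B1(2) hs have "ksection p ?B ?s" by (auto simp: ksection_def)
  moreover have "?s z0 = x" using B1(4) x'(2) by simp
  ultimately show thesis using that B1(3) B2(3) by blast
qed

lemma ksection_subset: "ksection p B \<sigma> \<Longrightarrow> open B' \<Longrightarrow> B' \<subseteq> B \<Longrightarrow> ksection p B' \<sigma>"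
  unfolding ksection_def using hol_on_subset by blast

section \<open>Smoothness of the Hodge projections\<close>

lemma Ck_P_local:
  assumes z0: "z0 \<in> A"
  shows "\<exists>B. open B \<and> z0 \<in> B \<and> Ck_on k B (P p)"
proof -
  interpret m0: pure_hs \<pi> e0 q "G z0" N by (rule fib_pure[OF z0])
  \<comment> \<open>For each unit vector, its two parts at \<open>z0\<close> are extended: the
    F^p-part holomorphically, the complementary part as the conjugate of a holomorphic section of
    F^(-p).\<close>
  have "\<exists>B \<sigma>. ksection p B \<sigma> \<and> z0 \<in> B \<and> \<sigma> z0 = P p z0 *v axis j 1" for j
    using ksection_through[OF z0 m0.P_works(1)] by metis
  then obtain B1 \<sigma> where s: "\<And>j. ksection p (B1 j) (\<sigma> j)" "\<And>j. z0 \<in> B1 j"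
    "\<And>j. \<sigma> j z0 = P p z0 *v axis j 1" by metis
  have "\<exists>B \<tau>. ksection (- p) B \<tau> \<and> z0 \<in> B \<and> \<tau> z0 = vcnj (kp (axis j 1) - P p z0 *v axis j 1)" for j
    using ksection_through[OF z0 m0.P_works(2)] by metis
  then obtain B2 \<tau> where t: "\<And>j. ksection (- p) (B2 j) (\<tau> j)" "\<And>j. z0 \<in> B2 j"
    "\<And>j. \<tau> j z0 = vcnj (kp (axis j 1) - P p z0 *v axis j 1)" by metis
  define B where "B = (\<Inter>j. B1 j) \<inter> (\<Inter>j. B2 j)"
  have oB: "open B"
    unfolding B_def by (intro open_Int open_INT) (use s(1) t(1) in \<open>auto simp: ksection_def\<close>)
  have "B \<subseteq> B1 j" "B \<subseteq> B2 j" for j by (auto simp: B_def)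
  then have sB: "ksection p B (\<sigma> j)" "ksection (- p) B (\<tau> j)" for j
    using ksection_subset[OF s(1) oB] ksection_subset[OF t(1) oB] by blast+
  text \<open>The columns of \<open>M - S\<close> are in the kernel of \<open>P\<close>, hence \<open>P M = S\<close>; and \<open>M\<close> is the identity at \<open>z0\<close>.\<close>
  define M where "M z = (\<chi> i j. (\<sigma> j z + vcnj (\<tau> j z) + \<pi> (axis j 1) *s e0) $ i)" for z
  define S where "S z = (\<chi> i j. \<sigma> j z $ i)" for z
  have M_col: "M z *v axis j 1 = \<sigma> j z + vcnj (\<tau> j z) + \<pi> (axis j 1) *s e0" for z j
    by (simp only: vec_eq_iff matrix_vector_axis) (simp add: M_def)
  have S_col: "S z *v axis j 1 = \<sigma> j z" for z j
    by (simp only: vec_eq_iff matrix_vector_axis) (simp add: S_def)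
  have ck: "Ck_on k B (\<sigma> j)" "Ck_on k B (\<tau> j)" for j k
    using sB[of j] hol_on_Ck[OF oB, of "\<sigma> j"] hol_on_Ck[OF oB, of "\<tau> j"] by (auto simp: ksection_def)
  have ckS: "Ck_on k B S" for k
    unfolding S_def by (intro Ck_on_vec oB) (simp add: Ck_on_nth[OF oB ck(1)])
  have ckM: "Ck_on k B M" for k
    unfolding M_def
    by (intro Ck_on_vec oB)
       (simp only: vec_lambda_beta, intro Ck_on_nth Ck_on_add oB Ck_on_const ck Ck_on_linear[OF bounded_linear_vcnj])
  define B' where "B' = {z \<in> B. det (M z) \<noteq> 0}"
  have "continuous_on B (\<lambda>z. det (M z))"
    using Ck_on_det[OF oB ckM[of 0]] by simp
  then have "open (B \<inter> (\<lambda>z. det (M z)) -` (- {0}))"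
    using continuous_open_preimage oB open_Compl by blast
  moreover have "B' = B \<inter> (\<lambda>z. det (M z)) -` (- {0})" by (auto simp: B'_def)
  ultimately have oB': "open B'" by simp
  have sub: "B' \<subseteq> B" by (auto simp: B'_def)
  have "M z0 = mat 1"
    by (rule matrix_eq_axis) (simp add: M_col s(3) t(3) kp_def del: kp_simps)
  then have z0': "z0 \<in> B'" using s(2) t(2) by (simp add: B'_def B_def)
  have "S z ** matrix_inv (M z) = P p z" if z: "z \<in> B'" for z
  proof -
    have zB: "z \<in> B" and zA: "z \<in> A" using z sub sB(1) by (auto simp: ksection_def)
    interpret m: pure_hs \<pi> e0 q "G z" N by (rule fib_pure[OF zA])
    have "P p z ** M z = S z"
    proof (rule matrix_eq_axis)
      fix j
      have "\<sigma> j z \<in> G z p" "vcnj (vcnj (\<tau> j z)) \<in> G z (- p)" using sB zB by (auto simp: ksection_def)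
      then show "(P p z ** M z) *v axis j 1 = S z *v axis j 1"
        by (simp add: M_col S_col mv_simps m.P_id m.P_zero m.P_e0 flip: matrix_vector_mul_assoc)
    qed
    moreover have "invertible (M z)" using z by (simp add: B'_def invertible_det_nz)
    ultimately show ?thesis
      by (metis matrix_inv_left_right(2) matrix_mul_assoc matrix_mul_rid)
  qed
  moreover have "Ck_on k B' (\<lambda>z. S z ** matrix_inv (M z))"
  proof (intro Ck_on_bilinear[OF bounded_bilinear_mm] Ck_on_matrix_inv oB')
    show "Ck_on k B' S" "Ck_on k B' M" using Ck_on_subset[OF ckS sub] Ck_on_subset[OF ckM sub] by auto
    show "invertible (M z)" if "z \<in> B'" for z using that by (simp add: B'_def invertible_det_nz)
  qed
  ultimately have "Ck_on k B' (P p)" by (rule Ck_on_cong_imp[OF oB'])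
  then show ?thesis using oB' z0' by blast
qed

lemma smooth_P: "smooth_on A (P p)"
  by (rule smooth_onI, rule Ck_on_local, rule Ck_P_local)

lemma E_unit_section:
  assumes "filt_section \<Psi> 0 B \<sigma>" "B \<subseteq> A" "\<And>z. z \<in> B \<Longrightarrow> \<pi> (\<sigma> z) = 1" "z \<in> B"
  shows "E z = \<sigma> z + P 0 z *v (vcnj (\<sigma> z) - \<sigma> z)"
  by (rule mixed_hs.real_lift_works(1)[OF fib_mixed]) (use assms in \<open>auto simp: filt_section_def\<close>)

lemma smooth_E: "smooth_on A E"
proof (rule smooth_onI, rule Ck_on_local)
  fix k z0 assume z0: "z0 \<in> A"
  obtain B \<sigma> where B: "filt_section \<Psi> 0 B \<sigma>" "B \<subseteq> A" "z0 \<in> B" "\<And>z. z \<in> B \<Longrightarrow> \<pi> (\<sigma> z) = 1"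
    using unit_section[OF z0] by blast
  have oB: "open B" and h: "hol_on B \<sigma>" using B(1) by (auto simp: filt_section_def)
  have m: "Ck_on k B (\<lambda>z. - \<sigma> z)"
    by (rule Ck_on_linear[OF bounded_linear_minus[OF bounded_linear_ident] oB hol_on_Ck[OF oB h]])
  have "Ck_on k B (\<lambda>z. \<sigma> z + P 0 z *v (vcnj (\<sigma> z) + - \<sigma> z))"
    by (intro Ck_on_add oB m Ck_on_bilinear[OF bounded_bilinear_mv] Ck_on_linear[OF bounded_linear_vcnj]
        hol_on_Ck h Ck_on_subset[OF smooth_on_Ck[OF smooth_P] B(2)])
  then have "Ck_on k B E"
    by (rule Ck_on_cong_imp[OF oB, rotated]) (simp add: E_unit_section[OF B(1,2,4)])
  then show "\<exists>B. open B \<and> z0 \<in> B \<and> Ck_on k B E" using oB B(3) by blast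
qed

end

section \<open>Derivatives of the Hodge projections\<close>

context period_family
begin

lemma P_deriv: "z \<in> A \<Longrightarrow> (P p has_derivative dP p z) (at z)"
  by (rule smooth_on_has_derivative[OF smooth_P])

lemma E_deriv: "z \<in> A \<Longrightarrow> (E has_derivative dE z) (at z)"
  by (rule smooth_on_has_derivative[OF smooth_E])

lemma Px_deriv: "z \<in> A \<Longrightarrow> ((\<lambda>z. P p z *v x) has_derivative (\<lambda>v. dP p z v *v x)) (at z)"
  using bounded_bilinear.FDERIV[OF bounded_bilinear_mv P_deriv has_derivative_const[of x]] by simp

lemma dP_linear: "z \<in> A \<Longrightarrow> dP p z (v + w) = dP p z v + dP p z w"
  using linear_add[OF has_derivative_linear[OF P_deriv]] .

lemma dE_linear: "z \<in> A \<Longrightarrow> dE z (v + w) = dE z v + dE z w"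
  using linear_add[OF has_derivative_linear[OF E_deriv]] .

lemma dP_const:
  assumes z: "z \<in> A" and "open B" "z \<in> B" "\<And>x. x \<in> B \<Longrightarrow> P p x = M"
  shows "dP p z v = 0"
  using has_derivative_eq_on[OF P_deriv[OF z] has_derivative_const assms(2,3)] assms(4) by simp

lemma dP_K: "z \<in> A \<Longrightarrow> \<pi> (dP p z v *v x) = 0"
  using has_derivative_eq_on[OF derivative_pi[OF Px_deriv] has_derivative_const[of 0] open_A, of z p x]
    pure_hs.P_K[OF fib_pure] by blast

lemma dP_e0: "z \<in> A \<Longrightarrow> dP p z v *v e0 = 0"
  using has_derivative_eq_on[OF Px_deriv has_derivative_const[of 0] open_A, of z p e0]
    pure_hs.P_e0[OF fib_pure] by blast

lemma dP_kp: "z \<in> A \<Longrightarrow> dP p z v *v kp x = dP p z v *v x"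
  by (simp add: kp_def mv_simps dP_e0)

lemma P_idem_mat: "z \<in> A \<Longrightarrow> P p z ** P p z = P p z"
  using pure_hs.P_idem[OF fib_pure] by (simp add: matrix_eq flip: matrix_vector_mul_assoc)

lemma dP_idem: "z \<in> A \<Longrightarrow> P p z ** dP p z v + dP p z v ** P p z = dP p z v"
  using has_derivative_eq_on[OF bounded_bilinear.FDERIV[OF bounded_bilinear_mm P_deriv P_deriv] P_deriv open_A, of z p p p]
    P_idem_mat by blast

lemma dP_cnj:
  assumes z: "z \<in> A"
  shows "vcnj (dP p z v *v vcnj x) = - (dP (- p) z v *v x)"
proof -
  have 1: "((\<lambda>z. vcnj (P p z *v vcnj x)) has_derivative (\<lambda>v. vcnj (dP p z v *v vcnj x))) (at z)"
    by (rule bounded_linear.has_derivative[OF bounded_linear_vcnj Px_deriv[OF z]])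
  have 2: "((\<lambda>z. kp x - P (- p) z *v x) has_derivative (\<lambda>v. 0 - dP (- p) z v *v x)) (at z)"
    by (intro has_derivative_diff has_derivative_const Px_deriv z)
  show ?thesis
    using has_derivative_eq_on[OF 1 2 open_A z pure_hs.P_cnj[OF fib_pure], of v] by simp
qed

lemma dP_q:
  assumes z: "z \<in> A" and x: "\<pi> x = 0" "\<pi> y = 0"
  shows "q (dP p z v *v x) y = - q x (dP (- p) z v *v y)"
proof -
  have 1: "((\<lambda>z. q (P p z *v x) y) has_derivative (\<lambda>v. q (dP p z v *v x) y)) (at z)"
    using bounded_bilinear.FDERIV[OF bounded_bilinear_q Px_deriv[OF z] has_derivative_const[of y]]
    by (simp add: q_all)
  have 2: "((\<lambda>z. q x y - q x (P (- p) z *v y)) has_derivative (\<lambda>v. 0 - q x (dP (- p) z v *v y))) (at z)"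
    using has_derivative_diff[OF has_derivative_const
        bounded_bilinear.FDERIV[OF bounded_bilinear_q has_derivative_const[of x] Px_deriv[OF z]]]
    by (simp add: q_all)
  have 3: "q (P p z *v x) y = q x y - q x (P (- p) z *v y)" if "z \<in> A" for z
    using pure_hs.P_q[OF fib_pure[OF that] x] by (simp add: q_all)
  show ?thesis
    using has_derivative_eq_on[OF 1 2 open_A z 3, of v] by simp
qed

text \<open>Differentiate P_p \<sigma> = \<sigma>. The section need only be differentiable, which is
  used below for a non-holomorphic one.\<close>

lemma dP_section:
  assumes s: "(\<sigma> has_derivative D) (at z)" and B: "open B" "z \<in> B" "B \<subseteq> A" "\<And>x. x \<in> B \<Longrightarrow> \<sigma> x \<in> G x p"
  shows "dP p z v *v \<sigma> z = D v - P p z *v D v"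
proof -
  have z: "z \<in> A" using B by blast
  have "((\<lambda>z. P p z *v \<sigma> z) has_derivative (\<lambda>v. P p z *v D v + dP p z v *v \<sigma> z)) (at z)"
    by (rule bounded_bilinear.FDERIV[OF bounded_bilinear_mv P_deriv[OF z] s])
  then have "P p z *v D v + dP p z v *v \<sigma> z = D v"
    using has_derivative_eq_on[OF _ s B(1,2)] pure_hs.P_id[OF fib_pure] B(3,4) by blast
  then show ?thesis by (simp add: algebra_simps)
qed

lemma ksection_derivative:
  assumes s: "ksection p B \<sigma>" and z: "z \<in> B"
  shows "frechet_derivative \<sigma> (at z) v \<in> G z (p - 1)"
    "dP p z v *v \<sigma> z = frechet_derivative \<sigma> (at z) v - P p z *v frechet_derivative \<sigma> (at z) v"
    "frechet_derivative \<sigma> (at z) (c *s v) = c *s frechet_derivative \<sigma> (at z) v"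
proof -
  have h: "hol_on B \<sigma>" and B: "open B" "B \<subseteq> A" "\<And>x. x \<in> B \<Longrightarrow> \<sigma> x \<in> G x p"
    using s by (auto simp: ksection_def)
  note D = hol_on_has_derivative[OF h z]
  have "filt_section \<Psi> p B \<sigma>" using B h by (auto simp: filt_section_def kfilt_def)
  then have "frechet_derivative \<sigma> (at z) v \<in> \<Psi> z (p - 1)"
    using griffiths B(2) z unfolding griffiths_transversal_def by blast
  moreover have "\<pi> (frechet_derivative \<sigma> (at z) v) = 0"
    using has_derivative_eq_on[OF derivative_pi[OF D(1)] has_derivative_const[of 0] B(1) z] B(3)
    by (auto simp: kfilt_def)
  ultimately show "frechet_derivative \<sigma> (at z) v \<in> G z (p - 1)" by (simp add: kfilt_def)
  show "dP p z v *v \<sigma> z = frechet_derivative \<sigma> (at z) v - P p z *v frechet_derivative \<sigma> (at z) v"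
    by (rule dP_section[OF D(1) B(1) z B(2,3)])
  show "frechet_derivative \<sigma> (at z) (c *s v) = c *s frechet_derivative \<sigma> (at z) v" by (rule D(2))
qed

text \<open>Extending x to a holomorphic section \<sigma> gives dP_p(v) x = (1 - P_p) d\<sigma>(v).
  By transversality this lies in F^(p-1), as a value of 1 - P_p in the conjugate of F^(-p); together
  this is type (p - 1, -p). Linearity in v is that of d\<sigma>.\<close>

lemma dP_G:
  assumes z: "z \<in> A" and x: "x \<in> G z p"
  shows "dP p z v *v x \<in> H z (p - 1)" "dP p z (c *s v) *v x = c *s (dP p z v *v x)"
proof -
  interpret m: pure_hs \<pi> e0 q "G z" N by (rule fib_pure[OF z])
  obtain B \<sigma> where s: "ksection p B \<sigma>" "z \<in> B" "\<sigma> z = x" using ksection_through[OF z x] by blast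
  let ?D = "\<lambda>v. frechet_derivative \<sigma> (at z) v"
  note D = ksection_derivative[OF s(1,2)]
  have eq: "dP p z v *v x = ?D v - P p z *v ?D v" for v using D(2) s(3) by simp
  have "P p z *v ?D v \<in> G z (p - 1)" by (rule m.G_anti[OF _ m.P_works(1)]) simp
  then have "dP p z v *v x \<in> G z (p - 1)" unfolding eq using m.G_simps(3)[OF D(1)] by blast
  moreover have "vcnj (dP p z v *v x) \<in> G z (- p)"
    using m.P_works(2)[of "?D v" p] m.G_K[OF D(1)] unfolding eq by (simp only: kp_id)
  ultimately show "dP p z v *v x \<in> H z (p - 1)" by (simp add: hpiece_def)
  show "dP p z (c *s v) *v x = c *s (dP p z v *v x)"
    unfolding eq D(3) by (simp add: vec.scale_right_diff_distrib)
qed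

text \<open>A section of F^(p+1) has its derivative in F^p, where 1 - P_p vanishes.\<close>

lemma dP_G_next:
  assumes z: "z \<in> A" and x: "x \<in> G z (p + 1)"
  shows "dP p z v *v x = 0"
proof -
  interpret m: pure_hs \<pi> e0 q "G z" N by (rule fib_pure[OF z])
  obtain B \<sigma> where s: "ksection (p + 1) B \<sigma>" "z \<in> B" "\<sigma> z = x" using ksection_through[OF z x] by blast
  have "ksection p B \<sigma>"
    using s(1) pure_hs.G_anti[OF fib_pure, of _ p "p + 1"] unfolding ksection_def by auto
  from ksection_derivative(2)[OF this s(2)] ksection_derivative(1)[OF s(1,2)] s(3)
  show ?thesis by (simp add: m.P_id)
qed

lemma dP_cG:
  assumes z: "z \<in> A" and x: "vcnj x \<in> G z (- p)"
  shows "dP p z v *v x \<in> H z p"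
proof -
  interpret m: pure_hs \<pi> e0 q "G z" N by (rule fib_pure[OF z])
  have "dP p z v *v x = - vcnj (dP (- p) z v *v vcnj x)"
    using dP_cnj[OF z, of "- p" v x] by simp
  then show ?thesis
    using m.H_vcnj[OF dP_G(1)[OF z x]] vec.subspace_neg[OF m.H_sub] by fastforce
qed

lemma dP_cG_next:
  assumes z: "z \<in> A" and x: "vcnj x \<in> G z (- p + 1)"
  shows "dP p z v *v x = 0"
  using dP_cnj[OF z, of "- p" v x] dP_G_next[OF z x] by simp

text \<open>On one Hodge component only two projections have nonzero derivative: the index r lowers
  the type by one, the index r + 1 raises it by one.\<close>

lemma dP_H:
  assumes z: "z \<in> A" and x: "x \<in> H z r"
  shows "dP r z v *v x \<in> H z (r - 1)" "dP (r + 1) z v *v x \<in> H z (r + 1)"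
    "p \<noteq> r \<Longrightarrow> p \<noteq> r + 1 \<Longrightarrow> dP p z v *v x = 0"
    "dP r z (c *s v) *v x = c *s (dP r z v *v x)"
proof -
  interpret m: pure_hs \<pi> e0 q "G z" N by (rule fib_pure[OF z])
  have x1: "x \<in> G z r" and x2: "vcnj x \<in> G z (- 1 - r)" using x by (auto simp: hpiece_def)
  show "dP r z v *v x \<in> H z (r - 1)" "dP r z (c *s v) *v x = c *s (dP r z v *v x)"
    using dP_G[OF z x1] by auto
  show "dP (r + 1) z v *v x \<in> H z (r + 1)" 
  proof (rule dP_cG[OF z])
    have "- (r + 1) = - 1 - r" by simp
    then show "vcnj x \<in> G z (- (r + 1))" using x2 by (simp only:)
  qed
  show "dP p z v *v x = 0" if "p \<noteq> r" "p \<noteq> r + 1"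
  proof (cases "p < r")
    case True
    then show ?thesis using dP_G_next[OF z m.G_anti[OF _ x1]] by simp
  next
    case False
    then show ?thesis using dP_cG_next[OF z m.G_anti[OF _ x2]] that by simp
  qed
qed

lemma dE_K: "z \<in> A \<Longrightarrow> \<pi> (dE z v) = 0"
  using has_derivative_eq_on[OF derivative_pi[OF E_deriv] has_derivative_const[of 1] open_A, of z]
    mixed_hs.e_props(3)[OF fib_mixed] by blast

lemma dE_real: "z \<in> A \<Longrightarrow> vcnj (dE z v) = dE z v"
  by (rule has_derivative_eq_on[OF bounded_linear.has_derivative[OF bounded_linear_vcnj E_deriv] E_deriv open_A])
    (auto intro: mixed_hs.e_props(2)[OF fib_mixed])

text \<open>
  The derivative of the period map sends the real vector \<open>E z\<close> to \<open>xi z v\<close>, of type \<open>(-1, 0)\<close>, and acts on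
  \<open>ker \<pi>\<close> as \<open>al z v\<close> below.
\<close>

definition xi :: "complex^'d \<Rightarrow> complex^'d \<Rightarrow> complex^'n" where
  "xi z v = dE z v - P 0 z *v dE z v"

text \<open>E is not holomorphic, but E - \<sigma> is a smooth section of F^0 in
  \<open>ker \<pi>\<close>, so \<open>dP_section\<close> applies to it. Both resulting terms are
  complex linear in v, hence so is \<open>xi\<close>.\<close>

lemma xi_unit_section:
  assumes B: "filt_section \<Psi> 0 B \<sigma>" "B \<subseteq> A" "\<And>z. z \<in> B \<Longrightarrow> \<pi> (\<sigma> z) = 1" and z: "z \<in> B"
  defines "D \<equiv> frechet_derivative \<sigma> (at z)"
  shows "D v \<in> G z (-1)" "dE z v \<in> G z (-1)" "D (c *s v) = c *s D v" "E z - \<sigma> z \<in> G z 0"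
    "xi z v = D v - P 0 z *v D v + dP 0 z v *v (E z - \<sigma> z)"
proof -
  have h: "hol_on B \<sigma>" and oB: "open B" and sF: "\<And>z. z \<in> B \<Longrightarrow> \<sigma> z \<in> \<Psi> z 0"
    using B(1) by (auto simp: filt_section_def)
  have zA: "z \<in> A" using z B by blast
  interpret m: pure_hs \<pi> e0 q "G z" N by (rule fib_pure[OF zA])
  note D = hol_on_has_derivative[OF h z, folded D_def]
  show "D (c *s v) = c *s D v" by (rule D(2))
  have piD: "\<pi> (D v) = 0"
    using has_derivative_eq_on[OF derivative_pi[OF D(1)] has_derivative_const[of 1] oB z] B(3) by blast
  have "D v \<in> \<Psi> z (0 - 1)" using griffiths B(1,2) z unfolding griffiths_transversal_def D_def by blast
  then show DG: "D v \<in> G z (-1)" using piD by (simp add: kfilt_def)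
  have k: "E x - \<sigma> x \<in> G x 0" if x: "x \<in> B" for x
  proof -
    interpret mx: mixed_hs \<pi> e0 q "\<Psi> x" N using fib_mixed x B(2) by blast
    show ?thesis using mx.F_simps(3)[OF mx.e_props(1) sF[OF x]] mx.e_props(3) B(3)[OF x]
      by (simp add: kfilt_def pi_all)
  qed
  then show kz: "E z - \<sigma> z \<in> G z 0" using z by blast
  have dk: "((\<lambda>x. E x - \<sigma> x) has_derivative (\<lambda>v. dE z v - D v)) (at z)"
    by (rule has_derivative_diff[OF E_deriv[OF zA] D(1)])
  have s: "dP 0 z v *v (E z - \<sigma> z) = (dE z v - D v) - P 0 z *v (dE z v - D v)"
    by (rule dP_section[OF dk oB z B(2) k])
  then show "xi z v = D v - P 0 z *v D v + dP 0 z v *v (E z - \<sigma> z)"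
    by (simp add: xi_def mv_simps)
  have "dP 0 z v *v (E z - \<sigma> z) \<in> G z (-1)" using dP_G(1)[OF zA kz] by (simp add: hpiece_def)
  moreover have "P 0 z *v (dE z v - D v) \<in> G z (-1)" by (rule m.G_anti[OF _ m.P_works(1)]) simp
  ultimately have "dP 0 z v *v (E z - \<sigma> z) + P 0 z *v (dE z v - D v) + D v \<in> G z (-1)"
    using DG m.G_simps(2) by blast
  then show "dE z v \<in> G z (-1)" using s by simp
qed

lemma xi_props:
  assumes z: "z \<in> A"
  shows "xi z v \<in> H z (-1)" "xi z (c *s v) = c *s xi z v" "dE z v = xi z v + vcnj (xi z v)"
    "xi z (v + w) = xi z v + xi z w"
proof -
  interpret m: pure_hs \<pi> e0 q "G z" N by (rule fib_pure[OF z])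
  obtain B \<sigma> where B: "filt_section \<Psi> 0 B \<sigma>" "B \<subseteq> A" "z \<in> B" "\<And>z. z \<in> B \<Longrightarrow> \<pi> (\<sigma> z) = 1"
    using unit_section[OF z] by blast
  note s = xi_unit_section[OF B(1,2,4,3)]
  have "P 0 z *v dE z v \<in> G z (-1)" by (rule m.G_anti[OF _ m.P_works(1)]) simp
  then have "xi z v \<in> G z (-1)" unfolding xi_def using m.G_simps(3)[OF s(2)] by blast
  moreover have "vcnj (xi z v) \<in> G z 0"
    using m.P_works(2)[of "dE z v" 0] unfolding xi_def kp_id[OF dE_K[OF z]] by simp
  ultimately show "xi z v \<in> H z (-1)" by (simp add: hpiece_def)
  show "xi z (c *s v) = c *s xi z v"
    using s(5)[of "c *s v"] s(5)[of v]
    by (simp add: s(3) dP_G(2)[OF z s(4)] vec.scale_right_diff_distrib vec.scale_right_distrib)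
  \<comment> \<open>The derivative of the real lift is real, so its F^0-part is the conjugate of the
    other part.\<close>
  have "vcnj (P 0 z *v dE z v) = dE z v - P 0 z *v dE z v"
    using m.P_cnj[of 0 "dE z v"] unfolding dE_real[OF z] kp_id[OF dE_K[OF z]] by simp
  then show "dE z v = xi z v + vcnj (xi z v)" by (simp add: xi_def dE_real[OF z])
  show "xi z (v + w) = xi z v + xi z w" by (simp add: xi_def dE_linear[OF z] mv_simps)
qed

section \<open>The derivative of the period map\<close>

definition al :: "complex^'d \<Rightarrow> complex^'d \<Rightarrow> complex^'n^'n" where
  "al z v = (\<Sum>p\<in>{- N..<N}. dP p z v ** C p z)"

lemma al_mv: "al z v *v x = (\<Sum>p\<in>{- N..<N}. dP p z v *v (C p z *v x))"
  by (simp add: al_def sum_mv matrix_vector_mul_assoc)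

lemma al_H:
  assumes z: "z \<in> A" and x: "x \<in> H z r"
  shows "al z v *v x = dP r z v *v x"
proof -
  interpret m: pure_hs \<pi> e0 q "G z" N by (rule fib_pure[OF z])
  show ?thesis
  proof (cases "x = 0")
    case False
    have "al z v *v x = (\<Sum>p\<in>{- N..<N}. if p = r then dP r z v *v x else 0)"
      unfolding al_mv by (rule sum.cong) (auto simp: m.C_H[OF x])
    then show ?thesis using m.H_bot[OF x False] by simp
  qed simp
qed

lemma al_K: "z \<in> A \<Longrightarrow> \<pi> (al z v *v x) = 0"
  by (simp add: al_mv pi_sum dP_K)

lemma al_kp: "z \<in> A \<Longrightarrow> al z v *v kp x = al z v *v x"
  by (simp add: al_mv pure_hs.C_kp[OF fib_pure])

lemma K_expand: "z \<in> A \<Longrightarrow> \<pi> x = 0 \<Longrightarrow> x = (\<Sum>p\<in>{- N..<N}. C p z *v x)"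
  by (simp add: pure_hs.C_sum[OF fib_pure] kp_id)

text \<open>Additive identities on \<open>ker \<pi>\<close> need only be checked on the Hodge components.\<close>

lemma K_ext:
  assumes z: "z \<in> A" and x: "\<pi> x = 0"
    and add: "\<And>T f. finite T \<Longrightarrow> (\<And>t. t \<in> T \<Longrightarrow> g (f t) = (0::'b::comm_monoid_add)) \<Longrightarrow> g (sum f (T::int set)) = 0"
    and H: "\<And>r x. x \<in> H z r \<Longrightarrow> g x = 0"
  shows "g x = 0"
  by (subst K_expand[OF z x], rule add) (use H pure_hs.C_in[OF fib_pure[OF z]] in auto)

lemma al_scale:
  assumes z: "z \<in> A"
  shows "al z (c *s v) *v x = c *s (al z v *v x)"
proof -
  have "al z (c *s v) *v kp x - c *s (al z v *v kp x) = 0"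
  proof (rule K_ext[OF z, of "kp x" "\<lambda>x. al z (c *s v) *v x - c *s (al z v *v x)"])
    show "al z (c *s v) *v x - c *s (al z v *v x) = 0" if "x \<in> H z r" for r x
      by (simp add: al_H[OF z that] dP_H(4)[OF z that])
  qed (auto simp: mv_sum vec.scale_sum_right sum_subtractf[symmetric])
  then show ?thesis by (simp add: al_kp[OF z])
qed

lemma al_add: "z \<in> A \<Longrightarrow> al z (v + w) = al z v + al z w"
  by (simp add: al_def dP_linear mm_add_left sum.distrib)

text \<open>Since \<open>al\<close> lowers types by one, components r and s can contribute only if s
  = - r, and there the identity is the transposition rule for dP_r.\<close>

lemma al_skew:
  assumes z: "z \<in> A" and x: "\<pi> x = 0" and y: "\<pi> y = 0"
  shows "q (al z v *v x) y + q x (al z v *v y) = 0"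
proof -
  interpret m: pure_hs \<pi> e0 q "G z" N by (rule fib_pure[OF z])
  have 1: "q (al z v *v a) b + q a (al z v *v b) = 0" if a: "a \<in> H z r" and b: "b \<in> H z s" for a b r s
  proof (cases "s = - r")
    case True
    then show ?thesis
      using dP_q[OF z m.H_K[OF a] m.H_K[OF b], of r v] by (simp add: al_H[OF z a] al_H[OF z b])
  next
    case False
    have "q (dP r z v *v a) (vcnj (vcnj b)) = 0"
      by (rule m.H_q[OF dP_H(1)[OF z a] m.H_vcnj[OF b]]) (use False in simp)
    moreover have "q a (vcnj (vcnj (dP s z v *v b))) = 0"
      by (rule m.H_q[OF a m.H_vcnj[OF dP_H(1)[OF z b]]]) (use False in simp)
    ultimately show ?thesis by (simp add: al_H[OF z a] al_H[OF z b])
  qed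
  have 2: "q (al z v *v a) y + q a (al z v *v y) = 0" if a: "a \<in> H z r" for a r
    by (rule K_ext[OF z y]) (auto simp: mv_sum q_sum_right sum.distrib[symmetric] 1[OF a])
  show ?thesis
    by (rule K_ext[OF z x]) (auto simp: mv_sum q_sum_left sum.distrib[symmetric] 2)
qed

text \<open>The part of type (-1, 1) of the period derivative, extended by zero to the real lift;
  \<open>uB\<close> is the part of type (-1, 0).\<close>

definition uA :: "complex^'d \<Rightarrow> complex^'d \<Rightarrow> complex^'n^'n" where
  "uA z v = matrix (\<lambda>x. al z v *v (x - \<pi> x *s E z))"

definition uB :: "complex^'d \<Rightarrow> complex^'d \<Rightarrow> complex^'n^'n" where
  "uB z v = matrix (\<lambda>x. \<pi> x *s xi z v)"

lemma uA_mv: "uA z v *v x = al z v *v (x - \<pi> x *s E z)"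
  unfolding uA_def
  by (rule linear_matrixI)
    (simp_all add: mv_simps pi_all vec.scale_left_distrib vec.scale_right_diff_distrib)

lemma uB_mv: "uB z v *v x = \<pi> x *s xi z v"
  unfolding uB_def by (rule linear_matrixI) (simp_all add: pi_all vec.scale_left_distrib)

lemma u_tangent:
  assumes z: "z \<in> A"
  shows "uA z v + uB z v \<in> tangent_algebra W Q (\<Psi> z)"
proof -
  interpret m: polarized_mixed_hs \<pi> e0 q "\<Psi> z" N W Q by (rule fib[OF z])
  show ?thesis
  proof (rule m.tangent_algebraI)
    show "\<pi> (uA z v *v x) = 0" for x by (simp add: uA_mv al_K[OF z])
    show "uA z v *v E z = 0" by (simp add: uA_mv m.e_props)
    show "uA z v *v x \<in> H z (p - 1)" if "x \<in> H z p" for p x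
      using dP_H(1)[OF z that] by (simp add: uA_mv m.H_K[OF that] al_H[OF z that])
    show "q (uA z v *v x) y + q x (uA z v *v y) = 0" if "\<pi> x = 0" "\<pi> y = 0" for x y
      using al_skew[OF z that] by (simp add: uA_mv that)
    show "xi z v \<in> H z (-1)" by (rule xi_props(1)[OF z])
    show "uB z v *v x = \<pi> x *s xi z v" for x by (rule uB_mv)
  qed
qed

text \<open>On the component r = p the two maps agree. For r > p the first vanishes and the second
  lands in type r - 1 >= p.\<close>

lemma dP_minus_al:
  assumes z: "z \<in> A" and x: "x \<in> G z p"
  shows "dP p z v *v x - al z v *v x \<in> G z p"
proof -
  interpret m: pure_hs \<pi> e0 q "G z" N by (rule fib_pure[OF z])
  have "dP p z v *v (C r z *v x) - al z v *v (C r z *v x) \<in> G z p" for r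
  proof -
    have Cr: "C r z *v x \<in> H z r" by (rule m.C_in)
    consider "r < p" | "r = p" | "r > p" by linarith
    then show ?thesis
    proof cases
      case 1
      then have "C r z *v x = 0" using m.G_iff_C[OF m.G_K[OF x]] x by blast
      then show ?thesis using m.G_simps(1) by simp
    next
      case 2
      then show ?thesis using m.G_simps(1) al_H[OF z Cr] by simp
    next
      case 3
      have "dP r z v *v (C r z *v x) \<in> G z (r - 1)" using dP_H(1)[OF z Cr] by (simp add: hpiece_def)
      then have "dP r z v *v (C r z *v x) \<in> G z p" using 3 m.G_anti[of p "r - 1"] by simp
      then show ?thesis using 3 dP_H(3)[OF z Cr, of p] m.G_simps(5) by (simp add: al_H[OF z Cr])
    qed
  qed
  then have "(\<Sum>r\<in>{- N..<N}. dP p z v *v (C r z *v x) - al z v *v (C r z *v x)) \<in> G z p"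
    by (intro m.G_simps(6)) auto
  then have "dP p z v *v (\<Sum>r\<in>{- N..<N}. C r z *v x) - al z v *v (\<Sum>r\<in>{- N..<N}. C r z *v x) \<in> G z p"
    by (simp add: mv_sum sum_subtractf)
  then show ?thesis by (simp only: K_expand[OF z m.G_K[OF x], symmetric])
qed

lemma u_represents:
  assumes B: "B \<subseteq> A" "z \<in> B" and s: "filt_section \<Psi> p B \<sigma>"
  shows "frechet_derivative \<sigma> (at z) v - (uA z v + uB z v) *v \<sigma> z \<in> \<Psi> z p"
proof -
  have h: "hol_on B \<sigma>" and oB: "open B" and sF: "\<And>z. z \<in> B \<Longrightarrow> \<sigma> z \<in> \<Psi> z p"
    using s by (auto simp: filt_section_def)
  have z: "z \<in> A" using B by blast
  interpret m: mixed_hs \<pi> e0 q "\<Psi> z" N by (rule fib_mixed[OF z])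
  define D where "D = frechet_derivative \<sigma> (at z)"
  note D = hol_on_has_derivative[OF h B(2), folded D_def]
  let ?R = "\<lambda>x. \<sigma> x - \<pi> (\<sigma> x) *s E x"
  have R: "?R x \<in> G x p" if x: "x \<in> B" for x
  proof -
    interpret mx: mixed_hs \<pi> e0 q "\<Psi> x" N using fib_mixed x B(1) by blast
    show ?thesis using mx.F_iff_R[of "\<sigma> x" p] sF[OF x] by (simp add: mx.R_def)
  qed
  from has_derivative_diff[OF D(1) bounded_bilinear.FDERIV[OF bounded_bilinear_vec_scale derivative_pi[OF D(1)] E_deriv[OF z]]]
  have dR: "(?R has_derivative (\<lambda>v. D v - (\<pi> (\<sigma> z) *s dE z v + \<pi> (D v) *s E z))) (at z)" .
  let ?d = "D v - (\<pi> (\<sigma> z) *s dE z v + \<pi> (D v) *s E z)"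
  have e1: "dP p z v *v ?R z = ?d - P p z *v ?d"
    by (rule dP_section[OF dR oB B(2,1) R])
  \<comment> \<open>The conjugate of \<open>xi\<close> has type (0, -1) and E lies in F^0, which
    suffices for p <= 0. For p >= 1 both coefficients vanish because \<pi> vanishes along the
    section.\<close>
  have piR: "\<pi> (\<sigma> z) *s vcnj (xi z v) + \<pi> (D v) *s E z \<in> \<Psi> z p"
  proof (cases "p \<ge> 1")
    case True
    have "\<pi> (\<sigma> x) = 0" if "x \<in> B" for x
      using mixed_hs.F_pos[OF fib_mixed True sF[OF that]] that B(1) by blast
    then have "\<pi> (D v) = 0" "\<pi> (\<sigma> z) = 0"
      using has_derivative_eq_on[OF derivative_pi[OF D(1)] has_derivative_const[of 0] oB B(2)] B(2) by auto
    then show ?thesis using m.F_simps(1) by simp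
  next
    case False
    have "vcnj (xi z v) \<in> \<Psi> z 0" using xi_props(1)[OF z, of v] by (simp add: hpiece_def kfilt_def)
    then have "vcnj (xi z v) \<in> \<Psi> z p" "E z \<in> \<Psi> z p"
      using m.F_anti[of p 0] m.e_props(1) False by auto
    then show ?thesis by (intro m.F_simps)
  qed
  have GF: "x \<in> G z p \<Longrightarrow> x \<in> \<Psi> z p" for x by (simp add: kfilt_def)
  \<comment> \<open>Each of the three terms lies in F^p. \<open>uB\<close> takes away
    \<open>xi\<close> from the derivative of E and leaves its conjugate.\<close>
  have "D v - (uA z v + uB z v) *v \<sigma> z =
      (dP p z v *v ?R z - al z v *v ?R z) + P p z *v ?d + (\<pi> (\<sigma> z) *s vcnj (xi z v) + \<pi> (D v) *s E z)"
  proof -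
    have "\<pi> (\<sigma> z) *s dE z v = \<pi> (\<sigma> z) *s xi z v + \<pi> (\<sigma> z) *s vcnj (xi z v)"
      using xi_props(3)[OF z, of v] vec.scale_right_distrib by metis
    then show ?thesis unfolding e1 by (simp add: uA_mv uB_mv mv_simps)
  qed
  then show ?thesis unfolding D_def[symmetric]
    using m.F_simps(2)[OF m.F_simps(2)[OF GF[OF dP_minus_al[OF z R[OF B(2)]]] GF[OF m.P_works(1)]] piR]
    by simp
qed

lemma period_derivative_eq:
  assumes z: "z \<in> A"
  shows "period_derivative W Q A \<Psi> z v = uA z v + uB z v"
  unfolding period_derivative_def
proof (rule the_equality, intro conjI allI impI)
  show "uA z v + uB z v \<in> tangent_algebra W Q (\<Psi> z)" by (rule u_tangent[OF z])
  show "frechet_derivative \<sigma> (at z) v - (uA z v + uB z v) *v \<sigma> z \<in> \<Psi> z p"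
    if "B \<subseteq> A" "z \<in> B" "filt_section \<Psi> p B \<sigma>" for p B \<sigma>
    using u_represents that by blast
  interpret m: polarized_mixed_hs \<pi> e0 q "\<Psi> z" N W Q by (rule fib[OF z])
  fix u
  assume u: "u \<in> tangent_algebra W Q (\<Psi> z) \<and>
    (\<forall>p B \<sigma>. B \<subseteq> A \<longrightarrow> z \<in> B \<longrightarrow> filt_section \<Psi> p B \<sigma> \<longrightarrow> frechet_derivative \<sigma> (at z) v - u *v \<sigma> z \<in> \<Psi> z p)"
  show "u = uA z v + uB z v"
  proof (rule m.tangent_unique)
    show "u \<in> tangent_algebra W Q (\<Psi> z)" "uA z v + uB z v \<in> tangent_algebra W Q (\<Psi> z)"
      using u u_tangent[OF z] by auto
    fix p x assume x: "x \<in> \<Psi> z p"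
    obtain B \<sigma> where B: "filt_section \<Psi> p B \<sigma>" "B \<subseteq> A" "z \<in> B" "\<sigma> z = x"
      using section_through[OF z x] by blast
    have 1: "frechet_derivative \<sigma> (at z) v - u *v x \<in> \<Psi> z p" using u B by blast
    have 2: "frechet_derivative \<sigma> (at z) v - (uA z v + uB z v) *v x \<in> \<Psi> z p"
      using u_represents[OF B(2,3,1)] B(4) by simp
    show "u *v x - (uA z v + uB z v) *v x \<in> \<Psi> z p" using m.F_simps(3)[OF 2 1] by (simp add: algebra_simps)
  qed
qed

end

section \<open>A formula for the pulled back metric\<close>

lemma trace_axis: "trace M = (\<Sum>j\<in>UNIV. (M *v axis j 1) $ j)" for M :: "complex^'n::finite^'n"
  by (simp add: trace_def matrix_vector_axis)

lemma neg_mv: "(- M) *v x = - (M *v x)" for M :: "complex^'n::finite^'m"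
  by (simp add: matrix_vector_mult_def vec_eq_iff sum_negf)

context polarized_mixed_hs
begin

lemma hform_H:
  assumes a: "a \<in> H r" and b: "b \<in> H s"
  shows "hform a b = (if r = s then ipow r * q a (vcnj b) else 0)"
proof (cases "a = 0")
  case True
  then show ?thesis by (simp add: sesq_simps[OF hform_sesq] q_all)
next
  case False
  have "hform a b = (\<Sum>p\<in>{- N..<N}. ipow p * q (C p *v a) (vcnj (C p *v b)))"
    by (simp add: hform_def H_K[OF a] H_K[OF b] R_id)
  also have "\<dots> = (\<Sum>p\<in>{- N..<N}. if p = r then (if r = s then ipow r * q a (vcnj b) else 0) else 0)"
    by (rule sum.cong) (auto simp: C_H[OF a] C_H[OF b] q_all)
  finally show ?thesis using H_bot[OF a False] by simp
qed

lemma hform_e: "hform x e = \<pi> x"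
  by (simp add: hform_def q_all e_props)

end

context period_family
begin

text \<open>The adjoint of \<open>al\<close>: the sign comes from the alternating sign of the Hodge metric.\<close>

definition be :: "complex^'d \<Rightarrow> complex^'d \<Rightarrow> complex^'n^'n" where
  "be z w = - (\<Sum>p\<in>{- N..<N}. dP (p + 1) z w ** C p z)"

lemma be_mv: "be z w *v x = - (\<Sum>p\<in>{- N..<N}. dP (p + 1) z w *v (C p z *v x))"
  by (simp add: be_def neg_mv sum_mv matrix_vector_mul_assoc)

lemma be_H:
  assumes z: "z \<in> A" and x: "x \<in> H z r"
  shows "be z w *v x = - (dP (r + 1) z w *v x)"
proof -
  interpret m: pure_hs \<pi> e0 q "G z" N by (rule fib_pure[OF z])
  show ?thesis
  proof (cases "x = 0")
    case False
    have "(\<Sum>p\<in>{- N..<N}. dP (p + 1) z w *v (C p z *v x)) = (\<Sum>p\<in>{- N..<N}. if p = r then dP (r + 1) z w *v x else 0)"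
      by (rule sum.cong) (auto simp: m.C_H[OF x])
    then show ?thesis unfolding be_mv using m.H_bot[OF x False] by simp
  qed simp
qed

lemma be_K: "z \<in> A \<Longrightarrow> \<pi> (be z w *v x) = 0"
  by (simp add: be_mv pi_sum dP_K pi_simps)

lemma be_kp: "z \<in> A \<Longrightarrow> be z w *v kp x = be z w *v x"
  by (simp add: be_mv pure_hs.C_kp[OF fib_pure])

text \<open>On the component r, dP_p(w) (1 - P_p) vanishes except for p = r + 1, where both sides
  agree. The sum runs up to N because r + 1 reaches N.\<close>

lemma al_be:
  assumes z: "z \<in> A"
  shows "al z v ** be z w = - (\<Sum>p\<in>{- N..N}. dP p z v ** dP p z w ** (mat 1 - P p z))"
proof -
  interpret m: pure_hs \<pi> e0 q "G z" N by (rule fib_pure[OF z])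
  let ?S = "\<lambda>x. \<Sum>p\<in>{- N..N}. dP p z v *v (dP p z w *v (x - P p z *v x))"
  have H: "al z v *v (be z w *v x) + ?S x = 0" if x: "x \<in> H z r" for x r
  proof (cases "x = 0")
    case False
    have 1: "dP p z v *v (dP p z w *v (x - P p z *v x)) = (if p = r + 1 then dP p z v *v (dP p z w *v x) else 0)" for p
      using dP_H(3)[OF z x, of p w] by (cases "p \<le> r") (auto simp: m.P_H[OF x])
    have "?S x = dP (r + 1) z v *v (dP (r + 1) z w *v x)"
      unfolding 1 using m.H_bot[OF x False] by simp
    moreover have "al z v *v (be z w *v x) = - (dP (r + 1) z v *v (dP (r + 1) z w *v x))"
      using al_H[OF z dP_H(2)[OF z x]] by (simp add: be_H[OF z x] vec.neg)
    ultimately show ?thesis by simp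
  qed (simp add: mv_simps)
  have "al z v *v (be z w *v kp x) + ?S (kp x) = 0" for x
  proof (rule K_ext[OF z, of "kp x" "\<lambda>x. al z v *v (be z w *v x) + ?S x"])
    fix T :: "int set" and f
    assume "finite T" and f: "\<And>t. t \<in> T \<Longrightarrow> al z v *v (be z w *v f t) + ?S (f t) = 0"
    have "?S (sum f T) = (\<Sum>t\<in>T. ?S (f t))"
      by (subst sum.swap) (simp add: mv_sum mv_simps sum_subtractf)
    then have "al z v *v (be z w *v sum f T) + ?S (sum f T) = (\<Sum>t\<in>T. al z v *v (be z w *v f t) + ?S (f t))"
      by (simp add: mv_sum sum.distrib)
    then show "al z v *v (be z w *v sum f T) + ?S (sum f T) = 0" using f by simp
  qed (auto intro: H)
  moreover have "dP p z w *v (kp x - P p z *v kp x) = dP p z w *v (x - P p z *v x)" for p x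
    by (simp add: mv_simps dP_kp[OF z] m.P_kp del: kp_simps)
  ultimately have "al z v *v (be z w *v x) = - ?S x" for x
    by (simp add: be_kp[OF z] eq_neg_iff_add_eq_0)
  then show ?thesis
    by (simp add: matrix_eq neg_mv sum_mv mv_simps flip: matrix_vector_mul_assoc)
qed

text \<open>Only components r and s = r - 1 pair. There dP_r crosses q by \<open>dP_q\<close> and
  conjugation by \<open>dP_cnj\<close>; the signs combine with
  \<open>ipow (r - 1) = - ipow r\<close>.\<close>

lemma hform_al_be:
  assumes z: "z \<in> A" and x: "\<pi> x = 0" and y: "\<pi> y = 0"
  shows "polarized_mixed_hs.hform \<pi> e0 q (\<Psi> z) N (al z w *v x) y =
         polarized_mixed_hs.hform \<pi> e0 q (\<Psi> z) N x (be z w *v y)"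
proof -
  interpret m: polarized_mixed_hs \<pi> e0 q "\<Psi> z" N W Q by (rule fib[OF z])
  note sq = m.hform_sesq
  have 1: "m.hform (al z w *v a) b - m.hform a (be z w *v b) = 0"
    if a: "a \<in> H z r" and b: "b \<in> H z s" for a b r s
  proof (cases "s = r - 1")
    case True
    then have s: "s + 1 = r" by simp
    have bH: "be z w *v b \<in> H z r"
      using dP_H(2)[OF z b, of w] vec.subspace_neg[OF m.H_sub] unfolding be_H[OF z b] s by blast
    have "vcnj (be z w *v b) = dP (- r) z w *v vcnj b"
      using dP_cnj[OF z, of r w "vcnj b"] unfolding be_H[OF z b] s by simp
    then have "m.hform a (be z w *v b) = ipow r * q a (dP (- r) z w *v vcnj b)"
      using m.hform_H[OF a bH] by simp
    also have "\<dots> = ipow (r - 1) * q (dP r z w *v a) (vcnj b)"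
      using dP_q[OF z m.H_K[OF a], of "vcnj b" r w] m.H_K[OF b] by (simp add: pi_cnj ipow_simps)
    also have "\<dots> = m.hform (al z w *v a) b"
      unfolding al_H[OF z a] using m.hform_H[OF dP_H(1)[OF z a] b] True by simp
    finally show ?thesis by simp
  next
    case False
    have "be z w *v b \<in> H z (s + 1)"
      using dP_H(2)[OF z b, of w] vec.subspace_neg[OF m.H_sub] unfolding be_H[OF z b] by blast
    from m.hform_H[OF a this] m.hform_H[OF dP_H(1)[OF z a] b] False
    show ?thesis unfolding al_H[OF z a] by auto
  qed
  have 2: "m.hform (al z w *v a) y - m.hform a (be z w *v y) = 0" if a: "a \<in> H z r" for a r
    by (rule K_ext[OF z y]) (auto simp: mv_sum sesq_sum_right[OF sq] sum_subtractf[symmetric] 1[OF a])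
  have "m.hform (al z w *v x) y - m.hform x (be z w *v y) = 0"
    by (rule K_ext[OF z x]) (auto simp: mv_sum sesq_sum_left[OF sq] sum_subtractf[symmetric] 2)
  then show ?thesis by simp
qed

abbreviation u :: "complex^'d \<Rightarrow> complex^'d \<Rightarrow> complex^'n^'n" where
  "u z v \<equiv> uA z v + uB z v"

abbreviation g :: "complex^'d \<Rightarrow> complex^'d \<Rightarrow> complex^'d \<Rightarrow> complex" where
  "g z v w \<equiv> mixed_hodge_metric W Q (\<Psi> z) (u z v) (u z w)"

lemma metric_eq:
  assumes z: "z \<in> A"
  shows "g z v w = - (\<Sum>p\<in>{- N..N}. trace (dP p z v ** dP p z w ** (mat 1 - P p z)))
      - \<i> * q (xi z v) (vcnj (xi z w))"
proof -
  interpret m: polarized_mixed_hs \<pi> e0 q "\<Psi> z" N W Q by (rule fib[OF z])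
  note sq = m.hform_sesq
  \<comment> \<open>The adjoint is \<open>be\<close> on \<open>ker \<pi>\<close>, plus the adjoint
    of the rank one map \<open>uB\<close>, which sends y to h(y, xi) E.\<close>
  define D where "D = matrix (\<lambda>y. be z w *v (y - \<pi> y *s E z) + m.hform y (xi z w) *s E z)"
  have D: "D *v y = be z w *v (y - \<pi> y *s E z) + m.hform y (xi z w) *s E z" for y
    unfolding D_def
    by (rule linear_matrixI)
      (simp_all add: mv_simps pi_all sesq_simps[OF sq] vec.scale_left_distrib vec.scale_right_diff_distrib
        vec.scale_right_distrib)
  have "form_adjoint m.hform (u z w) = D"
  proof (rule form_adjoint_eqI[OF m.hform_posdef])
    fix x y
    let ?x = "x - \<pi> x *s E z" and ?y = "y - \<pi> y *s E z"
    have K: "\<pi> ?x = 0" "\<pi> ?y = 0" by (simp_all add: pi_all m.e_props)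
    have "m.hform (al z w *v ?x) y = m.hform (al z w *v ?x) (?y + \<pi> y *s E z)" by simp
    also have "\<dots> = m.hform (al z w *v ?x) ?y"
      by (simp only: sesq_simps[OF sq] m.hform_e al_K[OF z] mult_zero_right add_0_right)
    finally have 1: "m.hform (al z w *v ?x) y = m.hform (al z w *v ?x) ?y" .
    have eb: "m.hform (E z) b = cnj (\<pi> b)" for b
      using posdefD(2)[OF m.hform_posdef, of "E z" b] m.hform_e by simp
    have "m.hform x (be z w *v ?y) = m.hform (?x + \<pi> x *s E z) (be z w *v ?y)" by simp
    also have "\<dots> = m.hform ?x (be z w *v ?y)"
      by (simp only: sesq_simps[OF sq] eb be_K[OF z] complex_cnj_zero mult_zero_right add_0_right)
    finally have 2: "m.hform x (be z w *v ?y) = m.hform ?x (be z w *v ?y)" .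
    have "m.hform (u z w *v x) y = m.hform (al z w *v ?x) y + \<pi> x * m.hform (xi z w) y"
      by (simp add: mv_simps uA_mv uB_mv sesq_simps[OF sq])
    also have "\<dots> = m.hform ?x (be z w *v ?y) + \<pi> x * m.hform (xi z w) y"
      by (simp only: 1 hform_al_be[OF z K])
    also have "\<dots> = m.hform x (D *v y)"
    proof -
      have "m.hform x (D *v y) = m.hform x (be z w *v ?y) + cnj (m.hform y (xi z w)) * m.hform x (E z)"
        by (simp only: D sesq_simps(2,4)[OF sq])
      then show ?thesis
        using 2 m.hform_e[of x] posdefD(2)[OF m.hform_posdef, of "xi z w" y] by (simp only: mult.commute)
    qed
    finally show "m.hform (u z w *v x) y = m.hform x (D *v y)" .
  qed
  then have g: "g z v w = trace (u z v ** D)"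
    by (simp add: mixed_hodge_metric_def m.hodge_form_eq)
  have uD: "(u z v ** D) *v x = (al z v ** be z w) *v x - \<pi> x *s (al z v *v (be z w *v E z)) + m.hform x (xi z w) *s xi z v" for x
  proof -
    have "\<pi> (D *v x) = m.hform x (xi z w)" by (simp add: D pi_all be_K[OF z] m.e_props)
    moreover have "D *v x - m.hform x (xi z w) *s E z = be z w *v (x - \<pi> x *s E z)" by (simp add: D)
    ultimately show ?thesis
      by (simp add: mv_simps uA_mv uB_mv flip: matrix_vector_mul_assoc)
  qed
  \<comment> \<open>The trace of the rank one map x -> f(x) b is f(b).\<close>
  have lin: "(\<Sum>j\<in>UNIV. f (axis j 1) * b $ j) = f b"
    if "\<And>x y. f (x + y) = f x + f y" "\<And>c x. f (c *s x) = c * f x" for f :: "complex^'n \<Rightarrow> complex" and b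
  proof -
    have "f 0 = 0" using that(2)[of 0 0] by simp
    then have "f (sum h T) = (\<Sum>t\<in>T. f (h t))" for h and T :: "'n set"
      by (induction T rule: infinite_finite_induct) (auto simp: that(1))
    then have "f (\<Sum>j\<in>UNIV. b $ j *s axis j 1) = (\<Sum>j\<in>UNIV. b $ j * f (axis j 1))" by (simp add: that(2))
    then show ?thesis using vec_expand[of b] by (simp add: mult.commute)
  qed
  have "trace (u z v ** D) = trace (al z v ** be z w) - (\<Sum>j\<in>UNIV. \<pi> (axis j 1) * (al z v *v (be z w *v E z)) $ j)
      + (\<Sum>j\<in>UNIV. m.hform (axis j 1) (xi z w) * xi z v $ j)"
    unfolding trace_axis uD by (simp add: sum.distrib sum_subtractf)
  \<comment> \<open>This is \<pi> of a value of \<open>al\<close>, and \<open>al\<close> maps into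
    \<open>ker \<pi>\<close>.\<close>
  also have "(\<Sum>j\<in>UNIV. \<pi> (axis j 1) * (al z v *v (be z w *v E z)) $ j) = 0"
    using lin[of \<pi> "al z v *v (be z w *v E z)"] by (simp add: pi_add pi_scale al_K[OF z])
  also have "(\<Sum>j\<in>UNIV. m.hform (axis j 1) (xi z w) * xi z v $ j) = m.hform (xi z v) (xi z w)"
    by (rule lin[of "\<lambda>x. m.hform x (xi z w)"]) (simp_all add: sesq_simps[OF sq])
  also have "m.hform (xi z v) (xi z w) = - \<i> * q (xi z v) (vcnj (xi z w))"
    using m.hform_H[OF xi_props(1)[OF z] xi_props(1)[OF z]] by (simp add: ipow_simps)
  also have "trace (al z v ** be z w) = - (\<Sum>p\<in>{- N..N}. trace (dP p z v ** dP p z w ** (mat 1 - P p z)))"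
  proof -
    interpret t: bounded_linear "trace :: complex^'n^'n \<Rightarrow> complex" by (rule bounded_linear_trace)
    show ?thesis unfolding al_be[OF z] t.neg t.sum ..
  qed
  finally show ?thesis unfolding g by simp
qed

lemma u_add: "z \<in> A \<Longrightarrow> u z (v + w) = u z v + u z w"
  by (simp add: matrix_eq mv_simps uA_mv uB_mv al_add xi_props(4) vec.scale_right_distrib)

lemma g_sesq:
  assumes z: "z \<in> A"
  shows "sesquilinear (g z)" "g z w v = cnj (g z v w)" "Re (g z v v) \<ge> 0"
proof -
  interpret m: polarized_mixed_hs \<pi> e0 q "\<Psi> z" N W Q by (rule fib[OF z])
  show herm: "g z w v = cnj (g z v w)" for v w
    unfolding mixed_hodge_metric_def m.hodge_form_eq by (rule trace_adjoint(1)[OF m.hform_posdef])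
  show "Re (g z v v) \<ge> 0"
    unfolding mixed_hodge_metric_def m.hodge_form_eq by (rule trace_adjoint(2)[OF m.hform_posdef])
  have add: "g z (v + v') w = g z v w + g z v' w" for v v' w
  proof -
    interpret t: bounded_linear "trace :: complex^'n^'n \<Rightarrow> complex" by (rule bounded_linear_trace)
    show ?thesis unfolding mixed_hodge_metric_def u_add[OF z] mm_add_left[of "u z v"] t.add ..
  qed
  have scale: "g z (c *s v) w = c * g z v w" for c v w
  proof -
    have "u z (c *s v) *v x = c *s (u z v *v x)" for x
      by (simp add: mv_simps uA_mv uB_mv al_scale[OF z] xi_props(2)[OF z] vec.scale_right_distrib
          vec.scale_right_diff_distrib mult.commute)
    then show ?thesis
      unfolding mixed_hodge_metric_def trace_axis
      by (simp add: sum_distrib_left flip: matrix_vector_mul_assoc)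
  qed
  show "sesquilinear (g z)"
    unfolding sesquilinear_def
  proof (intro conjI allI)
    fix x y w c
    show "g z (x + y) w = g z x w + g z y w" by (rule add)
    show "g z (c *s x) y = c * g z x y" by (rule scale)
    show "g z x (y + w) = g z x y + g z x w"
      using herm[of x "y + w"] herm[of x y] herm[of x w] add[of y w x] by simp
    show "g z x (c *s y) = cnj c * g z x y"
      using herm[of x "c *s y"] herm[of x y] scale[of c y x] by simp
  qed
qed

lemma smooth_dP: "smooth_on A (\<lambda>z. dP p z v)"
  by (rule smooth_on_derivative[OF smooth_P])

lemma smooth_dE: "smooth_on A (\<lambda>z. dE z v)"
  by (rule smooth_on_derivative[OF smooth_E])

lemma Ck_on_neg:
  assumes "Ck_on k A f"
  shows "Ck_on k A (\<lambda>z. - f z)"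
  by (rule Ck_on_linear[OF bounded_linear_minus[OF bounded_linear_ident] open_A assms])

lemma g_smooth: "smooth_on A (\<lambda>z. g z v w)"
proof (rule smooth_onI)
  fix k
  note P = smooth_on_Ck[OF smooth_P] and dP = smooth_on_Ck[OF smooth_dP] and dE = smooth_on_Ck[OF smooth_dE]
  have xi: "Ck_on k A (\<lambda>z. dE z v + - (P 0 z *v dE z v))" for v
    by (intro Ck_on_add open_A dE Ck_on_neg Ck_on_bilinear[OF bounded_bilinear_mv] P)
  have "Ck_on k A (\<lambda>z. - (\<Sum>p\<in>{- N..N}. trace (dP p z v ** dP p z w ** (mat 1 + - P p z)))
      + - (\<i> * q (dE z v + - (P 0 z *v dE z v)) (vcnj (dE z w + - (P 0 z *v dE z w)))))"
    by (intro Ck_on_add open_A Ck_on_neg Ck_on_sum Ck_on_linear[OF bounded_linear_trace]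
        Ck_on_bilinear[OF bounded_bilinear_mm] Ck_on_mult Ck_on_const Ck_on_bilinear[OF bounded_bilinear_q]
        Ck_on_linear[OF bounded_linear_vcnj] xi P dP)
  then show "Ck_on k A (\<lambda>z. g z v w)"
    by (rule Ck_on_cong_imp[OF open_A, rotated]) (simp add: metric_eq xi_def)
qed

section \<open>Closedness\<close>

text \<open>The derivatives of a projection exchange its image and its kernel.\<close>

lemma trace_odd:
  fixes P X Y Z :: "complex^'n^'n"
  assumes P: "P ** P = P" and X: "P ** X + X ** P = X" and Y: "P ** Y + Y ** P = Y" and Z: "P ** Z + Z ** P = Z"
  shows "trace (X ** Y ** Z) = 0"
proof -
  have c: "P ** M = M - M ** P" if "P ** M + M ** P = M" for M :: "complex^'n^'n"
    using that by (simp add: algebra_simps eq_diff_eq)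
  have d: "(M - M') ** M'' = M ** M'' - M' ** M''" "M'' ** (M - M') = M'' ** M - M'' ** M'"
    for M M' M'' :: "complex^'n^'n"
    by (simp_all add: matrix_matrix_mult_def vec_eq_iff algebra_simps sum_subtractf)
  define T where "T = X ** Y ** Z"
  \<comment> \<open>Each factor turns P into 1 - P as P moves past it; after three factors P T = T
    (1 - P).\<close>
  have "P ** T = (P ** X) ** Y ** Z" by (simp add: T_def matrix_mul_assoc)
  also have "\<dots> = T - X ** (P ** Y) ** Z" unfolding c[OF X] by (simp add: d T_def matrix_mul_assoc)
  also have "\<dots> = X ** Y ** (P ** Z)" unfolding c[OF Y] by (simp add: d T_def matrix_mul_assoc)
  also have "\<dots> = T - T ** P" unfolding c[OF Z] by (simp add: d T_def matrix_mul_assoc)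
  finally have PT: "P ** T = T - T ** P" .
  interpret t: bounded_linear "trace :: complex^'n^'n \<Rightarrow> complex" by (rule bounded_linear_trace)
  have "P ** T = P ** (P ** T)" by (simp add: matrix_mul_assoc P)
  also have "\<dots> = P ** (T - T ** P)" by (simp only: PT)
  also have "\<dots> = P ** T - P ** T ** P" by (simp add: d matrix_mul_assoc)
  finally have 0: "trace (P ** T ** P) = 0" by simp
  have PPT: "P ** (P ** T) = P ** T" by (simp add: matrix_mul_assoc P)
  have "trace (P ** T ** P) = trace (P ** (P ** T))" by (rule trace_mul_sym)
  then have "trace (P ** T) = 0" using 0 unfolding PPT by simp
  moreover have "trace (P ** T) = trace T - trace (T ** P)" by (simp only: PT t.diff)
  ultimately have "trace T = 0" unfolding trace_mul_sym[of T P] by simp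
  then show ?thesis by (simp add: T_def)
qed

text \<open>Cyclicity of the trace produces the commutator. The vectors \<open>xi\<close> are
  isotropic for q, and so are their conjugates in F^0; hence only mixed terms of q(dE(v), dE(w))
  survive and these are the ones present in g.\<close>

lemma g_alternating:
  assumes z: "z \<in> A"
  shows "g z v w - g z w v =
    (\<Sum>p\<in>{- N..N}. trace (P p z ** (dP p z v ** dP p z w - dP p z w ** dP p z v))) - \<i> * q (dE z v) (dE z w)"
proof -
  interpret m: pure_hs \<pi> e0 q "G z" N by (rule fib_pure[OF z])
  interpret t: bounded_linear "trace :: complex^'n^'n \<Rightarrow> complex" by (rule bounded_linear_trace)
  have d: "(M - M') ** M'' = M ** M'' - M' ** M''" "M'' ** (M - M') = M'' ** M - M'' ** M'"
    for M M' M'' :: "complex^'n^'n"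
    by (simp_all add: matrix_matrix_mult_def vec_eq_iff algebra_simps sum_subtractf)
  have 1: "- trace (X ** Y ** (mat 1 - M)) + trace (Y ** X ** (mat 1 - M)) = trace (M ** (X ** Y - Y ** X))"
    for X Y M :: "complex^'n^'n"
    using trace_mul_sym[of X Y] trace_mul_sym[of "X ** Y" M] trace_mul_sym[of "Y ** X" M]
    by (simp add: d t.diff)
  have x0: "q (xi z v) (xi z w) = 0" for v w
  proof -
    have "q (vcnj (xi z v)) (vcnj (xi z w)) = 0"
      by (rule m.G_q[of _ 0]) (use xi_props(1)[OF z] in \<open>auto simp: hpiece_def\<close>)
    then show ?thesis by (simp add: q_cnj)
  qed
  have x1: "q (vcnj (xi z v)) (vcnj (xi z w)) = 0" for v w by (simp add: q_cnj x0)
  have 2: "q (xi z v) (vcnj (xi z w)) - q (xi z w) (vcnj (xi z v)) = q (dE z v) (dE z w)"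
    using q_skew[of "xi z w" "vcnj (xi z v)"] unfolding xi_props(3)[OF z] by (simp add: q_all x0 x1)
  have "g z v w - g z w v = (\<Sum>p\<in>{- N..N}. - trace (dP p z v ** dP p z w ** (mat 1 - P p z)) +
      trace (dP p z w ** dP p z v ** (mat 1 - P p z))) - \<i> * (q (xi z v) (vcnj (xi z w)) - q (xi z w) (vcnj (xi z v)))"
    unfolding metric_eq[OF z] sum.distrib sum_negf by (simp add: right_diff_distrib)
  then show ?thesis unfolding 1 2 .
qed

abbreviation ddP :: "int \<Rightarrow> complex^'d \<Rightarrow> complex^'d \<Rightarrow> complex^'d \<Rightarrow> complex^'n^'n" where
  "ddP p z v w \<equiv> frechet_derivative (\<lambda>x. dP p x v) (at z) w"
abbreviation ddE :: "complex^'d \<Rightarrow> complex^'d \<Rightarrow> complex^'d \<Rightarrow> complex^'n" where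
  "ddE z v w \<equiv> frechet_derivative (\<lambda>x. dE x v) (at z) w"

lemma g_closed:
  assumes z: "z \<in> A"
  shows "ext_deriv2 (associated_form g) z a b c = 0"
proof -
  interpret t: bounded_linear "trace :: complex^'n^'n \<Rightarrow> complex" by (rule bounded_linear_trace)
  define Om where "Om v w x = (\<Sum>p\<in>{- N..N}. trace (P p x ** (dP p x v ** dP p x w - dP p x w ** dP p x v)))
      - \<i> * q (dE x v) (dE x w)" for v w x
  define DOm where "DOm v w h = (\<Sum>p\<in>{- N..N}. trace (P p z ** ((dP p z v ** ddP p z w h + ddP p z v h ** dP p z w)
        - (dP p z w ** ddP p z v h + ddP p z w h ** dP p z v)) + dP p z h ** (dP p z v ** dP p z w - dP p z w ** dP p z v)))
      - \<i> * (q (dE z v) (ddE z w h) + q (ddE z v h) (dE z w))" for v w h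
  have dp: "((\<lambda>x. dP p x v) has_derivative (\<lambda>h. ddP p z v h)) (at z)" for p v
    using smooth_on_has_derivative[OF smooth_dP z] by simp
  have de: "((\<lambda>x. dE x v) has_derivative (\<lambda>h. ddE z v h)) (at z)" for v
    using smooth_on_has_derivative[OF smooth_dE z] by simp
  have D: "(Om v w has_derivative DOm v w) (at z)" for v w
    unfolding Om_def DOm_def
    by (intro has_derivative_diff has_derivative_sum has_derivative_mult_right
        bounded_linear.has_derivative[OF bounded_linear_trace]
        bounded_bilinear.FDERIV[OF bounded_bilinear_mm] bounded_bilinear.FDERIV[OF bounded_bilinear_q]
        P_deriv[OF z] dp de)
  \<comment> \<open>The alternation is g - conj(g) = 2 i Im g, and the associated form is - Im g,
    whence the factor i/2.\<close>
  have F: "frechet_derivative (\<lambda>x. associated_form g x v w) (at z) h = Re (\<i> / 2 * DOm v w h)" for v w h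
  proof -
    have "((\<lambda>x. Re (\<i> / 2 * Om v w x)) has_derivative (\<lambda>h. Re (\<i> / 2 * DOm v w h))) (at z)"
      by (intro bounded_linear.has_derivative[OF bounded_linear_Re] has_derivative_mult_right D)
    moreover have "Re (\<i> / 2 * Om v w x) = associated_form g x v w" if "x \<in> A" for x
    proof -
      have "Om v w x = g x v w - cnj (g x v w)"
        using g_alternating[OF that, of v w] g_sesq(2)[OF that, of w v] by (simp add: Om_def)
      then show ?thesis by (simp add: associated_form_def)
    qed
    ultimately have "((\<lambda>x. associated_form g x v w) has_derivative (\<lambda>h. Re (\<i> / 2 * DOm v w h))) (at z)"
      by (rule has_derivative_transform_within_open[OF _ open_A z])
    from frechet_derivative_at[OF this] show ?thesis by metis
  qed
  have cP: "ddP p z v w = ddP p z w v" for p v w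
    by (rule frechet_derivative_commute[OF open_A smooth_on_Ck[OF smooth_P] z])
  have cE: "ddE z v w = ddE z w v" for v w
    by (rule frechet_derivative_commute[OF open_A smooth_on_Ck[OF smooth_E] z])
  have t0: "trace (dP p z v ** dP p z w ** dP p z h) = 0" for p v w h
    by (rule trace_odd[OF P_idem_mat dP_idem dP_idem dP_idem]) (rule z)+
  have d: "M'' ** (M - M') = M'' ** M - M'' ** M'" for M M' M'' :: "complex^'n^'n"
    by (simp add: matrix_matrix_mult_def vec_eq_iff algebra_simps sum_subtractf)
  have "DOm b c a - DOm a c b + DOm a b c = 0"
  proof -
    \<comment> \<open>Terms with three first derivatives are gone by \<open>t0\<close>. Every
      remaining term has one second derivative and cancels in the cyclic sum by \<open>cP\<close>
      and \<open>cE\<close>.\<close>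
    have DOm': "DOm v w h = (\<Sum>p\<in>{- N..N}. trace (P p z ** (dP p z v ** ddP p z w h)) + trace (P p z ** (ddP p z v h ** dP p z w))
        - trace (P p z ** (dP p z w ** ddP p z v h)) - trace (P p z ** (ddP p z w h ** dP p z v)))
      - \<i> * (q (dE z v) (ddE z w h) - q (dE z w) (ddE z v h))" for v w h
      unfolding DOm_def q_skew[of "ddE z v h" "dE z w"]
      by (simp add: t.add t.diff d matrix_add_ldistrib matrix_mul_assoc t0 diff_diff_eq)
    show ?thesis
      unfolding DOm' cP[of _ b a] cP[of _ c a] cP[of _ c b] cE[of b a] cE[of c a] cE[of c b]
      by (simp add: sum.distrib sum_subtractf algebra_simps)
  qed
  then have "Re (\<i> / 2 * (DOm b c a - DOm a c b + DOm a b c)) = 0" by simp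
  then show ?thesis unfolding ext_deriv2_def F
    by (simp only: ring_distribs minus_complex.sel plus_complex.sel)
qed

lemma g_pseudo_kaehler: "pseudo_kaehler_on A g"
  unfolding pseudo_kaehler_on_def pseudo_metric_on_def
  using g_smooth g_sesq g_closed by blast

end

lemma frechet_derivative_cong_on:
  assumes "open A" "z \<in> A" "\<And>x. x \<in> A \<Longrightarrow> f x = g x"
  shows "frechet_derivative f (at z) = frechet_derivative g (at z)"
proof -
  have "(f has_derivative D) (at z) \<longleftrightarrow> (g has_derivative D) (at z)" for D
    using has_derivative_transform_within_open[of f D z UNIV A g]
      has_derivative_transform_within_open[of g D z UNIV A f] assms by auto
  then show ?thesis by (simp add: frechet_derivative_def)
qed

text \<open>The pullback is known explicitly only over the chart domain, so the property has to be
  carried over from values on A.\<close>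

lemma pseudo_kaehler_on_cong:
  assumes A: "open A" and eq: "\<And>z v w. z \<in> A \<Longrightarrow> h z v w = g z v w" and g: "pseudo_kaehler_on A g"
  shows "pseudo_kaehler_on A h"
proof -
  have e: "h z = g z" if "z \<in> A" for z using eq[OF that] by (intro ext)
  have "smooth_on A (\<lambda>z. h z v w)" for v w
  proof (rule smooth_onI)
    fix k
    have "smooth_on A (\<lambda>z. g z v w)" using g by (simp add: pseudo_kaehler_on_def pseudo_metric_on_def)
    from smooth_on_Ck[OF this] show "Ck_on k A (\<lambda>z. h z v w)"
      by (rule Ck_on_cong_imp[OF A, rotated]) (simp add: eq)
  qed
  moreover have "sesquilinear (h z) \<and> (\<forall>v w. h z w v = cnj (h z v w)) \<and> (\<forall>v. Re (h z v v) \<ge> 0)" if "z \<in> A" for z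
    using g that unfolding pseudo_kaehler_on_def pseudo_metric_on_def e[OF that] by blast
  ultimately have "pseudo_metric_on A h"
    unfolding pseudo_metric_on_def by blast
  moreover have "ext_deriv2 (associated_form h) z a b c = 0" if z: "z \<in> A" for z a b c
  proof -
    have "frechet_derivative (\<lambda>x. associated_form h x v w) (at z) = frechet_derivative (\<lambda>x. associated_form g x v w) (at z)" for v w
      by (rule frechet_derivative_cong_on[OF A z]) (simp add: associated_form_def eq)
    then have "ext_deriv2 (associated_form h) z a b c = ext_deriv2 (associated_form g) z a b c"
      by (simp add: ext_deriv2_def)
    then show ?thesis using g z by (simp add: pseudo_kaehler_on_def)
  qed
  ultimately show ?thesis by (simp add: pseudo_kaehler_on_def)
qed

section \<open>Curvature of a pulled back constant form\<close>

lemma delbar_cong: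
  assumes "open A" "z \<in> A" "\<And>x. x \<in> A \<Longrightarrow> f x = g x"
  shows "delbar v f z = delbar v g z" "del v f z = del v g z"
  using frechet_derivative_cong_on[OF assms] by (simp_all add: delbar_def del_def)

lemma delbar_mult:
  assumes "f differentiable at z" "g differentiable at z"
  shows "delbar v (\<lambda>x. f x * g x) z = delbar v f z * g z + f z * delbar v g z"
proof -
  have "((\<lambda>x. f x * g x) has_derivative
      (\<lambda>h. f z * frechet_derivative g (at z) h + frechet_derivative f (at z) h * g z)) (at z)"
    using assms unfolding frechet_derivative_works by (rule has_derivative_mult)
  from frechet_derivative_at[OF this, symmetric] show ?thesis
    by (simp add: delbar_def field_simps)
qed

lemma delbar_sum:
  assumes "\<And>i. i \<in> I \<Longrightarrow> f i differentiable at z"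
  shows "delbar v (\<lambda>x. \<Sum>i\<in>I. f i x) z = (\<Sum>i\<in>I. delbar v (f i) z)"
proof -
  have "((\<lambda>x. \<Sum>i\<in>I. f i x) has_derivative (\<lambda>h. \<Sum>i\<in>I. frechet_derivative (f i) (at z) h)) (at z)"
    using assms unfolding frechet_derivative_works by (intro has_derivative_sum)
  from frechet_derivative_at[OF this, symmetric] show ?thesis
    by (simp add: delbar_def sum.distrib flip: sum_divide_distrib sum_distrib_left)
qed

lemma bounded_bilinear_sesq:
  assumes "sesquilinear (b :: complex^'n::finite \<Rightarrow> _)"
  shows "bounded_bilinear b"
proof -
  have "bilinear b"
    unfolding bilinear_def
    by (auto intro!: linearI simp: scaleR_vec sesq_simps[OF assms] scaleR_conv_of_real)
  then show ?thesis by (simp add: bilinear_conv_bounded_bilinear)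
qed

text \<open>Since b is conjugate linear in its second argument, the (1,0)-derivative sees only f and
  the (0,1)-derivative only g.\<close>

lemma del_sesq:
  fixes f g :: "complex^'d::finite \<Rightarrow> complex^'n::finite"
  assumes b: "sesquilinear b" and f: "hol_on B f" and g: "hol_on B g" and z: "z \<in> B"
  shows "del v (\<lambda>x. b (f x) (g x)) z = b (frechet_derivative f (at z) v) (g z)"
    "delbar v (\<lambda>x. b (f x) (g x)) z = b (f z) (frechet_derivative g (at z) v)"
proof -
  note Df = hol_on_has_derivative[OF f z] and Dg = hol_on_has_derivative[OF g z]
  have "frechet_derivative (\<lambda>x. b (f x) (g x)) (at z) h =
      b (f z) (frechet_derivative g (at z) h) + b (frechet_derivative f (at z) h) (g z)" for h
    using frechet_derivative_at[OF bounded_bilinear.FDERIV[OF bounded_bilinear_sesq[OF b] Df(1) Dg(1)], symmetric]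
    by simp
  then show "del v (\<lambda>x. b (f x) (g x)) z = b (frechet_derivative f (at z) v) (g z)"
    "delbar v (\<lambda>x. b (f x) (g x)) z = b (f z) (frechet_derivative g (at z) v)"
    by (simp_all add: del_def delbar_def Df(2) Dg(2) sesq_simps[OF b] field_simps)
qed

lemma sesq_gram:
  assumes "sesquilinear h"
  shows "h x y = (\<Sum>k\<in>UNIV. (\<Sum>l\<in>UNIV. x $ l * h (axis l 1) (axis k 1)) * cnj (y $ k))"
proof -
  have "h x y = h (\<Sum>l\<in>UNIV. x $ l *s axis l 1) (\<Sum>k\<in>UNIV. y $ k *s axis k 1)"
    using vec_expand by metis
  also have "\<dots> = (\<Sum>k\<in>UNIV. cnj (y $ k) * (\<Sum>l\<in>UNIV. x $ l * h (axis l 1) (axis k 1)))"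
    by (simp add: sesq_sum_left[OF assms] sesq_sum_right[OF assms] sesq_simps[OF assms])
  finally show ?thesis by (simp add: mult.commute[of "cnj _"])
qed

text \<open>A kernel vector of the transposed Gram matrix is a vector of the radical of h.\<close>

lemma invertible_gram:
  fixes h :: "complex^'d::finite \<Rightarrow> complex^'d \<Rightarrow> complex^'d \<Rightarrow> complex"
  assumes sq: "sesquilinear (h z)" and nd: "nondegenerate_form (h z)"
  shows "invertible (gram h z)"
proof -
  have "x = 0" if x: "transpose (gram h z) *v x = 0" for x
  proof -
    have "(\<Sum>l\<in>UNIV. x $ l * h z (axis l 1) (axis k 1)) = 0" for k
      using arg_cong[OF x, of "\<lambda>y. y $ k"]
      by (simp add: matrix_vector_mult_def transpose_def gram_def mult.commute)
    then have "h z x w = 0" for w by (subst sesq_gram[OF sq]) simp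
    then show ?thesis using nd by (simp add: nondegenerate_form_def)
  qed
  then have "invertible (transpose (gram h z))"
    by (simp add: invertible_left_inverse matrix_left_invertible_ker)
  then show ?thesis by (simp add: invertible_det_nz)
qed

text \<open>
  The curvature of a submanifold of a flat space: with \<open>a\<close> the second derivative of \<open>\<tau>\<close> along \<open>v\<close> and
  \<open>c\<close> its orthogonal projection to the tangent space, it is \<open>- b (a - c) (a - c)\<close> up to normalization.
\<close>

lemma curvature_nonpos:
  fixes h :: "complex^'d::finite \<Rightarrow> complex^'d \<Rightarrow> complex^'d \<Rightarrow> complex"
    and \<tau> :: "complex^'d \<Rightarrow> complex^'n::finite"
  assumes B: "open B" and z: "z \<in> B" and tau: "hol_on B \<tau>"
    and b: "sesquilinear b" "\<And>x. Re (b x x) \<ge> 0"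
    and h: "\<And>x v w. x \<in> B \<Longrightarrow> h x v w = b (frechet_derivative \<tau> (at x) v) (frechet_derivative \<tau> (at x) w)"
    and nd: "nondegenerate_form (h z)"
  shows "hol_sectional_curvature h z v \<le> 0"
proof -
  define J where "J j x = frechet_derivative \<tau> (at x) (axis j 1)" for j x
  define K where "K j x = frechet_derivative (J j) (at x) v" for j x
  have hJ: "hol_on B (J j)" for j unfolding J_def by (rule hol_on_derivative[OF B tau])
  have hK: "hol_on B (K j)" for j unfolding K_def by (rule hol_on_derivative[OF B hJ])
  have gram: "gram h x $ j $ k = b (J j x) (J k x)" if "x \<in> B" for x j k
    by (simp add: gram_def h[OF that] J_def)
  have sqh: "sesquilinear (h z)"
    using linear_add[OF has_derivative_linear[OF hol_on_has_derivative(1)[OF tau z]]]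
      hol_on_has_derivative(2)[OF tau z]
    by (simp add: sesquilinear_def h[OF z] sesq_simps[OF b(1)])
  have inv: "invertible (gram h z)" by (rule invertible_gram[of h z, OF sqh nd])
  define M where "M x = (\<chi> j k. b (K j x) (J k x))" for x
  define G where "G x = (\<chi> j k. b (J j x) (J k x))" for x
  have gG: "gram h x = G x" if "x \<in> B" for x by (simp add: vec_eq_iff gram[OF that] G_def)
  have ckG: "Ck_on n B G" and ckM: "Ck_on n B M" for n
    unfolding G_def M_def
    by (intro Ck_on_vec B, simp, intro Ck_on_bilinear[OF bounded_bilinear_sesq[OF b(1)]] hol_on_Ck hJ hK B)+
  \<comment> \<open>Nondegeneracy is given at z alone; by continuity it holds nearby, which makes
    \<theta> differentiable at z.\<close>
  define B' where "B' = {x \<in> B. det (G x) \<noteq> 0}"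
  have "continuous_on B (\<lambda>x. det (G x))"
    using Ck_on_det[OF B ckG[of 0]] by simp
  then have "open (B \<inter> (\<lambda>x. det (G x)) -` (- {0}))"
    using continuous_open_preimage B open_Compl by blast
  moreover have "B' = B \<inter> (\<lambda>x. det (G x)) -` (- {0})" by (auto simp: B'_def)
  ultimately have oB': "open B'" by simp
  have sub: "B' \<subseteq> B" by (auto simp: B'_def)
  have zB': "z \<in> B'" using inv z by (simp add: B'_def gG invertible_det_nz)
  have invG: "invertible (G x)" if "x \<in> B'" for x using that by (simp add: B'_def invertible_det_nz)
  define \<theta> where "\<theta> x = M x ** matrix_inv (G x)" for x
  have conn: "chern_connection h v x = \<theta> x" if x: "x \<in> B" for x
  proof -
    have "del v (\<lambda>y. gram h y $ j $ k) x = b (K j x) (J k x)" for j k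
    proof -
      have "del v (\<lambda>y. gram h y $ j $ k) x = del v (\<lambda>y. b (J j y) (J k y)) x"
        by (rule delbar_cong(2)[OF B x]) (rule gram)
      also have "\<dots> = b (K j x) (J k x)" unfolding K_def by (rule del_sesq(1)[OF b(1) hJ hJ x])
      finally show ?thesis .
    qed
    then show ?thesis by (simp add: chern_connection_def \<theta>_def gG[OF x] M_def)
  qed
  have "Ck_on 1 B' \<theta>"
    unfolding \<theta>_def
    by (intro Ck_on_bilinear[OF bounded_bilinear_mm] Ck_on_matrix_inv oB' invG
        Ck_on_subset[OF ckG sub] Ck_on_subset[OF ckM sub])
  then have th_diff: "(\<lambda>x. \<theta> x $ j $ l) differentiable at z" for j l
    using Ck_on_nth[OF oB' Ck_on_nth[OF oB', of 1 \<theta> j], of l] zB' by simp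
  have G_diff: "(\<lambda>x. G x $ l $ k) differentiable at z" for l k
    using Ck_on_nth[OF B Ck_on_nth[OF B ckG[of 1], of l], of k] z by simp
  have thG: "(\<Sum>l\<in>UNIV. \<theta> x $ j $ l * G x $ l $ k) = M x $ j $ k" if x: "x \<in> B'" for x j k
  proof -
    have "\<theta> x ** G x = M x"
      unfolding \<theta>_def matrix_mul_assoc[symmetric] matrix_inv_left_right(1)[OF invG[OF x]] by simp
    then show ?thesis by (metis (no_types, lifting) matrix_matrix_mult_def vec_lambda_beta sum.cong)
  qed
  define d\<theta> where "d\<theta> j l = delbar v (\<lambda>x. \<theta> x $ j $ l) z" for j l
  \<comment> \<open>The (0,1)-derivative is applied to \<theta> G = M instead of to the inverse
    matrix.\<close>
  have prod: "(\<Sum>l\<in>UNIV. d\<theta> j l * G z $ l $ k) = b (K j z) (K k z) - (\<Sum>l\<in>UNIV. \<theta> z $ j $ l * b (J l z) (K k z))" for j k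
  proof -
    have "delbar v (\<lambda>x. \<Sum>l\<in>UNIV. \<theta> x $ j $ l * G x $ l $ k) z = delbar v (\<lambda>x. b (K j x) (J k x)) z"
      by (rule delbar_cong(1)[OF oB' zB']) (simp add: thG M_def)
    moreover have "delbar v (\<lambda>x. b (K j x) (J k x)) z = b (K j z) (K k z)"
      unfolding K_def[of k] by (rule del_sesq(2)[OF b(1) hK hJ z])
    moreover have "delbar v (\<lambda>x. \<Sum>l\<in>UNIV. \<theta> x $ j $ l * G x $ l $ k) z =
        (\<Sum>l\<in>UNIV. d\<theta> j l * G z $ l $ k + \<theta> z $ j $ l * delbar v (\<lambda>x. G x $ l $ k) z)"
      by (subst delbar_sum) (auto simp: d\<theta>_def intro!: delbar_mult th_diff G_diff differentiable_mult sum.cong)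
    moreover have "delbar v (\<lambda>x. G x $ l $ k) z = b (J l z) (K k z)" for l
      unfolding G_def K_def[of k] using del_sesq(2)[OF b(1) hJ hJ z] by simp
    ultimately show ?thesis by (simp add: sum.distrib algebra_simps)
  qed
  define a where "a = (\<Sum>j\<in>UNIV. v $ j *s K j z)"
  \<comment> \<open>The coordinates of v \<theta>. With them c has the same products with all
    tangent vectors as the second derivative a.\<close>
  define y where "y l = (\<Sum>j\<in>UNIV. v $ j * \<theta> z $ j $ l)" for l
  define c where "c = (\<Sum>l\<in>UNIV. y l *s J l z)"
  have cJ: "b c (J k z) = b a (J k z)" for k
  proof -
    have "b c (J k z) = (\<Sum>l\<in>UNIV. \<Sum>j\<in>UNIV. v $ j * (\<theta> z $ j $ l * G z $ l $ k))"
      by (simp add: c_def y_def sesq_sum_left[OF b(1)] sesq_simps[OF b(1)] G_def sum_distrib_right mult.assoc)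
    also have "\<dots> = (\<Sum>j\<in>UNIV. v $ j * (\<Sum>l\<in>UNIV. \<theta> z $ j $ l * G z $ l $ k))"
      by (subst sum.swap) (simp add: sum_distrib_left)
    also have "\<dots> = b a (J k z)"
      by (simp add: thG[OF zB'] M_def a_def sesq_sum_left[OF b(1)] sesq_simps[OF b(1)])
    finally show ?thesis .
  qed
  have "b (a - c) (J k z) = 0" for k by (simp add: sesq_simps[OF b(1)] cJ)
  \<comment> \<open>The vector c is itself a combination of the tangent vectors J k, to which a - c
    is orthogonal.\<close>
  then have ac: "b (a - c) c = 0"
    unfolding c_def[of] sesq_sum_right[OF b(1)] by (simp add: sesq_simps(4)[OF b(1)] flip: c_def)
  define X where "X = v v* chern_curvature h v z"
  have curv: "chern_curvature h v z $ j $ l = - d\<theta> j l" for j l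
  proof -
    have "delbar v (\<lambda>x. chern_connection h v x $ j $ l) z = d\<theta> j l"
      unfolding d\<theta>_def by (rule delbar_cong(1)[OF B z]) (simp add: conn)
    then show ?thesis by (simp add: chern_curvature_def)
  qed
  have X: "X $ l = - (\<Sum>j\<in>UNIV. v $ j * d\<theta> j l)" for l
    by (simp add: X_def vector_matrix_mult_def curv sum_negf mult.commute)
  have inner: "(\<Sum>l\<in>UNIV. X $ l * h z (axis l 1) (axis k 1)) =
      - (b a (K k z) - b c (K k z))" for k
  proof -
    have "(\<Sum>l\<in>UNIV. X $ l * h z (axis l 1) (axis k 1)) =
        - (\<Sum>l\<in>UNIV. \<Sum>j\<in>UNIV. v $ j * (d\<theta> j l * G z $ l $ k))"
    proof -
      have "h z (axis l 1) (axis k 1) = G z $ l $ k" for l by (simp add: h[OF z] G_def J_def)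
      then show ?thesis by (simp add: X sum_distrib_right sum_negf mult.assoc)
    qed
    also have "(\<Sum>l\<in>UNIV. \<Sum>j\<in>UNIV. v $ j * (d\<theta> j l * G z $ l $ k)) =
        (\<Sum>j\<in>UNIV. v $ j * (\<Sum>l\<in>UNIV. d\<theta> j l * G z $ l $ k))"
      by (subst sum.swap) (simp add: sum_distrib_left)
    also have "\<dots> = (\<Sum>j\<in>UNIV. v $ j * b (K j z) (K k z)) -
        (\<Sum>j\<in>UNIV. \<Sum>l\<in>UNIV. v $ j * (\<theta> z $ j $ l * b (J l z) (K k z)))"
      unfolding prod by (simp add: right_diff_distrib sum_subtractf sum_distrib_left)
    also have "(\<Sum>j\<in>UNIV. v $ j * b (K j z) (K k z)) = b a (K k z)"
      by (simp add: a_def sesq_sum_left[OF b(1)] sesq_simps[OF b(1)])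
    also have "(\<Sum>j\<in>UNIV. \<Sum>l\<in>UNIV. v $ j * (\<theta> z $ j $ l * b (J l z) (K k z))) = b c (K k z)"
      by (subst sum.swap) (simp add: c_def y_def sesq_sum_left[OF b(1)] sesq_simps[OF b(1)] sum_distrib_right mult.assoc)
    finally show ?thesis .
  qed
  have "h z X v = - (\<Sum>k\<in>UNIV. (b a (K k z) - b c (K k z)) * cnj (v $ k))"
    by (subst sesq_gram[OF sqh]) (simp only: inner mult_minus_left sum_negf)
  also have "(\<Sum>k\<in>UNIV. (b a (K k z) - b c (K k z)) * cnj (v $ k)) = b (a - c) a"
    by (subst (3) a_def)
      (simp add: sesq_sum_right[OF b(1)] sesq_simps[OF b(1)] mult.commute)
  also have "b (a - c) a = b (a - c) (a - c)"
    using ac by (simp only: sesq_simps(8)[OF b(1)] diff_0_right)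
  finally have "Re (h z X v) \<le> 0" using b(2)[of "a - c"] by simp
  then show ?thesis
    unfolding hol_sectional_curvature_def X_def by (simp add: divide_nonpos_nonneg)
qed

context period_family
begin

lemma curvature_constant:
  assumes z: "z \<in> A" and B: "open B" "z \<in> B" "B \<subseteq> A" and const: "\<And>x. x \<in> B \<Longrightarrow> G x = G z"
    and h: "\<And>x v w. x \<in> A \<Longrightarrow> h x v w = g x v w" and nd: "nondegenerate_form (h z)"
  shows "hol_sectional_curvature h z v \<le> 0"
proof -
  interpret m: pure_hs \<pi> e0 q "G z" N by (rule fib_pure[OF z])
  obtain B1 \<sigma> where B1: "filt_section \<Psi> 0 B1 \<sigma>" "B1 \<subseteq> A" "z \<in> B1" "\<And>z. z \<in> B1 \<Longrightarrow> \<pi> (\<sigma> z) = 1"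
    using unit_section[OF z] by blast
  have h1: "hol_on B1 \<sigma>" "open B1" using B1(1) by (auto simp: filt_section_def)
  let ?B = "B \<inter> B1"
  have hB: "hol_on ?B \<sigma>" by (rule hol_on_subset[OF h1(1)]) simp
  \<comment> \<open>\<open>P 0\<close> does not move on B, so \<open>xi\<close> is the derivative of
    this map: a fixed linear image of a holomorphic unit section.\<close>
  define \<tau> where "\<tau> x = (mat 1 - P 0 z) *v \<sigma> x" for x
  \<comment> \<open>The Hodge metric on type (-1, 0), where the sign is - i, extended by zero to a
    semi-definite form on the whole fixed space.\<close>
  define b where "b x y = - \<i> * q (C (-1) z *v x) (vcnj (C (-1) z *v y))" for x y
  have dP0: "dP p x w = 0" if x: "x \<in> B" for p x w
  proof -
    have "x \<in> A" using x B(3) by blast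
    moreover have "P p y = P p z" if "y \<in> B" for y using const[OF that] by simp
    ultimately show ?thesis by (rule dP_const[OF _ B(1) x])
  qed
  have xi: "xi x w = frechet_derivative \<tau> (at x) w" if x: "x \<in> ?B" for x w
  proof -
    have xB: "x \<in> B" "x \<in> B1" using x by auto
    have D: "(\<tau> has_derivative (\<lambda>w. (mat 1 - P 0 z) *v frechet_derivative \<sigma> (at x) w)) (at x)"
      unfolding \<tau>_def
      using bounded_bilinear.FDERIV[OF bounded_bilinear_mv has_derivative_const hol_on_has_derivative(1)[OF hB x], of "mat 1 - P 0 z"]
      by simp
    have "xi x w = frechet_derivative \<sigma> (at x) w - P 0 x *v frechet_derivative \<sigma> (at x) w"
      using xi_unit_section(5)[OF B1(1,2,4) xB(2), of w] dP0[OF xB(1)] by simp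
    also have "P 0 x = P 0 z" using const[OF xB(1)] by simp
    finally show ?thesis
      using frechet_derivative_at[OF D, symmetric] by (simp add: mv_simps)
  qed
  have "hol_on ?B \<tau>" unfolding \<tau>_def by (rule hol_on_matrix[OF hB])
  moreover have "sesquilinear b"
    unfolding sesquilinear_def b_def by (auto simp: mv_simps q_all algebra_simps)
  moreover have "Re (b x x) \<ge> 0" for x
    using m.G_pos[OF m.C_in[of "-1" x]]
    by (cases "C (-1) z *v x = 0") (auto simp: b_def ipow_simps q_all)
  moreover have "h x v w = b (frechet_derivative \<tau> (at x) v) (frechet_derivative \<tau> (at x) w)" if x: "x \<in> ?B" for x v w
  proof -
    have xA: "x \<in> A" and xB: "x \<in> B" using x B(3) by auto
    have "C (-1) z *v xi x w = xi x w" for w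
      using m.C_H[of "xi x w" "-1" "-1"] xi_props(1)[OF xA, of w] const[OF xB] by simp
    then show ?thesis
      unfolding h[OF xA] metric_eq[OF xA] b_def xi[OF x, symmetric] by (simp add: dP0[OF xB] trace_def)
  qed
  moreover have "open ?B" "z \<in> ?B" using B B1(3) h1(2) by auto
  ultimately show ?thesis using nd by (intro curvature_nonpos[of ?B z \<tau> b h]) auto
qed

end

section \<open>Real and integral structures\<close>

definition real_mat :: "complex^'n^'m \<Rightarrow> bool" where
  "real_mat M \<longleftrightarrow> (\<forall>x. vcnj (M *v x) = M *v vcnj x)"

lemma cnj_Rats: "r \<in> \<rat> \<Longrightarrow> cnj r = r"
proof (elim Rats_cases)
  fix s assume "r = of_rat s"
  then show "cnj r = r" by (cases s) (simp add: of_rat_rat)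
qed

lemma cnj_Ints: "r \<in> \<int> \<Longrightarrow> cnj r = r"
  by (auto elim: Ints_cases)

lemma real_integral_mat: "integral_mat M \<Longrightarrow> real_mat M" for M :: "complex^'n::finite^'m"
  unfolding real_mat_def vcnj_def
  by (simp add: vec_eq_iff matrix_vector_mult_def integral_mat_def cnj_Ints)

lemma vcnj_rational: "rational_vec x \<Longrightarrow> vcnj x = x"
  by (simp add: vcnj_def vec_eq_iff rational_vec_def cnj_Rats)

lemma vcnj_integral: "integral_vec x \<Longrightarrow> vcnj x = x"
  by (simp add: vcnj_def vec_eq_iff integral_vec_def cnj_Ints)

lemma vcnj_span_rational:
  assumes S: "\<And>x. x \<in> S \<Longrightarrow> rational_vec x" and x: "x \<in> vec.span S"
  shows "vcnj x \<in> vec.span S"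
  using x
proof (induction rule: vec.span_induct_alt)
  case (step c x y)
  then have "vcnj x \<in> vec.span S" using vcnj_rational[OF S] vec.span_base by metis
  then show ?case using step.IH by (simp add: vec.span_add vec.span_scale)
qed (simp add: vec.span_zero)

lemma weight_filtration_subspace: "weight_filtration W \<Longrightarrow> vec.subspace (W k)"
  unfolding weight_filtration_def by (metis vec.subspace_span)

lemma weight_filtration_vcnj: "weight_filtration W \<Longrightarrow> x \<in> W k \<Longrightarrow> vcnj x \<in> W k"
  using vcnj_span_rational[of "{x \<in> W k. rational_vec x}" x] unfolding weight_filtration_def by auto

lemma graded_forms_D:
  assumes "graded_forms W Q"
  shows "x \<in> W k \<Longrightarrow> y \<in> W k \<Longrightarrow> z \<in> W k \<Longrightarrow> Q k (x + y) z = Q k x z + Q k y z"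
    "x \<in> W k \<Longrightarrow> z \<in> W k \<Longrightarrow> Q k (c *s x) z = c * Q k x z"
    "x \<in> W k \<Longrightarrow> y \<in> W k \<Longrightarrow> Q k y x = (-1) powi k * Q k x y"
    "x \<in> W (k - 1) \<Longrightarrow> y \<in> W k \<Longrightarrow> Q k x y = 0"
    "x \<in> W k \<Longrightarrow> y \<in> W k \<Longrightarrow> rational_vec x \<Longrightarrow> rational_vec y \<Longrightarrow> Q k x y \<in> \<rat>"
  using assms unfolding graded_forms_def by blast+

text \<open>Q is rational on rational vectors, and these span W k. There is one induction for each
  argument; membership in W k is carried along because bilinearity holds only there.\<close>

lemma graded_forms_cnj:
  assumes W: "weight_filtration W" and Q: "graded_forms W Q" and x: "x \<in> W k" and y: "y \<in> W k"
  shows "Q k (vcnj x) (vcnj y) = cnj (Q k x y)"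
proof -
  note sub = weight_filtration_subspace[OF W, of k]
  let ?S = "{x \<in> W k. rational_vec x}"
  have span: "W k = vec.span ?S" using W unfolding weight_filtration_def by blast
  have vS: "vcnj s = s" if "s \<in> ?S" for s using vcnj_rational that by blast
  note D = graded_forms_D[OF Q]
  have right: "Q k x (c *s y + z) = c * Q k x y + Q k x z" if "x \<in> W k" "y \<in> W k" "z \<in> W k" for c x y z
  proof -
    have cy: "c *s y \<in> W k" using vec.subspace_scale[OF sub] that by blast
    have cyz: "c *s y + z \<in> W k" using vec.subspace_add[OF sub cy] that by blast
    have "Q k x (c *s y + z) = (-1) powi k * Q k (c *s y + z) x" by (rule D(3)[OF cyz that(1)])
    also have "Q k (c *s y + z) x = c * Q k y x + Q k z x"
      using D(1)[OF cy that(3,1)] D(2)[OF that(2,1)] by simp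
    also have "(-1) powi k * \<dots> = c * Q k x y + Q k x z"
      using D(3)[OF that(2,1)] D(3)[OF that(3,1)] by (simp add: algebra_simps)
    finally show ?thesis .
  qed
  have left: "Q k (c *s x + z) y = c * Q k x y + Q k z y" if "x \<in> W k" "y \<in> W k" "z \<in> W k" for c x y z
    using D(1)[of "c *s x" k z y] D(2)[of x k y c] that vec.subspace_scale[OF sub] by simp
  have base: "s \<in> W k" if "s \<in> ?S" for s using that by blast
  have 1: "Q k s (vcnj y) = cnj (Q k s y) \<and> y \<in> W k" if s: "s \<in> ?S" and y: "y \<in> vec.span ?S" for s y
    using y
  proof (induction rule: vec.span_induct_alt)
    case base
    have "Q k s 0 = 0" using right[of s 0 0 1] s vec.subspace_0[OF sub] by simp
    then show ?case using vec.subspace_0[OF sub] by simp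
  next
    case (step c t z)
    have t: "t \<in> W k" "Q k s t \<in> \<rat>" using step s D(5) by auto
    have "vcnj z \<in> W k" using weight_filtration_vcnj[OF W] step.IH by blast
    then have "Q k s (vcnj (c *s t + z)) = cnj c * Q k s t + Q k s (vcnj z)"
      using right[of s t "vcnj z" "cnj c"] s t(1) vS[of t] step by simp
    moreover have "Q k s (c *s t + z) = c * Q k s t + Q k s z"
      using right[of s t z c] s t(1) step by simp
    moreover have "c *s t + z \<in> W k"
      using step.IH t(1) vec.subspace_add[OF sub] vec.subspace_scale[OF sub] by blast
    ultimately show ?case using step.IH cnj_Rats[OF t(2)] by simp
  qed
  have "Q k (vcnj x) (vcnj y) = cnj (Q k x y) \<and> x \<in> W k" if "x \<in> vec.span ?S" for x
    using that
  proof (induction rule: vec.span_induct_alt)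
    case base
    have "Q k 0 z = 0" if "z \<in> W k" for z using left[of 0 z 0 1] that vec.subspace_0[OF sub] by simp
    then show ?case using vec.subspace_0[OF sub] y weight_filtration_vcnj[OF W y] by simp
  next
    case (step c s z)
    note vy = weight_filtration_vcnj[OF W y]
    have s: "s \<in> W k" using step by blast
    have "vcnj z \<in> W k" using weight_filtration_vcnj[OF W] step.IH by blast
    then have "Q k (vcnj (c *s s + z)) (vcnj y) = cnj c * Q k s (vcnj y) + Q k (vcnj z) (vcnj y)"
      using left[of s "vcnj y" "vcnj z" "cnj c"] s vy vS[of s] step by simp
    moreover have "Q k (c *s s + z) y = c * Q k s y + Q k z y"
      using left[of s y z c] s y step by simp
    moreover have "c *s s + z \<in> W k"
      using step.IH s vec.subspace_add[OF sub] vec.subspace_scale[OF sub] by blast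
    moreover have "Q k s (vcnj y) = cnj (Q k s y)" using 1[of s y] step y span by blast
    ultimately show ?case using step.IH by simp
  qed
  then show ?thesis using x span by blast
qed

section \<open>Pure and mixed Hodge structures in a single weight\<close>

lemma gr_filt_lowest: "W (k - 1) = {0} \<Longrightarrow> gr_filt W F k p = F p \<inter> W k"
  unfolding gr_filt_def by auto

lemma mixed_hodge_structure_D:
  assumes "mixed_hodge_structure W F"
  shows "weight_filtration W" "vec.subspace (F p)" "p \<le> r \<Longrightarrow> F r \<subseteq> F p" "\<exists>p. F p = UNIV" "\<exists>p. F p = {0}"
    "{x + y | x y. x \<in> gr_filt W F k p \<and> y \<in> vcnj ` gr_filt W F k (k - p + 1)} = W k"
    "gr_filt W F k p \<inter> vcnj ` gr_filt W F k (k - p + 1) = W (k - 1)"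
proof -
  note a = assms[unfolded mixed_hodge_structure_def]
  show "weight_filtration W" using a by (elim conjE)
  have "\<forall>p. vec.subspace (F p)" using a by (elim conjE)
  then show "vec.subspace (F p)" ..
  have "antimono F" using a by (elim conjE)
  then show "p \<le> r \<Longrightarrow> F r \<subseteq> F p" by (rule antimonoD)
  show "\<exists>p. F p = UNIV" using a by (elim conjE)
  show "\<exists>p. F p = {0}" using a by (elim conjE)
  have "\<forall>k p. {x + y | x y. x \<in> gr_filt W F k p \<and> y \<in> vcnj ` gr_filt W F k (k - p + 1)} = W k \<and>
      gr_filt W F k p \<inter> vcnj ` gr_filt W F k (k - p + 1) = W (k - 1)" using a by (elim conjE)
  then show "{x + y | x y. x \<in> gr_filt W F k p \<and> y \<in> vcnj ` gr_filt W F k (k - p + 1)} = W k"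
    "gr_filt W F k p \<inter> vcnj ` gr_filt W F k (k - p + 1) = W (k - 1)" by auto
qed

text \<open>With W_(-2) = 0 the graded piece of weight -1 is W_(-1) itself, and k - p + 1 becomes -
  p.\<close>

lemma hodge_lowest_weight:
  assumes mhs: "mixed_hodge_structure W F" and W2: "W (-2) = {0}"
  shows "x \<in> W (-1) \<Longrightarrow> \<exists>y\<in>F p \<inter> W (-1). vcnj (x - y) \<in> F (- p) \<inter> W (-1)"
    "x \<in> F p \<inter> W (-1) \<Longrightarrow> vcnj x \<in> F (- p) \<inter> W (-1) \<Longrightarrow> x = 0"
proof -
  have gr: "gr_filt W F (-1) p = F p \<inter> W (-1)" for p using gr_filt_lowest[of W "-1"] W2 by simp
  have 1: "{x + y | x y. x \<in> F p \<inter> W (-1) \<and> y \<in> vcnj ` (F (- p) \<inter> W (-1))} = W (-1)"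
    and 2: "(F p \<inter> W (-1)) \<inter> vcnj ` (F (- p) \<inter> W (-1)) = W (-2)" for p
  proof -
    note mixed_hodge_structure_D(6,7)[OF mhs, of "-1" p]
    then
    show "{x + y | x y. x \<in> F p \<inter> W (-1) \<and> y \<in> vcnj ` (F (- p) \<inter> W (-1))} = W (-1)"
      and "(F p \<inter> W (-1)) \<inter> vcnj ` (F (- p) \<inter> W (-1)) = W (-2)"
      by (simp_all add: gr)
  qed
  show "\<exists>y\<in>F p \<inter> W (-1). vcnj (x - y) \<in> F (- p) \<inter> W (-1)" if "x \<in> W (-1)"
  proof -
    have "x \<in> {x + y | x y. x \<in> F p \<inter> W (-1) \<and> y \<in> vcnj ` (F (- p) \<inter> W (-1))}" using that 1 by simp
    then obtain a b where "x = a + vcnj b" "a \<in> F p \<inter> W (-1)" "b \<in> F (- p) \<inter> W (-1)" by blast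
    then show ?thesis by (intro bexI[of _ a]) auto
  qed
  show "x = 0" if x: "x \<in> F p \<inter> W (-1)" "vcnj x \<in> F (- p) \<inter> W (-1)"
  proof -
    have "x \<in> vcnj ` (F (- p) \<inter> W (-1))" using x(2) by (rule rev_image_eqI) simp
    then have "x \<in> W (-2)" using x(1) 2[of p] by blast
    then show ?thesis using W2 by simp
  qed
qed

lemma polarization_lowest_weight:
  assumes gp: "graded_polarized W Q F" and W2: "W (-2) = {0}"
  shows "x \<in> F p \<inter> W (-1) \<Longrightarrow> y \<in> F (- p) \<inter> W (-1) \<Longrightarrow> Q (-1) x y = 0"
    "x \<in> F p \<inter> W (-1) \<Longrightarrow> vcnj x \<in> F (- 1 - p) \<inter> W (-1) \<Longrightarrow> x \<noteq> 0 \<Longrightarrow> Re (ipow p * Q (-1) x (vcnj x)) > 0"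
proof -
  have gr: "gr_filt W F (-1) p = F p \<inter> W (-1)" for p using gr_filt_lowest[of W "-1"] W2 by simp
  have "\<forall>k p. \<forall>x\<in>gr_filt W F k p. \<forall>y\<in>gr_filt W F k (k - p + 1). Q k x y = 0"
    using gp unfolding graded_polarized_def by blast
  from this[rule_format, of _ "-1" p y]
  show "Q (-1) x y = 0" if "x \<in> F p \<inter> W (-1)" "y \<in> F (- p) \<inter> W (-1)"
    using that by (simp add: gr)
  have pos: "\<forall>p q. \<forall>x \<in> gr_comp W F p q - W (p + q - 1).
        Im (\<i> powi (p - q) * Q (p + q) x (vcnj x)) = 0 \<and>
        Re (\<i> powi (p - q) * Q (p + q) x (vcnj x)) > 0"
    using gp unfolding graded_polarized_def by blast
  show "Re (ipow p * Q (-1) x (vcnj x)) > 0"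
    if x: "x \<in> F p \<inter> W (-1)" "vcnj x \<in> F (- 1 - p) \<inter> W (-1)" "x \<noteq> 0"
  proof -
    have w: "p + (- 1 - p) = -1" "p - (- 1 - p) = 2 * p + 1" by simp_all
    have "x \<in> vcnj ` (F (- 1 - p) \<inter> W (-1))" using x(2) by (rule rev_image_eqI) simp
    then have "x \<in> gr_comp W F p (- 1 - p) - W (p + (- 1 - p) - 1)"
      using x(1,3) W2 unfolding gr_comp_def w gr by simp
    with pos have "Re (\<i> powi (p - (- 1 - p)) * Q (p + (- 1 - p)) x (vcnj x)) > 0" by blast
    then show ?thesis unfolding w ipow_def .
  qed
qed

lemma int_exists_last:
  fixes f :: "int \<Rightarrow> bool"
  assumes "f a" and "\<And>p. p \<ge> b \<Longrightarrow> \<not> f p"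
  obtains p where "f p" "\<not> f (p + 1)"
proof (rule ccontr)
  assume "\<not> thesis"
  with that have step: "f p \<Longrightarrow> f (p + 1)" for p by blast
  have "f p" if "p \<ge> a" for p
    using that by (induction p rule: int_ge_induct) (use assms(1) step in auto)
  then show False using assms(2)[of "max a b"] by simp
qed

text \<open>Take the last p such that F^p contains a nonzero vector x of the radical, and split off
  its part y in F^(p+1). The rest is nonzero of type (p, -1 - p), but its norm reduces to a product
  with x and one with y, both zero.\<close>

lemma pure_polarization_nondegenerate:
  assumes mhs: "mixed_hodge_structure W F" and gp: "graded_polarized W Q F"
    and W: "W (-1) = UNIV" "W (-2) = {0}" and x: "\<And>y. Q (-1) x y = 0"
  shows "x = 0"
proof (rule ccontr)
  assume "x \<noteq> 0"
  note sub = mixed_hodge_structure_D(2)[OF mhs] and anti = mixed_hodge_structure_D(3)[OF mhs]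
  obtain a b where ab: "F a = UNIV" "F b = {0}" using mixed_hodge_structure_D(4,5)[OF mhs] by blast
  define f where "f p \<longleftrightarrow> (\<exists>x. x \<noteq> 0 \<and> x \<in> F p \<and> (\<forall>y. Q (-1) x y = 0))" for p
  have "f a" using \<open>x \<noteq> 0\<close> ab x by (auto simp: f_def)
  moreover have "\<not> f p" if "p \<ge> b" for p using anti[OF that] ab by (auto simp: f_def)
  ultimately obtain p where p: "f p" "\<not> f (p + 1)" using int_exists_last[of f a b] by metis
  obtain x where x: "x \<noteq> 0" "x \<in> F p" "\<And>y. Q (-1) x y = 0" using p(1) by (auto simp: f_def)
  obtain y where y: "y \<in> F (p + 1)" "vcnj (x - y) \<in> F (- (p + 1))"
    using hodge_lowest_weight(1)[OF mhs W(2), of x "p + 1"] W(1) by auto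
  show False
  proof (cases "x = y")
    case True
    then show False using p(2) x y(1) unfolding f_def by blast
  next
    case False
    have "y \<in> F p" using y(1) anti[of p "p + 1"] by auto
    then have d: "x - y \<in> F p" "vcnj (x - y) \<in> F (- 1 - p)"
      using vec.subspace_diff[OF sub x(2)] y(2) by (auto simp: algebra_simps)
    have "Re (ipow p * Q (-1) (x - y) (vcnj (x - y))) > 0"
      by (rule polarization_lowest_weight(2)[OF gp W(2)]) (use d False W(1) in auto)
    moreover have "Q (-1) y (vcnj (x - y)) = 0"
      by (rule polarization_lowest_weight(1)[OF gp W(2), of y "p + 1"]) (use y W(1) in auto)
    moreover have "Q (-1) (x - y) z = Q (-1) x z - Q (-1) y z" for z
      using graded_forms_D(1)[of W Q "x - y" "-1" y z] gp W(1) by (simp add: graded_polarized_def)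
    ultimately show False using x(3) by simp
  qed
qed

lemma polarized_mixed_hsI:
  fixes \<pi> :: "complex^'n::finite \<Rightarrow> complex"
  assumes hs: "hs_space \<pi> e0 q" and N: "N \<ge> 0"
    and W_eq: "\<And>k. W k = (if k < -1 then {0} else if k = -1 then {x. \<pi> x = 0} else UNIV)"
    and Q: "\<And>k. k < -1 \<Longrightarrow> Q k 0 0 = 0" "\<And>x y. \<pi> x = 0 \<Longrightarrow> \<pi> y = 0 \<Longrightarrow> Q (-1) x y = q x y"
      "\<And>x y. Q 0 x y = \<pi> x * \<pi> y" "\<And>k x y. k \<ge> 1 \<Longrightarrow> Q k x y = 0"
    and mhs: "mixed_hodge_structure W F" and gp: "graded_polarized W Q F"
    and F_pos: "\<And>p x. p \<ge> 1 \<Longrightarrow> x \<in> F p \<Longrightarrow> \<pi> x = 0"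
    and comp: "\<And>p. N \<le> p \<or> p < - N \<Longrightarrow> gr_comp W F p (- 1 - p) \<subseteq> {0}"
  shows "polarized_mixed_hs \<pi> e0 q F N W Q"
proof -
  interpret hs_space \<pi> e0 q by (rule hs)
  have W1: "W (-1) = {x. \<pi> x = 0}" and W2: "W (-2) = {0}" by (simp_all add: W_eq)
  note sub = mixed_hodge_structure_D(2)[OF mhs] and anti = mixed_hodge_structure_D(3)[OF mhs]
  have kf: "kfilt \<pi> F p = F p \<inter> W (-1)" for p by (auto simp: kfilt_def W1)
  note hl = hodge_lowest_weight[OF mhs W2, folded kf]
  note pl = polarization_lowest_weight[OF gp W2, folded kf]
  have ksub: "vec.subspace (kfilt \<pi> F p)" for p
    using sub[of p] unfolding kfilt_def vec.subspace_def by (simp add: pi_all)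
  have kanti: "x \<in> kfilt \<pi> F p" if "p \<le> r" "x \<in> kfilt \<pi> F r" for p r x
    using anti[OF that(1)] that(2) by (auto simp: kfilt_def)
  have H0: "x = 0" if x: "x \<in> kfilt \<pi> F p" "vcnj x \<in> kfilt \<pi> F (- 1 - p)" and p: "N \<le> p \<or> p < - N" for x p
  proof -
    have gr: "gr_filt W F (-1) r = kfilt \<pi> F r" for r using gr_filt_lowest[of W "-1"] W2 by (simp add: kf)
    have w: "p + (- 1 - p) = -1" by simp
    have "x \<in> vcnj ` kfilt \<pi> F (- 1 - p)" using x(2) by (rule rev_image_eqI) simp
    then have "x \<in> gr_comp W F p (- 1 - p)" using x(1) unfolding gr_comp_def w gr by simp
    then show ?thesis using comp[OF p] by blast
  qed
  \<comment> \<open>At the last index r >= p with x in F^r, the part of x outside F^(r+1) has type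
    (r, -1 - r), which is empty for r >= N.\<close>
  have bot: "x = 0" if "N \<le> p" "x \<in> kfilt \<pi> F p" for p x
  proof (rule ccontr)
    assume nz: "x \<noteq> 0"
    obtain b where b: "F b = {0}" using mixed_hodge_structure_D(5)[OF mhs] by blast
    have b0: "\<not> x \<in> kfilt \<pi> F r" if "r \<ge> b" for r using anti[OF that] b nz by (auto simp: kfilt_def)
    define f where "f r \<longleftrightarrow> x \<in> kfilt \<pi> F r \<and> r \<ge> p" for r
    have "f p" "\<And>r. r \<ge> b \<Longrightarrow> \<not> f r" using that(2) b0 by (simp_all add: f_def)
    then obtain r where "f r" "\<not> f (r + 1)" using int_exists_last[of f p b] by metis
    then have r: "x \<in> kfilt \<pi> F r \<and> r \<ge> p" "\<not> (x \<in> kfilt \<pi> F (r + 1) \<and> r + 1 \<ge> p)"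
      by (simp_all add: f_def)
    have "x \<in> W (-1)" using r by (auto simp: kfilt_def W1)
    then obtain y where y: "y \<in> kfilt \<pi> F (r + 1)" "vcnj (x - y) \<in> kfilt \<pi> F (- (r + 1))"
      using hl(1)[of x "r + 1"] by blast
    have "y \<in> kfilt \<pi> F r" using kanti[of r "r + 1" y] y(1) by simp
    then have "x - y \<in> kfilt \<pi> F r" using vec.subspace_diff[OF ksub] r(1) by blast
    moreover have "vcnj (x - y) \<in> kfilt \<pi> F (- 1 - r)" using y(2) by (simp add: algebra_simps)
    ultimately have "x - y = 0" using r(1) that(1) by (intro H0[of "x - y" r]) auto
    then show False using y(1) r by simp
  qed
  have W_univ: "W 0 = UNIV" by (simp add: W_eq)
  have F0: "\<exists>x\<in>F 0. \<pi> x = 1"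
  proof -
    \<comment> \<open>The weight 0 splitting at p = 1: the F^1-part is killed by \<pi>, so the
      conjugate of the F^0-part maps to 1.\<close>
    have "e0 \<in> {x + y | x y. x \<in> gr_filt W F 0 1 \<and> y \<in> vcnj ` gr_filt W F 0 0}"
      using mixed_hodge_structure_D(6)[OF mhs, of 0 1] by (simp add: W_univ)
    then obtain x y where xy: "e0 = x + vcnj y" "x \<in> gr_filt W F 0 1" "y \<in> gr_filt W F 0 0" by blast
    have "\<pi> x = 0" using xy(2) F_pos[of 1] W1 unfolding gr_filt_def by (auto simp: pi_all)
    then have "cnj (\<pi> y) = 1" using arg_cong[OF xy(1), of \<pi>] by (simp add: pi_all)
    then have py: "\<pi> y = 1" by (metis complex_cnj_cnj complex_cnj_one)
    obtain a b where "y = a + b" "a \<in> F 0" "\<pi> b = 0" using xy(3) W1 unfolding gr_filt_def by auto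
    then show ?thesis using py by (intro bexI[of _ a]) (auto simp: pi_all)
  qed
  show ?thesis
  proof (unfold_locales)
    show "0 \<le> N" by (rule N)
    show "vec.subspace (kfilt \<pi> F p)" for p by (rule ksub)
    show "\<pi> x = 0" if "x \<in> kfilt \<pi> F p" for x p using that by (simp add: kfilt_def)
    show "x \<in> kfilt \<pi> F p" if "p \<le> r" "x \<in> kfilt \<pi> F r" for p r x using kanti that .
    show "x = 0" if "N \<le> p" "x \<in> kfilt \<pi> F p" for p x using bot that .
    \<comment> \<open>The conjugate summand comes from F^(-p) with - p >= N and vanishes.\<close>
    show "x \<in> kfilt \<pi> F p" if h: "p \<le> - N" "\<pi> x = 0" for p x
    proof -
      obtain y where y: "y \<in> kfilt \<pi> F p" "vcnj (x - y) \<in> kfilt \<pi> F (- p)"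
        using hl(1)[of x p] h(2) by (auto simp: W1)
      have "vcnj (x - y) = 0" by (rule bot[OF _ y(2)]) (use h(1) in simp)
      then have "x - y = 0" by (simp only: vcnj_eq_0)
      then show ?thesis using y(1) by simp
    qed
    show "\<exists>y\<in>kfilt \<pi> F p. vcnj (x - y) \<in> kfilt \<pi> F (- p)" if "\<pi> x = 0" for x p
      using hl(1)[of x p] that by (simp add: W1)
    show "x = 0" if "x \<in> kfilt \<pi> F p" "vcnj x \<in> kfilt \<pi> F (- p)" for x p using hl(2) that .
    show "q x y = 0" if xy: "x \<in> kfilt \<pi> F p" "y \<in> kfilt \<pi> F (- p)" for x p y
      using pl(1)[OF xy] Q(2)[of x y] xy by (simp add: kfilt_def)
    show "0 < Re (ipow p * q x (vcnj x))" if x: "x \<in> hpiece (kfilt \<pi> F) p" "x \<noteq> 0" for x p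
      using pl(2)[of x p] Q(2)[of x "vcnj x"] x by (simp add: hpiece_def kfilt_def)
    show "vec.subspace (F p)" for p by (rule sub)
    show "x \<in> F p" if "p \<le> r" "x \<in> F r" for p r x using anti[OF that(1)] that(2) by blast
    show "\<pi> x = 0" if "1 \<le> p" "x \<in> F p" for p x using F_pos that .
    show "\<exists>x\<in>F 0. \<pi> x = 1" by (rule F0)
    show "W k = (if k < -1 then {0} else if k = -1 then {x. \<pi> x = 0} else UNIV)" for k by (rule W_eq)
    show "Q k 0 0 = 0" if "k < -1" for k using Q(1) that .
    show "Q (-1) x y = q x y" if "\<pi> x = 0" "\<pi> y = 0" for x y using Q(2) that .
    show "Q 0 x y = \<pi> x * \<pi> y" for x y by (rule Q(3))
    show "Q k x y = 0" if "1 \<le> k" for k x y using Q(4) that .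
  qed
qed

section \<open>Invariance of the classifying space\<close>

lemma aut_int_D:
  assumes "g \<in> aut_int W Q"
  shows "invertible g" "real_mat g" "(*v) g ` W k = W k" "x \<in> W k \<Longrightarrow> y \<in> W k \<Longrightarrow> Q k (g *v x) (g *v y) = Q k x y"
    "matrix_inv g *v (g *v x) = x" "g *v (matrix_inv g *v x) = x"
proof -
  show inv: "invertible g" and "real_mat g" and "(*v) g ` W k = W k"
    and "x \<in> W k \<Longrightarrow> y \<in> W k \<Longrightarrow> Q k (g *v x) (g *v y) = Q k x y"
    using assms by (auto simp: aut_int_def GL_int_def intro: real_integral_mat)
  show "matrix_inv g *v (g *v x) = x" "g *v (matrix_inv g *v x) = x"
    using matrix_inv_left_right[OF inv] by (simp_all add: matrix_vector_mul_assoc)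
qed

lemma aut_int_inv:
  assumes g: "g \<in> aut_int W Q"
  shows "matrix_inv g \<in> aut_int W Q"
proof -
  note i = matrix_inv_left_right[OF aut_int_D(1)[OF g]]
  have inv: "invertible (matrix_inv g)" unfolding invertible_def using i by blast
  have "g ** (matrix_inv g ** matrix_inv (matrix_inv g)) = matrix_inv (matrix_inv g)"
    using i by (simp add: matrix_mul_assoc)
  then have ii: "matrix_inv (matrix_inv g) = g" using matrix_inv_left_right(2)[OF inv] by simp
  have W: "(*v) (matrix_inv g) ` W k = W k" for k
  proof -
    have "(*v) (matrix_inv g) ` ((*v) g ` W k) = W k" by (simp add: image_image aut_int_D(5)[OF g])
    then show ?thesis by (simp only: aut_int_D(3)[OF g])
  qed
  have "Q k (matrix_inv g *v x) (matrix_inv g *v y) = Q k x y" if "x \<in> W k" "y \<in> W k" for k x y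
  proof -
    have "matrix_inv g *v x \<in> W k" "matrix_inv g *v y \<in> W k" using W[of k] that by blast+
    from aut_int_D(4)[OF g this] show ?thesis by (simp add: aut_int_D(6)[OF g])
  qed
  then show ?thesis using g inv W by (auto simp: aut_int_def GL_int_def ii)
qed

lemma vcnj_image: "real_mat g \<Longrightarrow> vcnj ` ((*v) g ` S) = (*v) g ` (vcnj ` S)"
  by (simp add: image_image real_mat_def)

lemma gr_filt_subset:
  assumes "weight_filtration W"
  shows "gr_filt W F k p \<subseteq> W k"
proof -
  have "W (k - 1) \<subseteq> W k" using assms by (auto simp: weight_filtration_def mono_def)
  then show ?thesis
    unfolding gr_filt_def using vec.subspace_add[OF weight_filtration_subspace[OF assms]] by blast
qed

text \<open>Local lifts are translates of the fibres by inverse frames. All conditions are expressed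
  by \<open>gr_filt\<close> and \<open>gr_comp\<close>, which commute with g because g is real and
  preserves W.\<close>

lemma classifying_space_invariant:
  assumes F: "F \<in> classifying_space W Q h" and g: "g \<in> aut_int W Q"
  shows "(\<lambda>p. (*v) g ` F p) \<in> classifying_space W Q h"
proof -
  let ?F = "\<lambda>p. (*v) g ` F p"
  have mhs: "mixed_hodge_structure W F" and gp: "graded_polarized W Q F"
    and dim: "\<And>p q. vec.dim (gr_comp W F p q) = h p q + vec.dim (W (p + q - 1))"
    using F by (auto simp: classifying_space_def)
  note D = mixed_hodge_structure_D[OF mhs]
  note aD = aut_int_D[OF g]
  have inj: "inj ((*v) g)" using aD(5) by (rule inj_on_inverseI)
  have surj: "surj ((*v) g)" using aD(6) by (metis surj_def)
  have gr: "gr_filt W ?F k p = (*v) g ` gr_filt W F k p" for k p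
  proof -
    have "?F p \<inter> W k = (*v) g ` (F p \<inter> W k)"
      using aD(3)[of k] image_Int[OF inj, of "F p" "W k"] by simp
    then have "gr_filt W ?F k p = {x + y | x y. x \<in> (*v) g ` (F p \<inter> W k) \<and> y \<in> (*v) g ` W (k - 1)}"
      by (simp add: gr_filt_def aD(3))
    also have "\<dots> = (*v) g ` gr_filt W F k p"
      unfolding gr_filt_def by (fastforce simp: mv_simps image_iff)
    finally show ?thesis .
  qed
  have grc: "gr_comp W ?F p q = (*v) g ` gr_comp W F p q" for p q
    unfolding gr_comp_def gr vcnj_image[OF aD(2)] image_Int[OF inj] ..
  have "mixed_hodge_structure W ?F"
    unfolding mixed_hodge_structure_def
  proof (intro conjI allI)
    show "weight_filtration W" by (rule D(1))
    show "vec.subspace (?F p)" for p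
      by (rule vec.linear_subspace_image[OF matrix_vector_mul_linear_gen D(2)])
    show "antimono ?F" using D(3) by (intro antimonoI) (rule image_mono)
    obtain p0 where "F p0 = UNIV" using D(4) by blast
    then have "?F p0 = UNIV" using surj by simp
    then show "\<exists>p. ?F p = UNIV" ..
    obtain p1 where "F p1 = {0}" using D(5) by blast
    then have "?F p1 = {0}" by simp
    then show "\<exists>p. ?F p = {0}" ..
    fix k p
    have "{x + y | x y. x \<in> gr_filt W ?F k p \<and> y \<in> vcnj ` gr_filt W ?F k (k - p + 1)} =
        (*v) g ` {x + y | x y. x \<in> gr_filt W F k p \<and> y \<in> vcnj ` gr_filt W F k (k - p + 1)}"
      unfolding gr vcnj_image[OF aD(2)]
    proof (intro set_eqI iffI)
      fix w assume "w \<in> {x + y | x y. x \<in> (*v) g ` gr_filt W F k p \<and> y \<in> (*v) g ` vcnj ` gr_filt W F k (k - p + 1)}"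
      then obtain a b where "w = g *v a + g *v b" "a \<in> gr_filt W F k p" "b \<in> vcnj ` gr_filt W F k (k - p + 1)" by blast
      then show "w \<in> (*v) g ` {x + y | x y. x \<in> gr_filt W F k p \<and> y \<in> vcnj ` gr_filt W F k (k - p + 1)}"
        by (intro image_eqI[of _ _ "a + b"]) (simp add: mv_simps, blast)
    next
      fix w assume "w \<in> (*v) g ` {x + y | x y. x \<in> gr_filt W F k p \<and> y \<in> vcnj ` gr_filt W F k (k - p + 1)}"
      then obtain a b where "w = g *v (a + b)" "a \<in> gr_filt W F k p" "b \<in> vcnj ` gr_filt W F k (k - p + 1)" by blast
      then show "w \<in> {x + y | x y. x \<in> (*v) g ` gr_filt W F k p \<and> y \<in> (*v) g ` vcnj ` gr_filt W F k (k - p + 1)}"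
        unfolding mv_simps by blast
    qed
    then show "{x + y | x y. x \<in> gr_filt W ?F k p \<and> y \<in> vcnj ` gr_filt W ?F k (k - p + 1)} = W k"
      by (simp only: D(6) aD(3))
    show "gr_filt W ?F k p \<inter> vcnj ` gr_filt W ?F k (k - p + 1) = W (k - 1)"
      unfolding gr vcnj_image[OF aD(2)] image_Int[OF inj, symmetric] D(7) by (rule aD(3))
  qed
  moreover have "graded_polarized W Q ?F"
    unfolding graded_polarized_def
  proof (intro conjI allI ballI)
    show "graded_forms W Q" using gp unfolding graded_polarized_def by (elim conjE)
    have gp1: "\<And>k p x y. x \<in> gr_filt W F k p \<Longrightarrow> y \<in> gr_filt W F k (k - p + 1) \<Longrightarrow> Q k x y = 0"
      using gp unfolding graded_polarized_def by blast
    have gp2: "\<And>p q x. x \<in> gr_comp W F p q - W (p + q - 1) \<Longrightarrow>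
        Im (\<i> powi (p - q) * Q (p + q) x (vcnj x)) = 0 \<and> Re (\<i> powi (p - q) * Q (p + q) x (vcnj x)) > 0"
      using gp unfolding graded_polarized_def by blast
    note grW = gr_filt_subset[OF D(1), THEN subsetD]
    show "Q k x y = 0" if xy: "x \<in> gr_filt W ?F k p" "y \<in> gr_filt W ?F k (k - p + 1)" for k p x y
    proof -
      obtain a b where ab: "x = g *v a" "y = g *v b" "a \<in> gr_filt W F k p" "b \<in> gr_filt W F k (k - p + 1)"
        using xy unfolding gr by blast
      then show ?thesis using gp1[OF ab(3,4)] aD(4)[OF grW[OF ab(3)] grW[OF ab(4)]] by simp
    qed
    fix p q x
    assume x: "x \<in> gr_comp W ?F p q - W (p + q - 1)"
    then obtain a where a: "x = g *v a" "a \<in> gr_comp W F p q" unfolding grc by blast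
    have "a \<notin> W (p + q - 1)" using x a(1) aD(3)[of "p + q - 1"] by blast
    then have pos: "Im (\<i> powi (p - q) * Q (p + q) a (vcnj a)) = 0 \<and> Re (\<i> powi (p - q) * Q (p + q) a (vcnj a)) > 0"
      using gp2 a(2) by blast
    have "a \<in> W (p + q)" using a(2) grW unfolding gr_comp_def by blast
    moreover have "vcnj a \<in> W (p + q)" by (rule weight_filtration_vcnj[OF D(1)]) fact
    ultimately have "Q (p + q) x (vcnj x) = Q (p + q) a (vcnj a)"
      using aD(2,4) a(1) by (simp add: real_mat_def)
    then show "Im (\<i> powi (p - q) * Q (p + q) x (vcnj x)) = 0"
      "Re (\<i> powi (p - q) * Q (p + q) x (vcnj x)) > 0" using pos by simp_all
  qed
  moreover have "vec.dim (gr_comp W ?F p q) = h p q + vec.dim (W (p + q - 1))" for p q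
    unfolding grc dim[symmetric]
    by (rule vec.dim_image_eq[OF matrix_vector_mul_linear_gen]) (use inj in \<open>auto intro: inj_on_subset\<close>)
  ultimately show ?thesis by (simp add: classifying_space_def)
qed

section \<open>Normal functions\<close>

lemma locally_constant_onE:
  assumes "locally_constant_on U f" "s \<in> U"
  obtains N where "open N" "s \<in> N" "\<And>t. t \<in> N \<inter> U \<Longrightarrow> f t = f s"
proof -
  have "\<exists>N. open N \<and> s \<in> N \<and> (\<forall>t\<in>N \<inter> U. f t = f s)"
    by (rule bspec[OF assms(1)[unfolded locally_constant_on_def] assms(2)])
  then obtain N where "open N" "s \<in> N" "\<forall>t\<in>N \<inter> U. f t = f s" by (elim exE conjE)
  then show thesis by (intro that[of N]) auto
qed

lemma vec1_eq_0: "x = 0 \<longleftrightarrow> x $ 1 = 0" for x :: "complex^1"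
  by (simp add: vec_eq_iff forall_1)

locale normal_function =
  fixes \<A> :: "('s::t2_space, 'd::finite) chart set"
    and H :: "('s, 'm::finite) variation"
    and V :: "('s, 'n::finite) variation"
    and \<iota> :: "'s \<Rightarrow> complex^'m^'n" and pr :: "'s \<Rightarrow> complex^'n^1"
  assumes atlas: "complex_atlas \<A>"
    and H: "vmhs \<A> H" and pure: "pure_of_weight (-1) H"
    and V: "vmhs \<A> V" and extension: "extension_by_Z0 H V \<iota> pr"
begin

abbreviation W :: "'n filtration" where "W \<equiv> weight V"
abbreviation Q :: "'n graded_form" where "Q \<equiv> form V"

lemma V_space: "hodge V s \<in> classifying_space W Q (hodge_number V)"
  using V unfolding vmhs_def by blast

lemma V_mhs: "mixed_hodge_structure W (hodge V s)" "graded_polarized W Q (hodge V s)"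
  using V_space by (auto simp: classifying_space_def)

lemma H_mhs: "mixed_hodge_structure (weight H) (hodge H s)" "graded_polarized (weight H) (form H) (hodge H s)"
  using H unfolding vmhs_def classifying_space_def by blast+

lemma H_W: "weight H k = (if k < -1 then {0} else UNIV)"
  using pure by (simp add: pure_of_weight_def)

lemma iota_morphism: "vmhs_morphism H V \<iota>" and pr_morphism: "vmhs_morphism V Z0 pr"
  using extension unfolding extension_by_Z0_def by blast+

lemma iota_integral: "integral_mat (\<iota> s)" and pr_integral: "integral_mat (pr s)"
  using iota_morphism pr_morphism unfolding vmhs_morphism_def by blast+

lemma iota_W: "\<iota> s *v x \<in> W (-1)"
  using iota_morphism H_W[of "-1"] unfolding vmhs_morphism_def by fastforce

lemma iota_F: "x \<in> hodge H s p \<Longrightarrow> \<iota> s *v x \<in> hodge V s p"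
  using iota_morphism unfolding vmhs_morphism_def by blast

lemma pr_W: "x \<in> W (-1) \<Longrightarrow> pr s *v x = 0"
  using pr_morphism unfolding vmhs_morphism_def by (fastforce simp: Z0_def)

lemma pr_F:
  assumes "p \<ge> 1" "x \<in> hodge V s p"
  shows "pr s *v x = 0"
proof -
  have "(*v) (pr s) ` hodge V s p \<subseteq> hodge Z0 s p" using pr_morphism unfolding vmhs_morphism_def by blast
  then have "pr s *v x \<in> hodge (Z0 :: ('s, 1) variation) s p" using assms(2) by blast
  then show ?thesis using assms(1) by (simp add: Z0_def)
qed

lemma unit_vector: "\<exists>e. integral_vec e \<and> (pr s *v e) $ 1 = 1"
proof -
  have "(*v) (pr s) ` {y. integral_vec y} = {x. integral_vec x}"
    using extension unfolding extension_by_Z0_def by blast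
  moreover have "(\<chi> i. 1) \<in> {x :: complex^1. integral_vec x}" by (simp add: integral_vec_def)
  ultimately have "(\<chi> i. 1) \<in> (*v) (pr s) ` {y. integral_vec y}" by (simp only:)
  then obtain e where "integral_vec e" "(\<chi> i. 1) = pr s *v e" by blast
  then show ?thesis by (intro exI[of _ e]) (simp flip: \<open>(\<chi> i. 1) = pr s *v e\<close>)
qed

text \<open>Exactness is given on lattices. Correcting each unit vector by a multiple of an integral
  lift of 1 gives integral kernel vectors, and x is the combination of these with its own
  coordinates.\<close>

lemma ker_pr:
  assumes "pr s *v x = 0"
  obtains a where "x = \<iota> s *v a"
proof -
  obtain e where e: "integral_vec e" "(pr s *v e) $ 1 = 1" using unit_vector by blast
  have img: "(*v) (\<iota> s) ` {x. integral_vec x} = {y. integral_vec y \<and> pr s *v y = 0}"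
    using extension unfolding extension_by_Z0_def by blast
  define w where "w j = axis j 1 - (pr s *v axis j 1) $ 1 *s e" for j
  have "integral_vec (w j)" for j
  proof -
    have "(pr s *v axis j 1) $ 1 \<in> \<int>"
      using pr_integral[of s] unfolding matrix_vector_axis integral_mat_def by blast
    then show ?thesis using e(1) unfolding w_def integral_vec_def
      by (auto simp: axis_def intro!: Ints_diff Ints_mult)
  qed
  moreover have "pr s *v w j = 0" for j
    unfolding vec1_eq_0 by (simp add: w_def mv_simps e(2))
  ultimately have "w j \<in> (*v) (\<iota> s) ` {x. integral_vec x}" for j unfolding img by simp
  then have "\<exists>a. \<iota> s *v a = w j" for j by (metis imageE)
  then obtain a where a: "\<And>j. \<iota> s *v a j = w j" by metis
  have "(\<Sum>j\<in>UNIV. x $ j * (pr s *v axis j 1) $ 1) = (pr s *v (\<Sum>j\<in>UNIV. x $ j *s axis j 1)) $ 1"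
    by (simp add: mv_sum)
  also have "\<dots> = 0" using assms vec_expand[of x] by simp
  finally have 0: "(\<Sum>j\<in>UNIV. x $ j * (pr s *v axis j 1) $ 1) = 0" .
  have "\<iota> s *v (\<Sum>j\<in>UNIV. x $ j *s a j) = (\<Sum>j\<in>UNIV. x $ j *s w j)" by (simp add: mv_sum a)
  also have "\<dots> = (\<Sum>j\<in>UNIV. x $ j *s axis j 1) - (\<Sum>j\<in>UNIV. x $ j * (pr s *v axis j 1) $ 1) *s e"
    by (simp add: w_def vec.scale_right_diff_distrib sum_subtractf vec.scale_sum_left)
  also have "\<dots> = x" using 0 vec_expand[of x] by simp
  finally show thesis using that by metis
qed

section \<open>The weights of the extension\<close>

lemma W1: "W (-1) = {x. pr s *v x = 0}"
proof (intro set_eqI iffI)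
  fix x assume "x \<in> {x. pr s *v x = 0}"
  then obtain a where "x = \<iota> s *v a" using ker_pr by blast
  then show "x \<in> W (-1)" using iota_W by simp
qed (use pr_W in blast)

lemma iota_form: "Q (-1) (\<iota> s *v x) (\<iota> s *v y) = form H (-1) x y"
  using extension H_W[of "-1"] unfolding extension_by_Z0_def by simp

text \<open>A vector of W_(-2) is in the radical of Q_(-1) on W_(-1), which is the polarized
  structure H, and a polarization is nondegenerate.\<close>

lemma W2: "W (-2) = {0}"
proof -
  have s: "x = 0" if x: "x \<in> W (-2)" for x
  proof -
    fix s :: 's
    have gf: "graded_forms W Q" using V_mhs(2) unfolding graded_polarized_def by blast
    have "W (-2) \<subseteq> W (-1)"
      using mixed_hodge_structure_D(1)[OF V_mhs(1)] unfolding weight_filtration_def mono_def by simp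
    then obtain a where a: "x = \<iota> s *v a" using x ker_pr pr_W by blast
    have "form H (-1) a b = 0" for b
      using graded_forms_D(4)[OF gf, of x "-1" "\<iota> s *v b"] x iota_W a iota_form by simp
    then have "a = 0"
      by (rule pure_polarization_nondegenerate[OF H_mhs, rotated 2]) (simp_all add: H_W)
    then show ?thesis using a by simp
  qed
  then show ?thesis
    using vec.subspace_0[OF weight_filtration_subspace[OF mixed_hodge_structure_D(1)[OF V_mhs(1)]]] by blast
qed

lemma W_mono: "j \<le> k \<Longrightarrow> W j \<subseteq> W k"
  using mixed_hodge_structure_D(1)[OF V_mhs(1)] unfolding weight_filtration_def mono_def by blast

lemma W_sub: "vec.subspace (W k)"
  by (rule weight_filtration_subspace[OF mixed_hodge_structure_D(1)[OF V_mhs(1)]])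

text \<open>Otherwise the one-dimensional quotient by W_(-1) would appear in some weight k0 + 1 >=
  1. That graded piece is the sum of F^1 and the conjugate of F^(k0 + 1), and both lie in the kernel
  of \<open>pr s\<close>.\<close>

lemma W0: "W 0 = UNIV"
proof (rule ccontr)
  fix s :: 's
  assume n: "W 0 \<noteq> UNIV"
  obtain b where b: "W b = UNIV"
    using mixed_hodge_structure_D(1)[OF V_mhs(1)] unfolding weight_filtration_def by blast
  have "\<not> W k \<noteq> UNIV" if "k \<ge> b" for k using W_mono[OF that] b by auto
  then obtain k0 where k0: "W k0 \<noteq> UNIV" "\<not> W (k0 + 1) \<noteq> UNIV" "k0 \<ge> 0"
  proof -
    define f where "f k \<longleftrightarrow> W k \<noteq> UNIV \<and> k \<ge> 0" for k
    have "f 0" "\<And>k. k \<ge> b \<Longrightarrow> \<not> f k" using n \<open>\<And>k. k \<ge> b \<Longrightarrow> \<not> W k \<noteq> UNIV\<close> by (auto simp: f_def)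
    then obtain k where "f k" "\<not> f (k + 1)" using int_exists_last[of f 0 b] by metis
    then show thesis using that[of k] by (auto simp: f_def)
  qed
  have K: "W k0 = W (-1)"
  proof (rule ccontr)
    assume "W k0 \<noteq> W (-1)"
    moreover have sub: "W (-1) \<subseteq> W k0" using k0(3) by (intro W_mono) simp
    ultimately obtain y where y: "y \<in> W k0" "y \<notin> W (-1)" by blast
    then have py: "(pr s *v y) $ 1 \<noteq> 0" unfolding W1[of s] vec1_eq_0[symmetric] by simp
    have "x \<in> W k0" for x
    proof -
      let ?c = "(pr s *v x) $ 1 / (pr s *v y) $ 1"
      have "pr s *v (x - ?c *s y) = 0" unfolding vec1_eq_0 using py by (simp add: mv_simps)
      then have "x - ?c *s y \<in> W k0" using sub W1[of s] by blast
      from vec.subspace_add[OF W_sub this vec.subspace_scale[OF W_sub y(1), of ?c]]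
      show ?thesis by simp
    qed
    then show False using k0(1) by blast
  qed
  have gr: "gr_filt W (hodge V s) (k0 + 1) p \<subseteq> W (-1)" if "p \<ge> 1" for p
  proof -
    have "hodge V s p \<subseteq> W (-1)" using pr_F[OF that] W1[of s] by blast
    then show ?thesis using vec.subspace_add[OF W_sub, of _ "-1"] K unfolding gr_filt_def by auto
  qed
  have v: "vcnj x \<in> W (-1)" if "x \<in> W (-1)" for x
    by (rule weight_filtration_vcnj[OF mixed_hodge_structure_D(1)[OF V_mhs(1)] that])
  have "W (k0 + 1) \<subseteq> W (-1)"
    unfolding mixed_hodge_structure_D(6)[OF V_mhs(1)[of s], of "k0 + 1" 1, symmetric]
  proof
    fix x assume "x \<in> {x + y | x y. x \<in> gr_filt W (hodge V s) (k0 + 1) 1 \<and>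
        y \<in> vcnj ` gr_filt W (hodge V s) (k0 + 1) (k0 + 1 - 1 + 1)}"
    then obtain a b where ab: "x = a + vcnj b" "a \<in> gr_filt W (hodge V s) (k0 + 1) 1"
      "b \<in> gr_filt W (hodge V s) (k0 + 1) (k0 + 1 - 1 + 1)" by blast
    have "a \<in> W (-1)" "b \<in> W (-1)" using ab(2,3) gr[of 1] gr[of "k0 + 1 - 1 + 1"] k0(3) by auto
    then show "x \<in> W (-1)" using ab(1) vec.subspace_add[OF W_sub] v by blast
  qed
  then show False using k0(1,2) K by auto
qed

lemma W_eq: "W k = (if k < -1 then {0} else if k = -1 then {x. pr s *v x = 0} else UNIV)"
proof -
  consider "k < -1" | "k = -1" | "k \<ge> 0" by linarith
  then show ?thesis
  proof cases
    case 1
    then have "W k \<subseteq> {0}" using W_mono[of k "-2"] W2 by simp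
    then show ?thesis using 1 vec.subspace_0[OF W_sub, of k] by auto
  next
    case 2
    then show ?thesis using W1 by simp
  next
    case 3
    then show ?thesis using W_mono[OF 3] W0 by auto
  qed
qed

lemma graded_forms_Q: "graded_forms W Q"
  using V_mhs(2) unfolding graded_polarized_def by blast

lemma Q0: "Q 0 x y = (pr s *v x) $ 1 * (pr s *v y) $ 1"
proof -
  have "\<forall>s. \<forall>x\<in>W 0. \<forall>y\<in>W 0. Q 0 x y = form (Z0 :: ('s, 1) variation) 0 (pr s *v x) (pr s *v y)"
    using extension unfolding extension_by_Z0_def by (elim conjE)
  then show ?thesis unfolding W0 by (simp add: Z0_def)
qed

text \<open>Hodge numbers are the same for all fibres, so one arbitrary fibre gives a bound for
  all.\<close>

lemma hodge_number_bound:
  obtains N where "N \<ge> 0" "\<And>p. N \<le> p \<or> p < - N \<Longrightarrow> hodge_number V p (- 1 - p) = 0"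
proof -
  fix s :: 's
  let ?F = "hodge V s"
  obtain b where b: "?F b = {0}" using mixed_hodge_structure_D(5)[OF V_mhs(1)] by blast
  define N where "N = \<bar>b\<bar>"
  have F0: "?F p \<subseteq> {0}" if "p \<ge> N" for p
    using mixed_hodge_structure_D(3)[OF V_mhs(1), of b p s] b that by (simp add: N_def)
  have gr: "gr_filt W ?F (-1) p \<subseteq> {0}" if "p \<ge> N" for p
    using F0[OF that] gr_filt_lowest[of W "-1" ?F p] W2 by auto
  have "hodge_number V p (- 1 - p) = 0" if "N \<le> p \<or> p < - N" for p
  proof -
    have w: "p + (- 1 - p) = -1" by simp
    have "gr_comp W ?F p (- 1 - p) \<subseteq> {0}"
      using that
    proof
      assume "N \<le> p"
      then show ?thesis using gr[of p] unfolding gr_comp_def w by blast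
    next
      assume "p < - N"
      then have "vcnj ` gr_filt W ?F (-1) (- 1 - p) \<subseteq> {0}" using gr[of "- 1 - p"] by auto
      then show ?thesis unfolding gr_comp_def w by blast
    qed
    then have "vec.dim (gr_comp W ?F p (- 1 - p)) = 0" by (simp add: vec.dim_eq_0)
    moreover have "vec.dim (gr_comp W ?F p (- 1 - p)) = hodge_number V p (- 1 - p) + vec.dim (W (p + (- 1 - p) - 1))"
      using V_space unfolding classifying_space_def by blast
    ultimately show ?thesis by simp
  qed
  then show thesis using that[of N] by (simp add: N_def)
qed

section \<open>Local lifts of the period map\<close>

lemma chart:
  assumes "c \<in> \<A>"
  shows "open (fst c)" "open (snd c ` fst c)"
    "homeomorphism (fst c) (snd c ` fst c) (snd c) (inv_into (fst c) (snd c))"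
proof -
  have "\<forall>(U, \<phi>)\<in>\<A>. open U \<and> open (\<phi> ` U) \<and> homeomorphism U (\<phi> ` U) \<phi> (inv_into U \<phi>)"
    using atlas unfolding complex_atlas_def by blast
  then show "open (fst c)" "open (snd c ` fst c)"
    "homeomorphism (fst c) (snd c ` fst c) (snd c) (inv_into (fst c) (snd c))"
    using assms by (auto simp: split_beta)
qed

lemma lift_point:
  assumes c: "c \<in> \<A>" and z: "z \<in> lift_domain c f"
  obtains s where "s \<in> fst c" "s \<in> fst f" "z = snd c s" "inv_into (fst c) (snd c) z = s"
proof -
  obtain s where s: "s \<in> fst c" "s \<in> fst f" "z = snd c s" using z unfolding lift_domain_def by blast
  have "inv_into (fst c) (snd c) z = s" using homeomorphism_apply1[OF chart(3)[OF c]] s by simp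
  then show thesis using that s by blast
qed

lemma chart_open_image:
  assumes c: "c \<in> \<A>" and S: "open S" "S \<subseteq> fst c"
  shows "open (snd c ` S)"
proof -
  have "openin (top_of_set (fst c)) S" using S chart(1)[OF c] by (simp add: openin_open_eq)
  then have "openin (top_of_set (snd c ` fst c)) (snd c ` S)"
    by (rule homeomorphism_imp_open_map[OF chart(3)[OF c]])
  then show ?thesis using chart(2)[OF c] openin_open_eq by blast
qed

lemma V_frame:
  assumes "f \<in> frames V"
  shows "open (fst f)" "s \<in> fst f \<Longrightarrow> snd f s \<in> aut_int W Q"
proof -
  have "\<forall>(U, g)\<in>frames V. open U \<and> (\<forall>s\<in>U. g s \<in> aut_int W Q)" using V unfolding vmhs_def by blast
  then show "open (fst f)" "s \<in> fst f \<Longrightarrow> snd f s \<in> aut_int W Q" using assms by (auto simp: split_beta)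
qed

lemma period_lift_eq: "inv_into (fst c) (snd c) z = s \<Longrightarrow>
    period_lift V c f z = (\<lambda>p. (*v) (matrix_inv (snd f s)) ` hodge V s p)"
  by (intro ext) (simp add: period_lift_def Let_def)

text \<open>The functional and the vector are taken from one base point. They serve every chart and
  frame because the kernel of \<open>pr s\<close> is W_(-1) for all s.\<close>

lemma family:
  obtains \<pi> e0 q N where "\<And>c f. c \<in> \<A> \<Longrightarrow> f \<in> frames V \<Longrightarrow>
      period_family \<pi> e0 q (lift_domain c f) (period_lift V c f) N W Q"
    "\<And>x. \<pi> x = 0 \<longleftrightarrow> x \<in> W (-1)"
proof -
  fix s0 :: 's
  define \<pi> where "\<pi> x = (pr s0 *v x) $ 1" for x
  obtain e0 where e0: "integral_vec e0" "\<pi> e0 = 1" using unit_vector[of s0] by (auto simp: \<pi>_def)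
  \<comment> \<open>Projection to W_(-1), used to extend Q_(-1), whose values outside W_(-1) are
    arbitrary, to a bilinear form on the whole space.\<close>
  define k where "k x = x - \<pi> x *s e0" for x
  define q where "q x y = Q (-1) (k x) (k y)" for x y
  have p_add: "\<pi> (x + y) = \<pi> x + \<pi> y" and p_scale: "\<pi> (c *s x) = c * \<pi> x" for x y c
    by (simp_all add: \<pi>_def mv_simps)
  have p_diff: "\<pi> (x - y) = \<pi> x - \<pi> y" for x y by (simp add: \<pi>_def mv_simps)
  have p_cnj: "\<pi> (vcnj x) = cnj (\<pi> x)" for x
  proof -
    have "vcnj (pr s0 *v x) = pr s0 *v vcnj x"
      using real_integral_mat[OF pr_integral] unfolding real_mat_def by blast
    from arg_cong[OF this, of "\<lambda>y::complex^1. y $ 1"] show ?thesis by (simp add: \<pi>_def vcnj_def)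
  qed
  have pK: "\<pi> x = 0 \<longleftrightarrow> x \<in> W (-1)" for x unfolding W1[of s0] \<pi>_def by (simp add: vec1_eq_0)
  have kK: "k x \<in> W (-1)" for x using e0(2) by (simp add: k_def p_diff p_scale flip: pK)
  have k_add: "k (x + y) = k x + k y" and k_scale: "k (c *s x) = c *s k x" and k_cnj: "k (vcnj x) = vcnj (k x)"
    for x y c
    by (simp_all add: k_def p_add p_scale p_cnj vec.scale_left_distrib vec.scale_right_diff_distrib
        vcnj_integral[OF e0(1)])
  have hs: "hs_space \<pi> e0 q"
  proof
    show "\<pi> (x + y) = \<pi> x + \<pi> y" "\<pi> (c *s x) = c * \<pi> x" "\<pi> (vcnj x) = cnj (\<pi> x)" for x y c
      by (rule p_add p_scale p_cnj)+
    show "\<pi> e0 = 1" "vcnj e0 = e0" using e0 vcnj_integral by auto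
    show "q (x + y) z = q x z + q y z" "q (c *s x) z = c * q x z" for x y z c
      using graded_forms_D(1)[OF graded_forms_Q kK kK kK] graded_forms_D(2)[OF graded_forms_Q kK kK]
      by (simp_all add: q_def k_add k_scale)
    show "q y x = - q x y" for x y
      using graded_forms_D(3)[OF graded_forms_Q kK kK, of y x] by (simp add: q_def)
    show "q (vcnj x) (vcnj y) = cnj (q x y)" for x y
      unfolding q_def k_cnj
      by (rule graded_forms_cnj[OF mixed_hodge_structure_D(1)[OF V_mhs(1)] graded_forms_Q kK kK])
  qed
  obtain N where N: "N \<ge> 0" "\<And>p. N \<le> p \<or> p < - N \<Longrightarrow> hodge_number V p (- 1 - p) = 0"
    using hodge_number_bound by metis
  have We: "W k = (if k < -1 then {0} else if k = -1 then {x. \<pi> x = 0} else UNIV)" for k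
    using W_eq[of k s0] by (simp add: \<pi>_def vec1_eq_0)
  have pmh: "polarized_mixed_hs \<pi> e0 q F N W Q"
    if F: "F \<in> classifying_space W Q (hodge_number V)" and pos: "\<And>p x. p \<ge> 1 \<Longrightarrow> x \<in> F p \<Longrightarrow> x \<in> W (-1)" for F
  proof (rule polarized_mixed_hsI[OF hs N(1) We])
    show "Q k 0 0 = 0" if "k < -1" for k
      using graded_forms_D(2)[OF graded_forms_Q, of 0 k 0 0] vec.subspace_0[OF W_sub] by simp
    show "Q (-1) x y = q x y" if "\<pi> x = 0" "\<pi> y = 0" for x y by (simp add: q_def k_def that)
    show "Q 0 x y = \<pi> x * \<pi> y" for x y unfolding \<pi>_def by (rule Q0)
    show "Q k x y = 0" if "k \<ge> 1" for k x y
      by (rule graded_forms_D(4)[OF graded_forms_Q]) (use that in \<open>simp_all add: We\<close>)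
    show "mixed_hodge_structure W F" "graded_polarized W Q F" using F by (auto simp: classifying_space_def)
    show "\<pi> x = 0" if "p \<ge> 1" "x \<in> F p" for p x using pos[OF that] pK by blast
    fix p assume p: "N \<le> p \<or> p < - N"
    have "vec.dim (gr_comp W F p (- 1 - p)) = hodge_number V p (- 1 - p) + vec.dim (W (p + (- 1 - p) - 1))"
      using F unfolding classifying_space_def by blast
    then have "vec.dim (gr_comp W F p (- 1 - p)) = 0" using N(2)[OF p] W2 by simp
    then show "gr_comp W F p (- 1 - p) \<subseteq> {0}" by (simp add: vec.dim_eq_0)
  qed
  have "period_family \<pi> e0 q (lift_domain c f) (period_lift V c f) N W Q"
    if c: "c \<in> \<A>" and f: "f \<in> frames V" for c f
  proof (intro period_family.intro[OF hs] period_family_axioms.intro)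
    show "open (lift_domain c f)"
      unfolding lift_domain_def using chart(1)[OF c] V_frame(1)[OF f] by (intro chart_open_image[OF c]) auto
    have "\<forall>c\<in>\<A>. \<forall>f\<in>frames V.
        holomorphic_filtration (lift_domain c f) (period_lift V c f) \<and>
        griffiths_transversal (lift_domain c f) (period_lift V c f)"
      using V unfolding vmhs_def by (elim conjE)
    then show "holomorphic_filtration (lift_domain c f) (period_lift V c f)"
      "griffiths_transversal (lift_domain c f) (period_lift V c f)" using c f by auto
    fix z assume "z \<in> lift_domain c f"
    then obtain s where s: "s \<in> fst f" "inv_into (fst c) (snd c) z = s" using lift_point[OF c] by metis
    have a: "matrix_inv (snd f s) \<in> aut_int W Q" by (rule aut_int_inv[OF V_frame(2)[OF f s(1)]])
    show "polarized_mixed_hs \<pi> e0 q (period_lift V c f z) N W Q"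
      unfolding period_lift_eq[OF s(2)]
    proof (rule pmh[OF classifying_space_invariant[OF V_space a]])
      fix p :: int and x assume "1 \<le> p" "x \<in> (*v) (matrix_inv (snd f s)) ` hodge V s p"
      then have "x \<in> (*v) (matrix_inv (snd f s)) ` W (-1)" using pr_F W1[of s] by blast
      then show "x \<in> W (-1)" using aut_int_D(3)[OF a] by blast
    qed
  qed
  then show thesis using that pK by blast
qed

text \<open>Strictness of the inclusion. Splitting a preimage in H, the image of the remainder lies
  in F^p and in the conjugate of F^(-p) of V on W_(-1), hence is zero.\<close>

lemma hodge_V_W1: "hodge V s p \<inter> W (-1) = (*v) (\<iota> s) ` hodge H s p"
proof
  show "(*v) (\<iota> s) ` hodge H s p \<subseteq> hodge V s p \<inter> W (-1)" using iota_F iota_W by blast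
  show "hodge V s p \<inter> W (-1) \<subseteq> (*v) (\<iota> s) ` hodge H s p"
  proof
    fix x assume x: "x \<in> hodge V s p \<inter> W (-1)"
    then obtain a where a: "x = \<iota> s *v a" using ker_pr pr_W by blast
    obtain b where b: "b \<in> hodge H s p" "vcnj (a - b) \<in> hodge H s (- p)"
      using hodge_lowest_weight(1)[OF H_mhs(1), where x = a and p = p] by (auto simp: H_W)
    have r: "vcnj (\<iota> s *v y) = \<iota> s *v vcnj y" for y
      using real_integral_mat[OF iota_integral] unfolding real_mat_def by blast
    have "x - \<iota> s *v b \<in> hodge V s p \<inter> W (-1)"
      using x vec.subspace_diff[OF mixed_hodge_structure_D(2)[OF V_mhs(1)]] vec.subspace_diff[OF W_sub] iota_F[OF b(1)] iota_W
      by blast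
    moreover have "vcnj (x - \<iota> s *v b) \<in> hodge V s (- p) \<inter> W (-1)"
    proof -
      have "vcnj (x - \<iota> s *v b) = \<iota> s *v vcnj (a - b)" unfolding a by (simp only: r flip: mv_simps)
      then show ?thesis using iota_F[OF b(2)] iota_W by simp
    qed
    ultimately have "x - \<iota> s *v b = 0" by (rule hodge_lowest_weight(2)[OF V_mhs(1) W2])
    then show "x \<in> (*v) (\<iota> s) ` hodge H s p" using b(1) by auto
  qed
qed

text \<open>In flat frames the inclusion (L) and the constant trivialization of H (M) are locally
  constant matrices, and together they carry one fixed filtration to the lift on W_(-1).\<close>

lemma locally_constant_hodge:
  assumes const: "constant_variation H" and c: "c \<in> \<A>" and f: "f \<in> frames V" and z: "z \<in> lift_domain c f"
  obtains B where "open B" "z \<in> B" "B \<subseteq> lift_domain c f"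
    "\<And>x p. x \<in> B \<Longrightarrow> period_lift V c f x p \<inter> W (-1) = period_lift V c f z p \<inter> W (-1)"
proof -
  obtain g where g: "\<And>s. g s \<in> GL_int"
    "\<forall>(U, f)\<in>frames H. locally_constant_on U (\<lambda>s. matrix_inv (f s) ** g s)"
    "\<And>s t p. (*v) (matrix_inv (g s)) ` hodge H s p = (*v) (matrix_inv (g t)) ` hodge H t p"
    using const unfolding constant_variation_def by blast
  obtain s where s: "s \<in> fst c" "s \<in> fst f" "z = snd c s" "inv_into (fst c) (snd c) z = s"
    using lift_point[OF c z] by blast
  have "\<Union>(fst ` frames H) = UNIV" using H unfolding vmhs_def by blast
  then obtain fH where fH: "fH \<in> frames H" "s \<in> fst fH" by blast
  have "\<forall>(U, g)\<in>frames H. open U \<and> (\<forall>s\<in>U. g s \<in> aut_int (weight H) (form H))"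
    using H unfolding vmhs_def by blast
  then have fH': "open (fst fH)" "\<And>t. t \<in> fst fH \<Longrightarrow> snd fH t \<in> aut_int (weight H) (form H)"
    using fH(1) by (auto simp: split_beta)
  have lc1: "locally_constant_on (fst fH) (\<lambda>s. matrix_inv (snd fH s) ** g s)"
    using bspec[OF g(2) fH(1)] by (simp add: split_beta)
  obtain N1 where N1: "open N1" "s \<in> N1"
    "\<And>t. t \<in> N1 \<inter> fst fH \<Longrightarrow> matrix_inv (snd fH t) ** g t = matrix_inv (snd fH s) ** g s"
    by (rule locally_constant_onE[OF lc1 fH(2)], rule that)
  have "\<forall>(U, f)\<in>frames H. \<forall>(U', g)\<in>frames V.
      locally_constant_on (U \<inter> U') (\<lambda>s. matrix_inv (g s) ** (\<iota> s ** f s))"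
    using iota_morphism unfolding vmhs_morphism_def by (elim conjE)
  then have lc2: "locally_constant_on (fst fH \<inter> fst f) (\<lambda>s. matrix_inv (snd f s) ** (\<iota> s ** snd fH s))"
    using fH(1) f by (auto simp: split_beta)
  have sH: "s \<in> fst fH \<inter> fst f" using fH(2) s(2) by simp
  obtain N2 where N2: "open N2" "s \<in> N2"
    "\<And>t. t \<in> N2 \<inter> (fst fH \<inter> fst f) \<Longrightarrow> matrix_inv (snd f t) ** (\<iota> t ** snd fH t) = matrix_inv (snd f s) ** (\<iota> s ** snd fH s)"
    by (rule locally_constant_onE[OF lc2 sH], rule that)
  define S where "S = N1 \<inter> N2 \<inter> fst fH \<inter> fst f \<inter> fst c"
  have oS: "open S" unfolding S_def using chart(1)[OF c] N1(1) N2(1) fH'(1) V_frame(1)[OF f] by auto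
  define L where "L = matrix_inv (snd f s) ** (\<iota> s ** snd fH s)"
  define M where "M = matrix_inv (snd fH s) ** g s"
  have eq: "period_lift V c f (snd c t) p \<inter> W (-1) = (*v) (L ** M) ` ((*v) (matrix_inv (g s)) ` hodge H s p)"
    if t: "t \<in> S" for t p
  proof -
    have tc: "t \<in> fst c" "t \<in> fst f" "t \<in> fst fH" using t by (auto simp: S_def)
    have it: "inv_into (fst c) (snd c) (snd c t) = t" by (rule homeomorphism_apply1[OF chart(3)[OF c] tc(1)])
    have a: "snd f t \<in> aut_int W Q" by (rule V_frame(2)[OF f tc(2)])
    note ai = aut_int_inv[OF a]
    have "period_lift V c f (snd c t) p \<inter> W (-1) = (*v) (matrix_inv (snd f t)) ` (hodge V t p \<inter> W (-1))"
    proof -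
      have "inj ((*v) (matrix_inv (snd f t)))" using aut_int_D(5)[OF ai] by (rule inj_on_inverseI)
      from image_Int[OF this] show ?thesis
        unfolding period_lift_eq[OF it] by (simp add: aut_int_D(3)[OF ai])
    qed
    also have "\<dots> = (*v) (matrix_inv (snd f t) ** \<iota> t) ` hodge H t p"
      unfolding hodge_V_W1 image_image by (simp add: matrix_vector_mul_assoc)
    \<comment> \<open>The flat frame of H cancels between L and M, and the trivialization cancels
      against its inverse.\<close>
    also have "matrix_inv (snd f t) ** \<iota> t = (L ** M) ** matrix_inv (g t)"
    proof -
      have "L ** M = (matrix_inv (snd f t) ** (\<iota> t ** snd fH t)) ** (matrix_inv (snd fH t) ** g t)"
        unfolding L_def M_def using N1(3)[of t] N2(3)[of t] t by (simp add: S_def)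
      also have "\<dots> = matrix_inv (snd f t) ** \<iota> t ** (snd fH t ** matrix_inv (snd fH t)) ** g t"
        by (simp only: matrix_mul_assoc)
      also have "snd fH t ** matrix_inv (snd fH t) = mat 1"
        by (rule matrix_inv_left_right(2)[OF aut_int_D(1)[OF fH'(2)[OF tc(3)]]])
      finally have "(L ** M) ** matrix_inv (g t) = matrix_inv (snd f t) ** \<iota> t ** (g t ** matrix_inv (g t))"
        by (simp add: matrix_mul_assoc)
      also have "g t ** matrix_inv (g t) = mat 1"
        by (rule matrix_inv_left_right(2)) (use g(1) in \<open>simp add: GL_int_def\<close>)
      finally show ?thesis by simp
    qed
    also have "(*v) ((L ** M) ** matrix_inv (g t)) ` hodge H t p = (*v) (L ** M) ` ((*v) (matrix_inv (g t)) ` hodge H t p)"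
      by (simp add: image_image matrix_vector_mul_assoc)
    also have "(*v) (matrix_inv (g t)) ` hodge H t p = (*v) (matrix_inv (g s)) ` hodge H s p" by (rule g(3))
    finally show ?thesis .
  qed
  have sS: "s \<in> S" using s fH N1 N2 by (simp add: S_def)
  show thesis
  proof (rule that[of "snd c ` S"])
    show "open (snd c ` S)" by (rule chart_open_image[OF c oS]) (auto simp: S_def)
    show "z \<in> snd c ` S" using s(3) sS by blast
    show "snd c ` S \<subseteq> lift_domain c f" by (auto simp: S_def lift_domain_def)
    fix x p assume "x \<in> snd c ` S"
    then obtain t where "t \<in> S" "x = snd c t" by blast
    then show "period_lift V c f x p \<inter> W (-1) = period_lift V c f z p \<inter> W (-1)"
      using eq[of t p] eq[OF sS, of p] s(3) by (simp only:)
  qed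
qed

end

theorem mainTheorem6:
  fixes \<A> :: "('s::t2_space, 'd::finite) chart set"
    and H :: "('s, 'm::finite) variation"
    and V :: "('s, 'n::finite) variation"
    and \<iota> :: "'s \<Rightarrow> complex^'m^'n" and \<pi> :: "'s \<Rightarrow> complex^'n^1"
  assumes "complex_atlas \<A>"
    and "vmhs \<A> H" and "pure_of_weight (-1) H"
    and "vmhs \<A> V" and "extension_by_Z0 H V \<iota> \<pi>"
  shows "(\<forall>c\<in>\<A>. \<forall>f\<in>frames V. pseudo_kaehler_on (lift_domain c f) (pullback_metric V c f)) \<and>
    (constant_variation H \<longrightarrow>
       (\<forall>c\<in>\<A>. \<forall>f\<in>frames V. \<forall>z\<in>lift_domain c f.
          nondegenerate_form (pullback_metric V c f z) \<longrightarrow>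
          (\<forall>v. v \<noteq> 0 \<longrightarrow> hol_sectional_curvature (pullback_metric V c f) z v \<le> 0)))"
proof -
  interpret nf: normal_function \<A> H V \<iota> \<pi> by (rule normal_function.intro) (rule assms)+
  \<comment> \<open>\<rho> is a functional on the fixed space with kernel W_(-1), replacing the
    projections that vary with the base point.\<close>
  obtain \<rho> e0 q N where fam: "\<And>c f. c \<in> \<A> \<Longrightarrow> f \<in> frames V \<Longrightarrow>
      period_family \<rho> e0 q (lift_domain c f) (period_lift V c f) N (weight V) (form V)"
    and rho: "\<And>x. \<rho> x = 0 \<longleftrightarrow> x \<in> weight V (-1)"
    using nf.family by blast
  show ?thesis
  proof (intro conjI ballI impI allI)
    fix c f assume cf: "c \<in> \<A>" "f \<in> frames V"
    interpret p: period_family \<rho> e0 q "lift_domain c f" "period_lift V c f" N "weight V" "form V"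
      by (rule fam[OF cf])
    have eq: "pullback_metric V c f z v w = p.g z v w" if "z \<in> lift_domain c f" for z v w
      by (simp add: pullback_metric_def Let_def p.period_derivative_eq[OF that])
    show "pseudo_kaehler_on (lift_domain c f) (pullback_metric V c f)"
      by (rule pseudo_kaehler_on_cong[OF p.open_A eq p.g_pseudo_kaehler])
    fix z v
    assume z: "z \<in> lift_domain c f" and const: "constant_variation H"
      and nd: "nondegenerate_form (pullback_metric V c f z)"
    obtain B where B: "open B" "z \<in> B" "B \<subseteq> lift_domain c f"
      "\<And>x p. x \<in> B \<Longrightarrow> period_lift V c f x p \<inter> weight V (-1) = period_lift V c f z p \<inter> weight V (-1)"
      using nf.locally_constant_hodge[OF const cf z] by metis
    have "kfilt \<rho> (period_lift V c f x) = kfilt \<rho> (period_lift V c f z)" if "x \<in> B" for x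
      using B(4)[OF that] by (intro ext) (auto simp: kfilt_def rho)
    then show "hol_sectional_curvature (pullback_metric V c f) z v \<le> 0"
      by (rule p.curvature_constant[OF z B(1-3) _ eq nd])
  qed
qed

end
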